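(* Let $m\ge 1$ and $n\ge 1$ be integers, let $K$ be a field, let $X=(x_{ij})$ be an $(m\times n)$-matrix of indeterminates, and let $S=K[x_{ij}: 1\le i\le m,\ 1\le j\le n]$. Let $C$ be an $m$-uniform clutter on the vertex set $[n]=\{1,\ldots,n\}$, with determinantal facet ideal $J_C\subset S$ and clique complex $\Delta(C)$. Then $$\beta_{i,i+m}(J_C)=\binom{m+i-1}{m-1} f_{m+i-1}(\Delta(C))$$ for all $i\ge 0$.
   Context: $S$ is standard graded ($\deg x_{ij}=1$), and $\beta_{i,j}(J_C)=\dim_K\operatorname{Tor}_i^S(K,J_C)_j$ are the graded Betti numbers of $J_C$ as an $S$-module. A clutter $C$ on $[n]$ is a collection of subsets of $[n]$ (called circuits) with no containment between its elements; every vertex in $[n]$ is assumed to belong to some circuit. $C$ is $m$-uniform if all circuits have cardinality $m$. A clique of $C$ is a subset $\sigma\subseteq[n]$ such that each $m$-subset of $\sigma$ is a circuit of $C$; the clique complex $\Delta(C)$ is the simplicial complex whose faces are the cliques of $C$. The determinantal facet ideal $J_C\subset S$ is the ideal generated by the $m$-minors $\mathbf{m}_\tau$ of $X$, $\tau\in C$, where for $\tau=\{j_1<\cdots<j_m\}$, $\mathbf{m}_\tau$ is the minor of $X$ with columns $j_1,\ldots,j_m$. For a simplicial complex $\Delta$, $f_t(\Delta)$ is the number of faces of $\Delta$ of dimension $t$ (i.e. of cardinality $t+1$), which is $0$ for $t>\dim\Delta$. *)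

theory Defs
  imports
    "HOL-Library.Poly_Mapping"
    "HOL-Library.Function_Algebras"
    "Jordan_Normal_Form.Determinant"
begin

text \<open>
  Polynomials over \<open>'k\<close> in variables \<open>x\<^bsub>(a,b)\<^esub>\<close> indexed by all pairs of naturals: finitely supported
  maps from exponent vectors to coefficients. The ring \<open>S = K[x\<^sub>a\<^sub>b : 1 \<le> a \<le> m, 1 \<le> b \<le> n]\<close> is the
  subring \<open>polyring m n\<close>.
\<close>

type_synonym 'k xpoly = "((nat \<times> nat) \<Rightarrow>\<^sub>0 nat) \<Rightarrow>\<^sub>0 'k"

definition polyring :: "nat \<Rightarrow> nat \<Rightarrow> 'k::field xpoly set" where
  "polyring m n = {p. \<forall>t \<in> Poly_Mapping.keys p. Poly_Mapping.keys t \<subseteq> {1..m} \<times> {1..n}}"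

definition xvar :: "nat \<Rightarrow> nat \<Rightarrow> 'k::field xpoly" where
  "xvar a b = Poly_Mapping.single (Poly_Mapping.single (a, b) 1) 1"

definition xconst :: "'k::field \<Rightarrow> 'k xpoly" where
  "xconst c = Poly_Mapping.single 0 c"

definition mon_degree :: "((nat \<times> nat) \<Rightarrow>\<^sub>0 nat) \<Rightarrow> nat" where
  "mon_degree t = (\<Sum>v \<in> Poly_Mapping.keys t. Poly_Mapping.lookup t v)"

text \<open>Degrees are integers; \<open>0\<close> is homogeneous of every degree, and the only element of negative degree.\<close>

definition homogeneous :: "int \<Rightarrow> 'k::field xpoly \<Rightarrow> bool" where
  "homogeneous d p \<longleftrightarrow> (\<forall>t \<in> Poly_Mapping.keys p. int (mon_degree t) = d)"

definition ideal_gen :: "nat \<Rightarrow> nat \<Rightarrow> 'k::field xpoly set \<Rightarrow> 'k xpoly set" where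
  "ideal_gen m n G =
    {(\<Sum>g\<in>A. q g * g) | A q. finite A \<and> A \<subseteq> G \<and> (\<forall>g\<in>A. q g \<in> polyring m n)}"


definition clutter :: "nat \<Rightarrow> nat set set \<Rightarrow> bool" where
  "clutter n C \<longleftrightarrow>
    C \<subseteq> Pow {1..n} \<and> (\<forall>\<sigma>\<in>C. \<forall>\<tau>\<in>C. \<sigma> \<subseteq> \<tau> \<longrightarrow> \<sigma> = \<tau>) \<and> \<Union>C = {1..n}"

definition uniform :: "nat \<Rightarrow> nat set set \<Rightarrow> bool" where
  "uniform m C \<longleftrightarrow> (\<forall>\<tau>\<in>C. card \<tau> = m)"

text \<open>The clique complex of an \<open>m\<close>-uniform clutter. Sets with fewer than \<open>m\<close> vertices are cliques vacuously.\<close>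

definition clique_complex :: "nat \<Rightarrow> nat \<Rightarrow> nat set set \<Rightarrow> nat set set" where
  "clique_complex m n C = {\<sigma>. \<sigma> \<subseteq> {1..n} \<and> (\<forall>\<tau>. \<tau> \<subseteq> \<sigma> \<and> card \<tau> = m \<longrightarrow> \<tau> \<in> C)}"

definition face_number :: "nat \<Rightarrow> nat set set \<Rightarrow> nat" where
  "face_number t \<Delta> = card {\<sigma> \<in> \<Delta>. card \<sigma> = t + 1}"

text \<open>
  The minor of the generic matrix on all \<open>m\<close> rows and the columns in \<open>\<tau>\<close>, in increasing order
  (matrices are indexed from \<open>0\<close>, variables from \<open>1\<close>).
\<close>

definition minor :: "nat \<Rightarrow> nat set \<Rightarrow> 'k::field xpoly" where
  "minor m \<tau> = det (mat m m (\<lambda>(a, b). xvar (a + 1) (sorted_list_of_set \<tau> ! b)))"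

definition det_facet_ideal :: "nat \<Rightarrow> nat \<Rightarrow> nat set set \<Rightarrow> 'k::field xpoly set" where
  "det_facet_ideal m n C = ideal_gen m n (minor m ` C)"


text \<open>
  Complexes \<open>\<dots> \<rightarrow> F\<^sub>2 \<rightarrow> F\<^sub>1 \<rightarrow> F\<^sub>0 \<rightarrow> K\<close> of graded free \<open>S\<close>-modules of finite rank, given by chosen
  homogeneous bases: \<open>F\<^sub>i\<close> has basis \<open>e\<^sub>0, \<dots>, e\<^bsub>crank i - 1\<^esub>\<close> with \<open>e\<^sub>l\<close> of degree \<open>cdeg i l\<close>; \<open>cmat i\<close> is
  the matrix of \<open>F\<^bsub>i+1\<^esub> \<rightarrow> F\<^sub>i\<close>, sending \<open>e\<^sub>l\<close> to \<open>\<Sum>\<^sub>k cmat i k l \<cdot> e\<^sub>k\<close>; the augmentation \<open>F\<^sub>0 \<rightarrow> K\<close>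
  sends \<open>e\<^sub>k\<close> to \<open>caug k\<close>.
\<close>

record (overloaded) 'k free_complex =
  crank :: "nat \<Rightarrow> nat"
  cdeg :: "nat \<Rightarrow> nat \<Rightarrow> int"
  cmat :: "nat \<Rightarrow> nat \<Rightarrow> nat \<Rightarrow> 'k xpoly"
  caug :: "nat \<Rightarrow> 'k"

text \<open>
  For an \<open>S\<close>-submodule \<open>M\<close> of \<open>S\<close>, the module \<open>F\<^sub>i \<otimes>\<^sub>S M\<close>, which is the direct sum of \<open>crank F i\<close> copies
  of \<open>M\<close> since \<open>F\<^sub>i\<close> is free; the vector \<open>v\<close> stands for \<open>\<Sum>\<^sub>k e\<^sub>k \<otimes> v k\<close>. For \<open>M = S\<close> this is \<open>F\<^sub>i\<close>.
\<close>

definition tensor :: "'k::field free_complex \<Rightarrow> nat \<Rightarrow> 'k xpoly set \<Rightarrow> (nat \<Rightarrow> 'k xpoly) set" where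
  "tensor F i M = {v. (\<forall>k < crank F i. v k \<in> M) \<and> (\<forall>k \<ge> crank F i. v k = 0)}"

definition tensor_part ::
    "'k::field free_complex \<Rightarrow> nat \<Rightarrow> 'k xpoly set \<Rightarrow> int \<Rightarrow> (nat \<Rightarrow> 'k xpoly) set" where
  "tensor_part F i M j = {v \<in> tensor F i M. \<forall>k < crank F i. homogeneous (j - cdeg F i k) (v k)}"

text \<open>The differential \<open>F\<^bsub>i+1\<^esub> \<otimes> M \<rightarrow> F\<^sub>i \<otimes> M\<close>.\<close>

definition cdiff :: "'k::field free_complex \<Rightarrow> nat \<Rightarrow> (nat \<Rightarrow> 'k xpoly) \<Rightarrow> (nat \<Rightarrow> 'k xpoly)" where
  "cdiff F i v = (\<lambda>k. if k < crank F i then \<Sum>l < crank F (Suc i). cmat F i k l * v l else 0)"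

text \<open>\<open>S\<close> acts on \<open>K = S / (x\<^sub>a\<^sub>b)\<close> through the constant coefficient.\<close>

definition augmentation :: "'k::field free_complex \<Rightarrow> (nat \<Rightarrow> 'k xpoly) \<Rightarrow> 'k" where
  "augmentation F v = (\<Sum>k < crank F 0. Poly_Mapping.lookup (v k) 0 * caug F k)"

text \<open>\<open>F\<close> is a graded free resolution of \<open>K\<close>, concentrated in degree \<open>0\<close>, over \<open>S\<close>.\<close>

definition resolution_of_field :: "nat \<Rightarrow> nat \<Rightarrow> 'k::field free_complex \<Rightarrow> bool" where
  "resolution_of_field m n F \<longleftrightarrow>
    (\<forall>i. \<forall>k < crank F i. \<forall>l < crank F (Suc i).
        cmat F i k l \<in> polyring m n \<and> homogeneous (cdeg F (Suc i) l - cdeg F i k) (cmat F i k l)) \<and>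
    (\<forall>k < crank F 0. caug F k \<noteq> 0 \<longrightarrow> cdeg F 0 k = 0) \<and>
    augmentation F ` tensor F 0 (polyring m n) = UNIV \<and>
    cdiff F 0 ` tensor F (Suc 0) (polyring m n) =
      {v \<in> tensor F 0 (polyring m n). augmentation F v = 0} \<and>
    (\<forall>i. cdiff F (Suc i) ` tensor F (Suc (Suc i)) (polyring m n) =
      {v \<in> tensor F (Suc i) (polyring m n). cdiff F i v = 0})"

definition kscale :: "'k::field \<Rightarrow> (nat \<Rightarrow> 'k xpoly) \<Rightarrow> (nat \<Rightarrow> 'k xpoly)" where
  "kscale c v = (\<lambda>k. xconst c * v k)"

lemma vector_space_kscale: "Vector_Spaces.vector_space (kscale :: 'k::field \<Rightarrow> _)"
proof
  fix a b :: 'k and x y :: "nat \<Rightarrow> 'k xpoly"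
  show "kscale a (x + y) = kscale a x + kscale a y"
    by (simp add: kscale_def fun_eq_iff distrib_left)
  show "kscale (a + b) x = kscale a x + kscale b x"
    by (simp add: kscale_def xconst_def fun_eq_iff distrib_right single_add)
  show "kscale a (kscale b x) = kscale (a * b) x"
    by (simp add: kscale_def xconst_def fun_eq_iff mult.assoc [symmetric] mult_single)
  show "kscale 1 x = x"
    by (simp add: kscale_def xconst_def fun_eq_iff)
qed

abbreviation kdim :: "(nat \<Rightarrow> 'k::field xpoly) set \<Rightarrow> nat" where
  "kdim \<equiv> Vector_Spaces.vector_space.dim kscale"

definition tor_cycles ::
    "'k::field free_complex \<Rightarrow> 'k xpoly set \<Rightarrow> nat \<Rightarrow> int \<Rightarrow> (nat \<Rightarrow> 'k xpoly) set" where
  "tor_cycles F M i j =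
    (case i of 0 \<Rightarrow> tensor_part F 0 M j
     | Suc i' \<Rightarrow> {v \<in> tensor_part F (Suc i') M j. cdiff F i' v = 0})"

definition tor_boundaries ::
    "'k::field free_complex \<Rightarrow> 'k xpoly set \<Rightarrow> nat \<Rightarrow> int \<Rightarrow> (nat \<Rightarrow> 'k xpoly) set" where
  "tor_boundaries F M i j = cdiff F i ` tensor_part F (Suc i) M j"

text \<open>
  \<open>\<beta>\<^bsub>i,j\<^esub>(M) = dim\<^sub>K Tor\<^sub>i\<^sup>S(K, M)\<^sub>j\<close> for a homogeneous ideal \<open>M\<close> of \<open>S\<close>, with \<open>Tor\<close> as the left derived
  functor of \<open>_ \<otimes>\<^sub>S M\<close>, i.e. the homology of \<open>F \<otimes>\<^sub>S M\<close> for some graded free resolution \<open>F\<close> of \<open>K\<close>.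
  The Koszul complex shows that resolutions of finite rank exist; the value does not depend on
  the choice. In each degree the cycles form a finite-dimensional space containing the boundaries,
  so the difference is the dimension of the quotient.
\<close>

definition betti :: "nat \<Rightarrow> nat \<Rightarrow> 'k::field xpoly set \<Rightarrow> nat \<Rightarrow> int \<Rightarrow> nat" where
  "betti m n M i j =
    (let F = SOME F. resolution_of_field m n F in kdim (tor_cycles F M i j) - kdim (tor_boundaries F M i j))"

end

theory Submission
  imports Defs
begin

text \<open>
Write \<open>V\<close> for the span of the variables and \<open>J\<close> for the determinantal facet ideal. If \<open>Tor\<close> is computed
with the Koszul complex, then \<open>Tor\<^sub>i(K, J)\<close> in degree \<open>i + m\<close> is the homology of
\<open>\<Lambda>\<^bsup>i+1\<^esup>V \<otimes> J\<^bsub>m-1\<^esub> \<rightarrow> \<Lambda>\<^sup>iV \<otimes> J\<^sub>m \<rightarrow> \<Lambda>\<^bsup>i-1\<^esup>V \<otimes> J\<^bsub>m+1\<^esub>\<close>. The ideal is generated in degree \<open>m\<close>, so the first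
term vanishes and only the kernel of the second map has to be determined.

The minors \<open>m\<^sub>\<tau>\<close> are linearly independent, so an element of \<open>\<Lambda>\<^sup>iV \<otimes> J\<^sub>m\<close> is a family of scalars \<open>a A \<tau>\<close>, with \<open>A\<close>
a set of \<open>i\<close> variables and \<open>\<tau> \<in> C\<close>. It is a cycle iff for every set \<open>B\<close> of \<open>i - 1\<close> variables the signed
coefficients \<open>a (B \<union> {u}) \<tau>\<close> form a linear relation \<open>\<Sum>\<^sub>u\<^sub>,\<^sub>\<tau> c\<^sub>u\<^sub>\<tau> x\<^sub>u m\<^sub>\<tau> = 0\<close>. Such relations are combinations of
the Laplace expansions of \<open>(m+1)\<close>-minors with a repeated row \<open>r\<close>, taken on \<open>m + 1\<close> columns \<open>\<sigma>\<close>; this is seen by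
comparing the coefficient of one monomial (\<open>linear_syzygy_column_disjoint\<close>, \<open>linear_syzygy_exchange\<close>).
For a cycle it follows that \<open>a A \<tau> = 0\<close> unless the variables in \<open>A\<close> lie in distinct columns outside \<open>\<tau>\<close>
(\<open>coef_cycle_column_disjoint\<close>, \<open>coef_cycle_columns_distinct\<close>), and that, up to an explicit sign, \<open>a A \<tau>\<close> does
not change when a variable of \<open>A\<close> moves within its row into a column of \<open>\<tau>\<close>, while its old column replaces the
new one in \<open>\<tau>\<close> (\<open>norm_coef_exchange\<close>). Since \<open>m \<ge> 1\<close> there is always a free column, so these moves connect
all pairs \<open>(A, \<tau>)\<close> with the same column set \<open>\<sigma>\<close> (of size \<open>m + i\<close>) and the same number of variables in each row
(\<open>placement_connected\<close>). A cycle is therefore a function of \<open>\<sigma>\<close> and of the row counts. All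
\<open>m\<close>-subsets of \<open>\<sigma>\<close> occur as \<open>\<tau>\<close>, so the function vanishes at \<open>\<sigma>\<close> unless \<open>\<sigma>\<close> is a clique. Conversely, each
clique with \<open>m + i\<close> vertices and each vector of row counts define a cycle, by the Laplace relation
(\<open>strand_cycle_kdiff\<close>). The \<open>m\<close> row counts are arbitrary natural numbers with sum \<open>i\<close>, which gives the binomial
coefficient.

The Betti numbers are defined through an arbitrarily chosen resolution of \<open>K\<close>. Any two resolutions give the
same dimensions by the comparison theorem for chain maps (\<open>betti_eq\<close>), and the Koszul complex is a resolution
over every field because it has a contracting homotopy that is defined monomial by monomial
(\<open>koszul_homotopy\<close>).
\<close>

section \<open>Monomials and coefficients\<close>

abbreviation coef :: "'k::field xpoly \<Rightarrow> ((nat \<times> nat) \<Rightarrow>\<^sub>0 nat) \<Rightarrow> 'k" where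
  "coef \<equiv> Poly_Mapping.lookup"

abbreviation expo :: "((nat \<times> nat) \<Rightarrow>\<^sub>0 nat) \<Rightarrow> nat \<times> nat \<Rightarrow> nat" where
  "expo \<equiv> Poly_Mapping.lookup"

abbreviation vars :: "((nat \<times> nat) \<Rightarrow>\<^sub>0 nat) \<Rightarrow> (nat \<times> nat) set" where
  "vars \<equiv> Poly_Mapping.keys"

abbreviation var1 :: "nat \<times> nat \<Rightarrow> ((nat \<times> nat) \<Rightarrow>\<^sub>0 nat)" where
  "var1 u \<equiv> Poly_Mapping.single u (Suc 0)"

definition vpoly :: "nat \<times> nat \<Rightarrow> 'k::field xpoly" where
  "vpoly u = Poly_Mapping.single (var1 u) 1"

lemma xvar_eq_vpoly: "xvar a b = vpoly (a, b)"
  by (simp add: xvar_def vpoly_def)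

lemma mon_degree_superset:
  "finite A \<Longrightarrow> vars t \<subseteq> A \<Longrightarrow> mon_degree t = (\<Sum>v\<in>A. expo t v)"
  unfolding mon_degree_def by (rule sum.mono_neutral_left) (auto simp: in_keys_iff)

lemma mon_degree_add: "mon_degree (s + t) = mon_degree s + mon_degree t"
proof -
  let ?A = "vars s \<union> vars t"
  have "vars (s + t) \<subseteq> ?A" by (rule Poly_Mapping.keys_add)
  then show ?thesis
    by (simp add: mon_degree_superset[of ?A] lookup_add sum.distrib)
qed

lemma mon_degree_0 [simp]: "mon_degree 0 = 0"
  by (simp add: mon_degree_def)

lemma mon_degree_single [simp]: "mon_degree (Poly_Mapping.single u k) = k"
  by (auto simp: mon_degree_def lookup_single)

lemma expo_add_eq_0: "s + t = (0 :: (nat \<times> nat) \<Rightarrow>\<^sub>0 nat) \<longleftrightarrow> s = 0 \<and> t = 0"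
  by (auto simp: poly_mapping_eq_iff fun_eq_iff lookup_add)

lemma vars_add: "vars (s + t) = vars s \<union> vars t"
  by (auto simp: in_keys_iff lookup_add)

lemma coef_monom_mult:
  "coef (Poly_Mapping.single s c * p) k = c * (\<Sum>q. coef p q when k = s + q)"
proof -
  have "coef (Poly_Mapping.single s c * p) k =
      (\<Sum>l. (c * (\<Sum>q. coef p q when k = l + q)) when l = s)"
    unfolding lookup_mult by (rule Sum_any.cong) (auto simp: lookup_single when_def)
  then show ?thesis by simp
qed

lemma coef_monom_mult_add:
  "coef (Poly_Mapping.single s c * p) (s + t) = c * coef p t"
proof -
  have "(\<Sum>q. coef p q when s + t = s + q) = (\<Sum>q. coef p q when q = t)"
    by (rule Sum_any.cong) (auto simp: when_def)
  then show ?thesis by (simp add: coef_monom_mult)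
qed

lemma coef_monom_mult_not:
  assumes "\<And>t. k \<noteq> s + t"
  shows "coef (Poly_Mapping.single s c * p) k = 0"
proof -
  from assms show ?thesis by (simp add: coef_monom_mult)
qed

lemma var1_add_diff: "u \<in> vars t \<Longrightarrow> var1 u + (t - var1 u) = t"
  by (rule poly_mapping_eqI) (auto simp: lookup_add lookup_minus lookup_single in_keys_iff when_def)

lemma coef_vpoly_mult:
  "coef (vpoly u * p) t = (if u \<in> vars t then coef p (t - var1 u) else 0)"
proof (cases "u \<in> vars t")
  case True
  then show ?thesis
    using coef_monom_mult_add[of "var1 u" 1 p "t - var1 u"] by (simp add: vpoly_def var1_add_diff)
next
  case False
  have "t \<noteq> var1 u + s" for s
    using False by (auto simp: vars_add)
  then show ?thesis using False by (simp add: vpoly_def coef_monom_mult_not)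
qed

lemma coef_xconst_mult: "coef (xconst c * p) t = c * coef p t"
  using coef_monom_mult_add[of 0 c p t] by (simp add: xconst_def)

lemma coef_mult_0: "coef (p * q) 0 = coef p 0 * coef q 0"
proof -
  have "coef p l * (\<Sum>r. coef q r when 0 = l + r) = (coef p 0 * coef q 0 when l = 0)" for l
  proof (cases "l = 0")
    case True
    then show ?thesis by simp
  next
    case False
    then have "0 \<noteq> l + r" for r using expo_add_eq_0[of l r] by metis
    then show ?thesis using False by simp
  qed
  then show ?thesis by (simp add: lookup_mult)
qed

section \<open>Homogeneous components\<close>

definition hcomp :: "int \<Rightarrow> 'k::field xpoly \<Rightarrow> 'k xpoly" where
  "hcomp d p = Abs_poly_mapping (\<lambda>t. coef p t when int (mon_degree t) = d)"

lemma coef_hcomp: "coef (hcomp d p) t = (coef p t when int (mon_degree t) = d)"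
proof -
  have "finite {t. (coef p t when int (mon_degree t) = d) \<noteq> 0}"
    by (rule finite_subset[OF _ finite_keys[of p]]) (auto simp: in_keys_iff)
  then show ?thesis by (simp add: hcomp_def)
qed

lemma homogeneous_iff: "homogeneous d p \<longleftrightarrow> (\<forall>t. coef p t \<noteq> 0 \<longrightarrow> int (mon_degree t) = d)"
  by (auto simp: homogeneous_def in_keys_iff)

lemma hcomp_eq_iff: "hcomp d p = p \<longleftrightarrow> homogeneous d p"
  by (auto simp: poly_mapping_eq_iff fun_eq_iff coef_hcomp homogeneous_iff when_def)

lemma homogeneous_hcomp: "homogeneous d (hcomp d p)"
  by (auto simp: homogeneous_iff coef_hcomp)

lemma hcomp_add: "hcomp d (p + q) = hcomp d p + hcomp d q"
  by (rule poly_mapping_eqI) (auto simp: coef_hcomp lookup_add when_def)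

lemma hcomp_0 [simp]: "hcomp d 0 = 0"
  by (rule poly_mapping_eqI) (auto simp: coef_hcomp)

lemma hcomp_sum: "hcomp d (sum f A) = (\<Sum>x\<in>A. hcomp d (f x))"
  by (induction A rule: infinite_finite_induct) (auto simp: hcomp_add)

text \<open>
Stated with the homogeneous factor pulled out, so that a vector solving a homogeneous linear system can be
replaced by its homogeneous component.
\<close>

lemma hcomp_mult:
  assumes "homogeneous a p"
  shows "hcomp (a + d) (p * q) = p * hcomp d q"
proof (rule poly_mapping_eqI)
  fix k
  have "coef p l * (\<Sum>r. coef (hcomp d q) r when k = l + r) =
      (coef p l * (\<Sum>r. coef q r when k = l + r) when int (mon_degree k) = a + d)" for l
  proof (cases "coef p l = 0")
    case False
    then have l: "int (mon_degree l) = a" using assms by (auto simp: homogeneous_iff)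
    have "(\<Sum>r. coef (hcomp d q) r when k = l + r) =
        (\<Sum>r. (coef q r when int (mon_degree k) = a + d) when k = l + r)"
      by (rule Sum_any.cong) (use l in \<open>auto simp: coef_hcomp when_def mon_degree_add\<close>)
    then show ?thesis by (cases "int (mon_degree k) = a + d") auto
  qed auto
  then have "coef (p * hcomp d q) k =
      (\<Sum>l. (coef p l * (\<Sum>r. coef q r when k = l + r) when int (mon_degree k) = a + d))"
    unfolding lookup_mult by simp
  then show "coef (hcomp (a + d) (p * q)) k = coef (p * hcomp d q) k"
    by (simp add: coef_hcomp lookup_mult when_def)
qed

lemma homogeneous_0 [simp]: "homogeneous d 0"
  by (simp add: homogeneous_iff)

lemma homogeneous_add: "homogeneous d p \<Longrightarrow> homogeneous d q \<Longrightarrow> homogeneous d (p + q)"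
  using hcomp_add[of d p q] by (metis hcomp_eq_iff)

lemma homogeneous_uminus: "homogeneous d p \<Longrightarrow> homogeneous d (- p)"
  by (auto simp: homogeneous_iff)

lemma homogeneous_diff: "homogeneous d p \<Longrightarrow> homogeneous d q \<Longrightarrow> homogeneous d (p - q)"
  by (metis homogeneous_add homogeneous_uminus diff_conv_add_uminus)

lemma homogeneous_sum: "(\<And>x. x \<in> A \<Longrightarrow> homogeneous d (f x)) \<Longrightarrow> homogeneous d (sum f A)"
  by (induction A rule: infinite_finite_induct) (auto simp: homogeneous_add)

lemma homogeneous_mult: "homogeneous a p \<Longrightarrow> homogeneous b q \<Longrightarrow> homogeneous (a + b) (p * q)"
  by (metis hcomp_eq_iff hcomp_mult)

lemma homogeneous_xconst: "homogeneous 0 (xconst c)"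
  by (auto simp: homogeneous_def xconst_def)

lemma homogeneous_1: "homogeneous 0 1"
  using homogeneous_xconst[of 1] by (simp add: xconst_def)

lemma homogeneous_vpoly: "homogeneous 1 (vpoly u)"
  by (auto simp: homogeneous_def vpoly_def)

section \<open>The polynomial ring and its ideals\<close>

lemma polyring_iff: "p \<in> polyring m n \<longleftrightarrow> (\<forall>t. coef p t \<noteq> 0 \<longrightarrow> vars t \<subseteq> {1..m} \<times> {1..n})"
  by (auto simp: polyring_def in_keys_iff)

lemma polyring_0 [simp]: "0 \<in> polyring m n"
  by (simp add: polyring_def)

lemma polyring_xconst: "xconst c \<in> polyring m n"
  by (simp add: polyring_def xconst_def)

lemma polyring_1: "1 \<in> polyring m n"
  by (simp add: polyring_def)

lemma polyring_vpoly: "u \<in> {1..m} \<times> {1..n} \<Longrightarrow> vpoly u \<in> polyring m n"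
  by (auto simp add: polyring_def vpoly_def)

lemma polyring_add: "p \<in> polyring m n \<Longrightarrow> q \<in> polyring m n \<Longrightarrow> p + q \<in> polyring m n"
  unfolding polyring_iff lookup_add by (metis add.right_neutral add.left_neutral)

lemma polyring_uminus: "p \<in> polyring m n \<Longrightarrow> - p \<in> polyring m n"
  unfolding polyring_iff by auto

lemma polyring_mult: "p \<in> polyring m n \<Longrightarrow> q \<in> polyring m n \<Longrightarrow> p * q \<in> polyring m n"
  unfolding polyring_def using keys_mult[of p q] by (fastforce simp: vars_add)

lemma polyring_hcomp: "p \<in> polyring m n \<Longrightarrow> hcomp d p \<in> polyring m n"
  by (auto simp: polyring_iff coef_hcomp)

text \<open>
Ideals of the subring \<open>polyring m n\<close>; they need not be closed under multiplication by the ambient ring, which has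
infinitely many variables.
\<close>

definition is_ideal :: "nat \<Rightarrow> nat \<Rightarrow> 'k::field xpoly set \<Rightarrow> bool" where
  "is_ideal m n M \<longleftrightarrow> M \<subseteq> polyring m n \<and> 0 \<in> M \<and> (\<forall>x\<in>M. \<forall>y\<in>M. x + y \<in> M) \<and>
     (\<forall>a\<in>polyring m n. \<forall>x\<in>M. a * x \<in> M)"

lemma is_ideal_polyring: "is_ideal m n (polyring m n)"
  by (auto simp: is_ideal_def polyring_add polyring_mult)

lemma is_ideal_sum: "is_ideal m n M \<Longrightarrow> (\<And>x. x \<in> A \<Longrightarrow> f x \<in> M) \<Longrightarrow> sum f A \<in> M"
  by (induction A rule: infinite_finite_induct) (auto simp: is_ideal_def)

lemma is_ideal_uminus: "is_ideal m n M \<Longrightarrow> x \<in> M \<Longrightarrow> - x \<in> M"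
proof -
  assume "is_ideal m n M" "x \<in> M"
  then have "(- 1) * x \<in> M"
    using polyring_uminus[OF polyring_1] unfolding is_ideal_def by blast
  then show ?thesis by simp
qed

lemma is_ideal_diff: "is_ideal m n M \<Longrightarrow> x \<in> M \<Longrightarrow> y \<in> M \<Longrightarrow> x - y \<in> M"
  using is_ideal_uminus[of m n M y] unfolding is_ideal_def by (metis diff_conv_add_uminus)

lemma is_ideal_ideal_gen:
  assumes "G \<subseteq> polyring m n"
  shows "is_ideal m n (ideal_gen m n G)"
  unfolding is_ideal_def
proof (intro conjI ballI subsetI)
  fix x assume "x \<in> ideal_gen m n G"
  then obtain A q where x: "x = (\<Sum>g\<in>A. q g * g)" and A: "finite A" "A \<subseteq> G"
    and q: "\<forall>g\<in>A. q g \<in> polyring m n" by (auto simp: ideal_gen_def)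
  show "x \<in> polyring m n"
    unfolding x by (rule is_ideal_sum[OF is_ideal_polyring]) (use A q assms in \<open>auto simp: polyring_mult subset_eq\<close>)
  { fix a :: "'a xpoly" assume "a \<in> polyring m n"
    then show "a * x \<in> ideal_gen m n G"
      unfolding ideal_gen_def mem_Collect_eq x
      by (intro exI[of _ A] exI[of _ "\<lambda>g. a * q g"])
        (use A q in \<open>auto simp: sum_distrib_left polyring_mult mult.assoc\<close>) }
  fix y assume "y \<in> ideal_gen m n G"
  then obtain B r where y: "y = (\<Sum>g\<in>B. r g * g)" and B: "finite B" "B \<subseteq> G"
    and r: "\<forall>g\<in>B. r g \<in> polyring m n" by (auto simp: ideal_gen_def)
  have "x = (\<Sum>g\<in>A \<union> B. (if g \<in> A then q g else 0) * g)"
    unfolding x by (rule sum.mono_neutral_cong_left) (use A B in auto)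
  moreover have "y = (\<Sum>g\<in>A \<union> B. (if g \<in> B then r g else 0) * g)"
    unfolding y by (rule sum.mono_neutral_cong_left) (use A B in auto)
  ultimately have "x + y = (\<Sum>g\<in>A \<union> B. ((if g \<in> A then q g else 0) + (if g \<in> B then r g else 0)) * g)"
    by (simp add: sum.distrib distrib_right)
  then show "x + y \<in> ideal_gen m n G"
    unfolding ideal_gen_def mem_Collect_eq
    by (intro exI[of _ "A \<union> B"] exI[of _ "\<lambda>g. (if g \<in> A then q g else 0) + (if g \<in> B then r g else 0)"])
      (use A B q r in \<open>auto simp: polyring_add\<close>)
next
  show "0 \<in> ideal_gen m n G"
    unfolding ideal_gen_def mem_Collect_eq
    by (intro exI[of _ "{}"]) auto
qed

section \<open>Matrices acting on vectors of polynomials\<close>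

text \<open>
The map of free modules of finite rank that sends the \<open>l\<close>-th basis vector to \<open>b l\<close>. Differentials, chain
maps and homotopies all have this form, and two of them agree once they agree on basis vectors.
\<close>

definition lin :: "nat \<Rightarrow> (nat \<Rightarrow> nat \<Rightarrow> 'k::field xpoly) \<Rightarrow> (nat \<Rightarrow> 'k xpoly) \<Rightarrow> (nat \<Rightarrow> 'k xpoly)" where
  "lin r b v = (\<lambda>k. \<Sum>l<r. b l k * v l)"

definition dcol :: "'k::field free_complex \<Rightarrow> nat \<Rightarrow> nat \<Rightarrow> (nat \<Rightarrow> 'k xpoly)" where
  "dcol F i l = (\<lambda>k. if k < crank F i then cmat F i k l else 0)"

text \<open>
The cycles of the augmented complex. Treating the augmentation as the differential out of degree \<open>0\<close> allows
exactness to be used in the same way in all degrees.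
\<close>

definition aug_cycle :: "'k::field free_complex \<Rightarrow> nat \<Rightarrow> (nat \<Rightarrow> 'k xpoly) \<Rightarrow> bool" where
  "aug_cycle F i v \<longleftrightarrow> (case i of 0 \<Rightarrow> augmentation F v = 0 | Suc i' \<Rightarrow> cdiff F i' v = 0)"

lemma cdiff_eq_lin: "cdiff F i v = lin (crank F (Suc i)) (dcol F i) v"
  by (auto simp: cdiff_def lin_def dcol_def fun_eq_iff)

lemma lin_lin: "lin r c (lin s b v) = lin s (\<lambda>l. lin r c (b l)) v"
proof
  fix k
  have "lin r c (lin s b v) k = (\<Sum>l'<r. \<Sum>l<s. c l' k * b l l' * v l)"
    by (simp add: lin_def sum_distrib_left mult.assoc)
  also have "\<dots> = (\<Sum>l<s. \<Sum>l'<r. c l' k * b l l' * v l)" by (rule sum.swap)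
  finally show "lin r c (lin s b v) k = lin s (\<lambda>l. lin r c (b l)) v k"
    by (simp add: lin_def sum_distrib_right)
qed

lemma lin_cong: "(\<And>l. l < r \<Longrightarrow> b l = c l) \<Longrightarrow> lin r b v = lin r c v"
  by (simp add: lin_def)

lemma lin_diff: "lin r b (v - w) = lin r b v - lin r b w"
  by (simp add: lin_def fun_eq_iff right_diff_distrib sum_subtractf)

lemma lin_diff_left: "lin r (\<lambda>l. b l - c l) v = lin r b v - lin r c v"
  by (simp add: lin_def fun_eq_iff left_diff_distrib sum_subtractf)

lemma lin_add: "lin r b (v + w) = lin r b v + lin r b w"
  by (simp add: lin_def fun_eq_iff distrib_left sum.distrib)

lemma lin_kscale: "lin r b (kscale c v) = kscale c (lin r b v)"
  by (simp add: lin_def kscale_def fun_eq_iff sum_distrib_left mult_ac)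

lemma lin_zero [simp]: "lin r b 0 = 0"
  by (simp add: lin_def fun_eq_iff)

lemma cdiff_lin: "cdiff F i (lin r b v) = lin r (\<lambda>l. cdiff F i (b l)) v"
  unfolding cdiff_eq_lin by (rule lin_lin)

lemma lin_cdiff: "lin r b (cdiff F i v) = lin (crank F (Suc i)) (\<lambda>l. lin r b (dcol F i l)) v"
  unfolding cdiff_eq_lin by (rule lin_lin)

lemma cdiff_diff: "cdiff F i (v - w) = cdiff F i v - cdiff F i w"
  unfolding cdiff_eq_lin by (rule lin_diff)

lemma cdiff_zero [simp]: "cdiff F i 0 = 0"
  unfolding cdiff_eq_lin by simp

lemma augmentation_lin:
  "augmentation G (lin r b v) = (\<Sum>l<r. augmentation G (b l) * coef (v l) 0)"
proof -
  have "augmentation G (lin r b v) = (\<Sum>k<crank G 0. \<Sum>l<r. coef (b l k) 0 * coef (v l) 0 * caug G k)"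
    by (simp add: augmentation_def lin_def lookup_sum coef_mult_0 sum_distrib_right)
  also have "\<dots> = (\<Sum>l<r. \<Sum>k<crank G 0. coef (b l k) 0 * coef (v l) 0 * caug G k)" by (rule sum.swap)
  finally show ?thesis by (simp add: augmentation_def sum_distrib_right sum_distrib_left mult_ac)
qed

lemma augmentation_diff: "augmentation F (v - w) = augmentation F v - augmentation F w"
  by (simp add: augmentation_def lookup_minus left_diff_distrib sum_subtractf)

section \<open>Graded maps\<close>

lemma tensor_partI:
  assumes "\<And>k. k < crank F i \<Longrightarrow> v k \<in> M \<and> homogeneous (j - cdeg F i k) (v k)"
    and "\<And>k. k \<ge> crank F i \<Longrightarrow> v k = 0"
  shows "v \<in> tensor_part F i M j"
  using assms by (auto simp: tensor_part_def tensor_def)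

lemma tensor_part_diff:
  assumes "is_ideal m n M" "v \<in> tensor_part F i M j" "w \<in> tensor_part F i M j"
  shows "v - w \<in> tensor_part F i M j"
  using assms by (auto simp: tensor_part_def tensor_def is_ideal_diff homogeneous_diff)

lemma tensor_part_mono: "M \<subseteq> N \<Longrightarrow> tensor_part F i M j \<subseteq> tensor_part F i N j"
  by (auto simp: tensor_part_def tensor_def)

definition graded_map ::
    "nat \<Rightarrow> nat \<Rightarrow> 'k::field free_complex \<Rightarrow> nat \<Rightarrow> 'k free_complex \<Rightarrow> nat \<Rightarrow> (nat \<Rightarrow> nat \<Rightarrow> 'k xpoly) \<Rightarrow> bool" where
  "graded_map m n F i G k b \<longleftrightarrow> (\<forall>l<crank F i. b l \<in> tensor_part G k (polyring m n) (cdeg F i l))"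

lemma lin_tensor_part:
  assumes M: "is_ideal m n M" and b: "graded_map m n F i G k b" and v: "v \<in> tensor_part F i M j"
  shows "lin (crank F i) b v \<in> tensor_part G k M j"
proof (rule tensor_partI)
  fix r assume r: "r < crank G k"
  have "b l r * v l \<in> M \<and> homogeneous (j - cdeg G k r) (b l r * v l)" if l: "l < crank F i" for l
  proof
    have b: "b l r \<in> polyring m n" "homogeneous (cdeg F i l - cdeg G k r) (b l r)"
      using b l r by (auto simp: graded_map_def tensor_part_def tensor_def)
    have v: "v l \<in> M" "homogeneous (j - cdeg F i l) (v l)"
      using v l by (auto simp: tensor_part_def tensor_def)
    show "b l r * v l \<in> M" using M b v by (auto simp: is_ideal_def)
    show "homogeneous (j - cdeg G k r) (b l r * v l)"
      using homogeneous_mult[OF b(2) v(2)] by simp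
  qed
  then show "lin (crank F i) b v r \<in> M \<and> homogeneous (j - cdeg G k r) (lin (crank F i) b v r)"
    unfolding lin_def by (auto intro!: is_ideal_sum[OF M] homogeneous_sum)
next
  fix r assume "crank G k \<le> r"
  then have "b l r = 0" if "l < crank F i" for l
    using b that by (auto simp: graded_map_def tensor_part_def tensor_def)
  then show "lin (crank F i) b v r = 0" by (simp add: lin_def)
qed

lemma dcol_graded:
  assumes "resolution_of_field m n F"
  shows "graded_map m n F (Suc i) F i (dcol F i)"
  using assms unfolding graded_map_def resolution_of_field_def tensor_part_def tensor_def dcol_def
  by simp

lemma cdiff_tensor_part:
  assumes "resolution_of_field m n F" "is_ideal m n M" "v \<in> tensor_part F (Suc i) M j"
  shows "cdiff F i v \<in> tensor_part F i M j"
  unfolding cdiff_eq_lin using assms by (blast intro: lin_tensor_part dcol_graded)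

lemma resolution_exact:
  assumes "resolution_of_field m n F"
  shows "cdiff F i ` tensor F (Suc i) (polyring m n) = {v \<in> tensor F i (polyring m n). aug_cycle F i v}"
  using assms by (cases i) (auto simp: resolution_of_field_def aug_cycle_def)

lemma aug_cycle_cdiff:
  assumes "resolution_of_field m n F" "v \<in> tensor_part F (Suc i) (polyring m n) j"
  shows "aug_cycle F i (cdiff F i v)"
  using resolution_exact[OF assms(1), of i] assms(2) by (auto simp: tensor_part_def)

text \<open>
The differential preserves degrees, so any preimage of a homogeneous cycle can be replaced by its homogeneous
component of the right degree.
\<close>

lemma resolution_exact_graded:
  assumes F: "resolution_of_field m n F"
    and v: "v \<in> tensor_part F i (polyring m n) j" and z: "aug_cycle F i v"
  shows "\<exists>w\<in>tensor_part F (Suc i) (polyring m n) j. cdiff F i w = v"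
proof -
  have "v \<in> cdiff F i ` tensor F (Suc i) (polyring m n)"
    using resolution_exact[OF F, of i] v z by (auto simp: tensor_part_def)
  then obtain w where w: "w \<in> tensor F (Suc i) (polyring m n)" "cdiff F i w = v" by auto
  \<comment> \<open>the homogeneous component of \<open>w\<close> of degree \<open>j\<close>\<close>
  define w' where "w' = (\<lambda>l. if l < crank F (Suc i) then hcomp (j - cdeg F (Suc i) l) (w l) else 0)"
  have "w' \<in> tensor_part F (Suc i) (polyring m n) j"
    by (rule tensor_partI) (use w in \<open>auto simp: w'_def homogeneous_hcomp tensor_def polyring_hcomp\<close>)
  moreover have "cdiff F i w' k = v k" for k
  proof (cases "k < crank F i")
    case True
    have "cmat F i k l * hcomp (j - cdeg F (Suc i) l) (w l) = hcomp (j - cdeg F i k) (cmat F i k l * w l)"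
      if "l < crank F (Suc i)" for l
    proof -
      have "homogeneous (cdeg F (Suc i) l - cdeg F i k) (cmat F i k l)"
        using F True that by (auto simp: resolution_of_field_def)
      from hcomp_mult[OF this, of "j - cdeg F (Suc i) l" "w l"] show ?thesis by (simp add: algebra_simps)
    qed
    then have "cdiff F i w' k = hcomp (j - cdeg F i k) (cdiff F i w k)"
      using True by (simp add: cdiff_def w'_def hcomp_sum)
    also have "\<dots> = v k" using v True w by (simp add: tensor_part_def hcomp_eq_iff)
    finally show ?thesis .
  next
    case False
    then show ?thesis using v by (auto simp: cdiff_def tensor_part_def tensor_def)
  qed
  ultimately show ?thesis by (blast intro: ext)
qed

section \<open>Chain maps and homotopies\<close>

lemma graded_map_lift:
  assumes F: "resolution_of_field m n F"
    and y: "\<And>l. l < r \<Longrightarrow> y l \<in> tensor_part F i (polyring m n) (d l) \<and> aug_cycle F i (y l)"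
  shows "\<exists>b. \<forall>l<r. b l \<in> tensor_part F (Suc i) (polyring m n) (d l) \<and> cdiff F i (b l) = y l"
proof -
  have "\<forall>l\<in>{..<r}. \<exists>b. b \<in> tensor_part F (Suc i) (polyring m n) (d l) \<and> cdiff F i b = y l"
    using resolution_exact_graded[OF F] y by blast
  from bchoice[OF this] show ?thesis by auto
qed

definition chain_map ::
    "nat \<Rightarrow> nat \<Rightarrow> 'k::field free_complex \<Rightarrow> 'k free_complex \<Rightarrow> (nat \<Rightarrow> nat \<Rightarrow> nat \<Rightarrow> 'k xpoly) \<Rightarrow> bool" where
  "chain_map m n F G \<phi> \<longleftrightarrow> (\<forall>i. graded_map m n F i G i (\<phi> i)) \<and>
     (\<forall>i. \<forall>l<crank F (Suc i). cdiff G i (\<phi> (Suc i) l) = lin (crank F i) (\<phi> i) (dcol F i l))"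

lemma chain_map_commute:
  assumes "chain_map m n F G \<phi>"
  shows "cdiff G i (lin (crank F (Suc i)) (\<phi> (Suc i)) v) = lin (crank F i) (\<phi> i) (cdiff F i v)"
  unfolding cdiff_lin lin_cdiff using assms by (intro lin_cong) (auto simp: chain_map_def)

lemma dcol_cycle:
  assumes F: "resolution_of_field m n F" and l: "l < crank F (Suc i)"
  shows "aug_cycle F i (dcol F i l)"
proof -
  define e where "e = (\<lambda>k. if k = l then 1 else 0 :: 'a xpoly)"
  have "e \<in> tensor F (Suc i) (polyring m n)"
    using l by (auto simp: e_def tensor_def polyring_1)
  moreover have "cdiff F i e = dcol F i l"
    using l by (auto simp: cdiff_def e_def dcol_def fun_eq_iff if_distrib cong: if_cong)
  ultimately have "dcol F i l \<in> cdiff F i ` tensor F (Suc i) (polyring m n)" by (metis imageI)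
  then show ?thesis unfolding resolution_exact[OF F] by simp
qed

lemma dcol_tensor_part:
  assumes F: "resolution_of_field m n F" and l: "l < crank F (Suc i)"
  shows "dcol F i l \<in> tensor_part F i (polyring m n) (cdeg F (Suc i) l)"
  using dcol_graded[OF F, of i] l by (auto simp: graded_map_def)

text \<open>
The lift is built degree by degree. The invariant kept during the construction is that cycles of the augmented
complex go to cycles, which is what makes the next lifting problem solvable by exactness.
\<close>

lemma exists_chain_map:
  assumes F: "resolution_of_field m n F" and G: "resolution_of_field m n G"
  shows "\<exists>\<phi>. chain_map m n F G \<phi> \<and> (\<forall>l<crank F 0. augmentation G (\<phi> 0 l) = caug F l)"
proof -
  define P where "P i \<phi> \<longleftrightarrow> graded_map m n F i G i \<phi> \<and> (i = 0 \<longrightarrow> (\<forall>l<crank F 0. augmentation G (\<phi> l) = caug F l))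
     \<and> (\<forall>v. aug_cycle F i v \<longrightarrow> aug_cycle G i (lin (crank F i) \<phi> v))" for i \<phi>
  define Q where "Q i \<phi> \<phi>' \<longleftrightarrow> (\<forall>l<crank F (Suc i). cdiff G i (\<phi>' l) = lin (crank F i) \<phi> (dcol F i l))"
    for i and \<phi> \<phi>' :: "nat \<Rightarrow> nat \<Rightarrow> 'a xpoly"
  have "\<exists>\<phi>. \<forall>i. P i (\<phi> i) \<and> Q i (\<phi> i) (\<phi> (Suc i))"
  proof (rule dependent_nat_choice)
    have "\<exists>b. b \<in> tensor_part G 0 (polyring m n) (cdeg F 0 l) \<and> augmentation G b = caug F l"
      if l: "l < crank F 0" for l
    proof (cases "caug F l = 0")
      case True
      then show ?thesis by (intro exI[of _ 0]) (auto intro!: tensor_partI simp: augmentation_def)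
    next
      case False
      then have d: "cdeg F 0 l = 0" using F l by (auto simp: resolution_of_field_def)
      have "caug F l \<in> augmentation G ` tensor G 0 (polyring m n)"
        using G by (simp add: resolution_of_field_def)
      then obtain w where w: "w \<in> tensor G 0 (polyring m n)" "augmentation G w = caug F l" by auto
      define b where "b = (\<lambda>k. if k < crank G 0 then hcomp (0 - cdeg G 0 k) (w k) else 0)"
      have "b \<in> tensor_part G 0 (polyring m n) (cdeg F 0 l)"
        by (rule tensor_partI)
          (use w d in \<open>auto simp: b_def homogeneous_hcomp tensor_def polyring_hcomp\<close>)
      moreover have eq: "coef (b k) 0 * caug G k = coef (w k) 0 * caug G k" if "k < crank G 0" for k
      proof (cases "caug G k = 0")
        case False
        then have "cdeg G 0 k = 0" using G that by (auto simp: resolution_of_field_def)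
        then show ?thesis using that by (simp add: b_def coef_hcomp)
      qed auto
      have "augmentation G b = augmentation G w"
        unfolding augmentation_def by (rule sum.cong) (use eq in auto)
      with w(2) have "augmentation G b = caug F l" by simp
      ultimately show ?thesis by blast
    qed
    then have "\<forall>l\<in>{..<crank F 0}. \<exists>b. b \<in> tensor_part G 0 (polyring m n) (cdeg F 0 l) \<and> augmentation G b = caug F l"
      by blast
    from bchoice[OF this] obtain b where
      b: "\<forall>l<crank F 0. b l \<in> tensor_part G 0 (polyring m n) (cdeg F 0 l) \<and> augmentation G (b l) = caug F l"
      by auto
    have "augmentation G (lin (crank F 0) b v) = augmentation F v" for v
      using b by (simp add: augmentation_lin) (simp add: augmentation_def mult.commute)
    then show "\<exists>x. P 0 x" using b by (intro exI[of _ b]) (auto simp: P_def graded_map_def aug_cycle_def)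
  next
    fix \<phi> i assume P: "P i \<phi>"
    have "lin (crank F i) \<phi> (dcol F i l) \<in> tensor_part G i (polyring m n) (cdeg F (Suc i) l)
        \<and> aug_cycle G i (lin (crank F i) \<phi> (dcol F i l))" if "l < crank F (Suc i)" for l
      using P that lin_tensor_part[OF is_ideal_polyring _ dcol_tensor_part[OF F]] dcol_cycle[OF F]
      unfolding P_def by blast
    from graded_map_lift[OF G, of "crank F (Suc i)" "\<lambda>l. lin (crank F i) \<phi> (dcol F i l)",
        OF this] obtain b where
      b: "\<forall>l<crank F (Suc i). b l \<in> tensor_part G (Suc i) (polyring m n) (cdeg F (Suc i) l) \<and>
         cdiff G i (b l) = lin (crank F i) \<phi> (dcol F i l)" by auto
    have "cdiff G i (lin (crank F (Suc i)) b v) = lin (crank F i) \<phi> (cdiff F i v)" for v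
      unfolding cdiff_lin lin_cdiff using b by (intro lin_cong) auto
    then have "P (Suc i) b" using b by (auto simp: P_def graded_map_def aug_cycle_def)
    moreover have "Q i \<phi> b" using b by (auto simp: Q_def)
    ultimately show "\<exists>y. P (Suc i) y \<and> Q i \<phi> y" by blast
  qed
  then obtain \<phi> where "\<forall>i. P i (\<phi> i)" "\<forall>i. Q i (\<phi> i) (\<phi> (Suc i))" by blast
  then show ?thesis unfolding chain_map_def P_def Q_def by (intro exI[of _ \<phi>]) auto
qed

text \<open>
Again by lifting: in each degree the difference between the chain map and the part of the homotopy built so far
is a cycle, hence a boundary.
\<close>

lemma chain_map_null_homotopic:
  assumes F: "resolution_of_field m n F" and \<theta>: "chain_map m n F F \<theta>"
    and aug: "\<And>l. l < crank F 0 \<Longrightarrow> augmentation F (\<theta> 0 l) = 0"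
  shows "\<exists>s. (\<forall>i. graded_map m n F i F (Suc i) (s i)) \<and>
    (\<forall>l<crank F 0. cdiff F 0 (s 0 l) = \<theta> 0 l) \<and>
    (\<forall>i. \<forall>l<crank F (Suc i). cdiff F (Suc i) (s (Suc i) l) = \<theta> (Suc i) l - lin (crank F i) (s i) (dcol F i l))"
proof -
  define P where "P i s \<longleftrightarrow> graded_map m n F i F (Suc i) s \<and> (i = 0 \<longrightarrow> (\<forall>l<crank F 0. cdiff F 0 (s l) = \<theta> 0 l))
     \<and> (\<forall>l<crank F (Suc i). cdiff F i (\<theta> (Suc i) l - lin (crank F i) s (dcol F i l)) = 0)" for i s
  define Q where "Q i s s' \<longleftrightarrow> (\<forall>l<crank F (Suc i).
      cdiff F (Suc i) (s' l) = \<theta> (Suc i) l - lin (crank F i) s (dcol F i l))"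
    for i and s s' :: "nat \<Rightarrow> nat \<Rightarrow> 'a xpoly"
  have gr: "\<theta> i l \<in> tensor_part F i (polyring m n) (cdeg F i l)" if "l < crank F i" for i l
    using \<theta> that by (auto simp: chain_map_def graded_map_def)
  have comm: "cdiff F i (\<theta> (Suc i) l) = lin (crank F i) (\<theta> i) (dcol F i l)" if "l < crank F (Suc i)" for i l
    using \<theta> that by (auto simp: chain_map_def)
  have dd: "cdiff F i (dcol F (Suc i) l) = 0" if "l < crank F (Suc (Suc i))" for i l
    using dcol_cycle[OF F that] by (simp add: aug_cycle_def)
  have "\<exists>s. \<forall>i. P i (s i) \<and> Q i (s i) (s (Suc i))"
  proof (rule dependent_nat_choice)
    from graded_map_lift[OF F, of "crank F 0" "\<theta> 0" 0 "cdeg F 0"] obtain s where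
      s: "\<forall>l<crank F 0. s l \<in> tensor_part F (Suc 0) (polyring m n) (cdeg F 0 l) \<and> cdiff F 0 (s l) = \<theta> 0 l"
      using gr aug by (auto simp: aug_cycle_def)
    have "cdiff F 0 (\<theta> (Suc 0) l - lin (crank F 0) s (dcol F 0 l)) = 0" if l: "l < crank F (Suc 0)" for l
    proof -
      have "cdiff F 0 (lin (crank F 0) s (dcol F 0 l)) = lin (crank F 0) (\<theta> 0) (dcol F 0 l)"
        unfolding cdiff_lin using s by (intro lin_cong) auto
      then show ?thesis by (simp add: cdiff_diff comm[OF l])
    qed
    then show "\<exists>x. P 0 x" using s by (intro exI[of _ s]) (auto simp: P_def graded_map_def)
  next
    fix s i assume P: "P i s"
    have "\<theta> (Suc i) l - lin (crank F i) s (dcol F i l) \<in> tensor_part F (Suc i) (polyring m n) (cdeg F (Suc i) l)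
        \<and> aug_cycle F (Suc i) (\<theta> (Suc i) l - lin (crank F i) s (dcol F i l))" if l: "l < crank F (Suc i)" for l
    proof
      have "lin (crank F i) s (dcol F i l) \<in> tensor_part F (Suc i) (polyring m n) (cdeg F (Suc i) l)"
        using lin_tensor_part[OF is_ideal_polyring _ dcol_tensor_part[OF F l]] P unfolding P_def by blast
      then show "\<theta> (Suc i) l - lin (crank F i) s (dcol F i l) \<in> tensor_part F (Suc i) (polyring m n) (cdeg F (Suc i) l)"
        using tensor_part_diff[OF is_ideal_polyring gr[OF l]] by blast
      show "aug_cycle F (Suc i) (\<theta> (Suc i) l - lin (crank F i) s (dcol F i l))"
        using P l by (auto simp: P_def aug_cycle_def)
    qed
    from graded_map_lift[OF F, of "crank F (Suc i)" "\<lambda>l. \<theta> (Suc i) l - lin (crank F i) s (dcol F i l)",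
        OF this] obtain b where
      b: "\<forall>l<crank F (Suc i). b l \<in> tensor_part F (Suc (Suc i)) (polyring m n) (cdeg F (Suc i) l) \<and>
         cdiff F (Suc i) (b l) = \<theta> (Suc i) l - lin (crank F i) s (dcol F i l)" by auto
    have "cdiff F (Suc i) (\<theta> (Suc (Suc i)) l - lin (crank F (Suc i)) b (dcol F (Suc i) l)) = 0"
      if l: "l < crank F (Suc (Suc i))" for l
    proof -
      have "cdiff F (Suc i) (lin (crank F (Suc i)) b (dcol F (Suc i) l)) =
          lin (crank F (Suc i)) (\<lambda>k. \<theta> (Suc i) k - lin (crank F i) s (dcol F i k)) (dcol F (Suc i) l)"
        unfolding cdiff_lin using b by (intro lin_cong) auto
      also have "\<dots> = lin (crank F (Suc i)) (\<theta> (Suc i)) (dcol F (Suc i) l)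
          - lin (crank F i) s (cdiff F i (dcol F (Suc i) l))"
        by (simp add: lin_diff_left lin_cdiff)
      also have "\<dots> = lin (crank F (Suc i)) (\<theta> (Suc i)) (dcol F (Suc i) l)"
        by (simp add: dd[OF l])
      finally show ?thesis by (simp add: cdiff_diff comm[OF l])
    qed
    then have "P (Suc i) b" using b by (auto simp: P_def graded_map_def)
    moreover have "Q i s b" using b by (auto simp: Q_def)
    ultimately show "\<exists>y. P (Suc i) y \<and> Q i s y" by blast
  qed
  then obtain s where "\<forall>i. P i (s i)" "\<forall>i. Q i (s i) (s (Suc i))" by blast
  then show ?thesis unfolding P_def Q_def by (intro exI[of _ s]) auto
qed

section \<open>Comparison of two resolutions\<close>

definition ucol :: "nat \<Rightarrow> nat \<Rightarrow> 'k::field xpoly" where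
  "ucol l = (\<lambda>k. if k = l then 1 else 0)"

lemma lin_ucol: "v \<in> tensor F i M \<Longrightarrow> lin (crank F i) ucol v = v"
proof
  fix k assume v: "v \<in> tensor F i M"
  have "(\<Sum>l<crank F i. ucol l k * v l) = (\<Sum>l<crank F i. if k = l then v l else 0)"
    by (rule sum.cong) (auto simp: ucol_def)
  also have "\<dots> = v k" using v by (auto simp: tensor_def)
  finally show "lin (crank F i) ucol v k = v k" by (simp add: lin_def)
qed

lemma lin_ucol_left: "l < r \<Longrightarrow> lin r b (ucol l) = b l"
  by (auto simp: lin_def ucol_def fun_eq_iff if_distrib cong: if_cong)

lemma ucol_graded: "graded_map m n F i F i ucol"
  unfolding graded_map_def
  by (auto intro!: tensor_partI simp: ucol_def polyring_1 homogeneous_1)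

lemma tor_cycles_iff:
  "v \<in> tor_cycles F M i j \<longleftrightarrow> v \<in> tensor_part F i M j \<and> (\<forall>i'. i = Suc i' \<longrightarrow> cdiff F i' v = 0)"
  by (cases i) (auto simp: tor_cycles_def)

text \<open>
Chain maps \<open>\<phi>\<close> and \<open>\<psi>\<close> in both directions exist, and \<open>\<psi> \<circ> \<phi>\<close> is homotopic to the identity. Their matrix
entries lie in \<open>S\<close>, so the maps and the homotopy also act on the complexes tensored with the ideal \<open>M\<close>; this makes
\<open>\<phi>\<close> injective on homology.
\<close>

lemma tor_comparison:
  assumes F: "resolution_of_field m n F" and G: "resolution_of_field m n G"
    and M: "is_ideal m n M"
  obtains b where "graded_map m n F i G i b"
    and "\<And>z. z \<in> tor_cycles F M i j \<Longrightarrow> lin (crank F i) b z \<in> tor_cycles G M i j"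
    and "\<And>z. z \<in> tor_cycles F M i j \<Longrightarrow> lin (crank F i) b z \<in> tor_boundaries G M i j
           \<Longrightarrow> z \<in> tor_boundaries F M i j"
proof -
  obtain \<phi> where \<phi>: "chain_map m n F G \<phi>" and a\<phi>: "\<And>l. l < crank F 0 \<Longrightarrow> augmentation G (\<phi> 0 l) = caug F l"
    using exists_chain_map[OF F G] by blast
  obtain \<psi> where \<psi>: "chain_map m n G F \<psi>" and a\<psi>: "\<And>l. l < crank G 0 \<Longrightarrow> augmentation F (\<psi> 0 l) = caug G l"
    using exists_chain_map[OF G F] by blast
  define \<theta> where "\<theta> i l = lin (crank G i) (\<psi> i) (\<phi> i l) - ucol l" for i l
  have gr\<phi>: "graded_map m n F i G i (\<phi> i)" and gr\<psi>: "graded_map m n G i F i (\<psi> i)" for i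
    using \<phi> \<psi> by (auto simp: chain_map_def)
  have gr\<theta>: "graded_map m n F i F i (\<theta> i)" for i
    unfolding graded_map_def \<theta>_def
  proof (intro allI impI)
    fix l assume l: "l < crank F i"
    have "\<phi> i l \<in> tensor_part G i (polyring m n) (cdeg F i l)"
      using gr\<phi> l by (auto simp: graded_map_def)
    from lin_tensor_part[OF is_ideal_polyring gr\<psi> this] ucol_graded[of m n F i] l
    show "lin (crank G i) (\<psi> i) (\<phi> i l) - ucol l \<in> tensor_part F i (polyring m n) (cdeg F i l)"
      using tensor_part_diff[OF is_ideal_polyring] unfolding graded_map_def by blast
  qed
  have lin\<theta>: "lin (crank F i) (\<theta> i) v = lin (crank G i) (\<psi> i) (lin (crank F i) (\<phi> i) v) - v"
    if "v \<in> tensor F i N" for i v N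
    unfolding \<theta>_def lin_diff_left lin_ucol[OF that] by (simp add: lin_lin)
  have "chain_map m n F F \<theta>"
    unfolding chain_map_def
  proof (intro conjI allI impI gr\<theta>)
    fix i l assume l: "l < crank F (Suc i)"
    have t: "dcol F i l \<in> tensor F i (polyring m n)"
      using dcol_tensor_part[OF F l] by (auto simp: tensor_part_def)
    have u: "cdiff F i (ucol l) = dcol F i l"
      unfolding cdiff_eq_lin by (rule lin_ucol_left[OF l])
    have "cdiff F i (\<theta> (Suc i) l) =
        lin (crank G i) (\<psi> i) (cdiff G i (\<phi> (Suc i) l)) - dcol F i l"
      unfolding \<theta>_def cdiff_diff u chain_map_commute[OF \<psi>] ..
    also have "cdiff G i (\<phi> (Suc i) l) = lin (crank F i) (\<phi> i) (dcol F i l)"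
      using \<phi> l by (auto simp: chain_map_def)
    finally show "cdiff F i (\<theta> (Suc i) l) = lin (crank F i) (\<theta> i) (dcol F i l)"
      unfolding lin\<theta>[OF t] .
  qed
  moreover have "augmentation F (\<theta> 0 l) = 0" if l: "l < crank F 0" for l
  proof -
    have "augmentation F (lin (crank G 0) (\<psi> 0) (\<phi> 0 l)) = augmentation G (\<phi> 0 l)"
      using a\<psi> by (simp add: augmentation_lin) (simp add: augmentation_def mult.commute)
    moreover have "(\<Sum>k<crank F 0. coef (ucol l k) 0 * caug F k) = (\<Sum>k<crank F 0. if k = l then caug F k else 0)"
      by (rule sum.cong) (auto simp: ucol_def)
    then have "augmentation F (ucol l) = caug F l" using l by (simp add: augmentation_def)
    ultimately show ?thesis using a\<phi>[OF l] by (simp add: \<theta>_def augmentation_diff)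
  qed
  ultimately obtain s where s: "\<And>i. graded_map m n F i F (Suc i) (s i)"
    and s0: "\<And>l. l < crank F 0 \<Longrightarrow> cdiff F 0 (s 0 l) = \<theta> 0 l"
    and sS: "\<And>i l. l < crank F (Suc i) \<Longrightarrow>
       cdiff F (Suc i) (s (Suc i) l) = \<theta> (Suc i) l - lin (crank F i) (s i) (dcol F i l)"
    using chain_map_null_homotopic[OF F] by blast
  show ?thesis
  proof (rule that[of "\<phi> i"])
    show "graded_map m n F i G i (\<phi> i)" by (rule gr\<phi>)
  next
    fix z assume z: "z \<in> tor_cycles F M i j"
    then have zt: "z \<in> tensor_part F i M j" by (simp add: tor_cycles_iff)
    from lin_tensor_part[OF M gr\<phi> this]
    have t: "lin (crank F i) (\<phi> i) z \<in> tensor_part G i M j" .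
    moreover have "cdiff G i' (lin (crank F i) (\<phi> i) z) = 0" if "i = Suc i'" for i'
      using z that by (simp add: chain_map_commute[OF \<phi>] tor_cycles_iff)
    ultimately show "lin (crank F i) (\<phi> i) z \<in> tor_cycles G M i j" by (simp add: tor_cycles_iff)
    assume "lin (crank F i) (\<phi> i) z \<in> tor_boundaries G M i j"
    then obtain w where w: "w \<in> tensor_part G (Suc i) M j" "lin (crank F i) (\<phi> i) z = cdiff G i w"
      by (auto simp: tor_boundaries_def)
    have \<theta>z: "lin (crank F i) (\<theta> i) z = cdiff F i (lin (crank F i) (s i) z)"
    proof (cases i)
      case 0
      have "cdiff F 0 (lin (crank F 0) (s 0) z) = lin (crank F 0) (\<theta> 0) z"
        unfolding cdiff_lin by (rule lin_cong) (simp add: s0)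
      then show ?thesis using 0 by simp
    next
      case (Suc i')
      have "cdiff F (Suc i') (lin (crank F (Suc i')) (s (Suc i')) z) =
          lin (crank F (Suc i')) (\<lambda>l. \<theta> (Suc i') l - lin (crank F i') (s i') (dcol F i' l)) z"
        unfolding cdiff_lin by (rule lin_cong) (simp add: sS)
      also have "\<dots> = lin (crank F (Suc i')) (\<theta> (Suc i')) z - lin (crank F i') (s i') (cdiff F i' z)"
        by (simp add: lin_diff_left lin_cdiff)
      finally show ?thesis using z Suc by (simp add: tor_cycles_iff)
    qed
    have "z = lin (crank G i) (\<psi> i) (cdiff G i w) - lin (crank F i) (\<theta> i) z"
      using zt by (simp add: lin\<theta>[of z i M] tensor_part_def w(2))
    also have "\<dots> = cdiff F i (lin (crank G (Suc i)) (\<psi> (Suc i)) w - lin (crank F i) (s i) z)"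
      by (simp add: cdiff_diff chain_map_commute[OF \<psi>] \<theta>z)
    finally have "z = cdiff F i (lin (crank G (Suc i)) (\<psi> (Suc i)) w - lin (crank F i) (s i) z)" .
    moreover have "lin (crank G (Suc i)) (\<psi> (Suc i)) w - lin (crank F i) (s i) z \<in> tensor_part F (Suc i) M j"
      by (rule tensor_part_diff[OF M]) (use lin_tensor_part[OF M] gr\<psi> s w zt in blast)+
    ultimately show "z \<in> tor_boundaries F M i j" by (auto simp: tor_boundaries_def)
  qed
qed

section \<open>Dimensions of quotients\<close>

text \<open>
No element of \<open>Z\<close> outside \<open>B\<close> is mapped into \<open>B'\<close>, so a basis of a complement of \<open>B\<close> in \<open>Z\<close> is mapped to vectors
that together with a basis of \<open>B'\<close> are independent. The finite sets \<open>S\<close> and \<open>S'\<close> provide finite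
dimension, since the ambient space has infinite dimension.
\<close>

lemma (in Vector_Spaces.vector_space) quotient_dim_le:
  assumes add: "\<And>x y. f (x + y) = f x + f y" and sc: "\<And>c x. f (scale c x) = scale c (f x)"
    and B: "B \<subseteq> Z" and fin: "finite S" "Z \<subseteq> span S"
    and B': "B' \<subseteq> Z'" "subspace B'" and sB: "subspace B" and fin': "finite S'" "Z' \<subseteq> span S'"
    and fZ: "f ` Z \<subseteq> Z'" and fB: "\<And>z. z \<in> Z \<Longrightarrow> f z \<in> B' \<Longrightarrow> z \<in> B" and sZ: "subspace Z"
  shows "dim Z - dim B \<le> dim Z' - dim B'"
proof -
  interpret f: module_hom scale scale f
    by (intro module_hom.intro module_hom_axioms.intro module_axioms add sc)
  obtain B1 where B1: "B1 \<subseteq> B" "independent B1" "B \<subseteq> span B1" "card B1 = dim B"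
    using basis_exists by metis
  obtain E where E: "B1 \<subseteq> E" "E \<subseteq> Z" "independent E" "Z \<subseteq> span E"
    using maximal_independent_subset_extend[of B1 Z] B1 B by (metis subset_trans)
  have finE: "finite E" using independent_span_bound[OF fin(1) E(3)] E fin by blast
  have cE: "card E = dim Z" using E basis_card_eq_dim by blast
  obtain B2 where B2: "B2 \<subseteq> B'" "independent B2" "B' \<subseteq> span B2" "card B2 = dim B'"
    using basis_exists by metis
  have finB2: "finite B2" using independent_span_bound[OF fin'(1) B2(2)] B2 B' fin' by blast
  have "inj_on f D \<and> f ` D \<inter> B2 = {} \<and> independent (f ` D \<union> B2)" if "finite D" "D \<subseteq> E - B1" for D
    using that
  proof (induction D)
    case empty
    then show ?case using B2 by simp
  next
    case (insert d D)
    have "f d \<notin> span (f ` D \<union> B2)"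
    proof
      assume "f d \<in> span (f ` D \<union> B2)"
      then obtain x b where x: "x \<in> span D" and b: "b \<in> span B2" and "f d = f x + b"
        by (auto simp: span_Un f.span_image)
      moreover have "span B2 \<subseteq> B'" using B2 B' by (simp add: span_minimal)
      ultimately have "f (d - x) \<in> B'" by (auto simp: f.diff)
      moreover have "span D \<subseteq> Z" using insert.prems E sZ by (intro span_minimal) auto
      then have "d - x \<in> Z" using insert.prems x E sZ by (intro subspace_diff) auto
      ultimately have "d - x \<in> span B1" using fB B1 by blast
      then have "(d - x) + x \<in> span (D \<union> B1)"
        using x by (intro span_add) (meson span_mono subsetD Un_upper1 Un_upper2)+
      then have "d \<in> span (D \<union> B1)" by simp
      moreover have "D \<union> B1 \<subseteq> E - {d}" using insert E by auto
      ultimately have "d \<in> span (E - {d})" using span_mono by blast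
      moreover have "d \<in> E" using insert by auto
      ultimately show False using E(3) dependent_def by blast
    qed
    note fd = this
    have ih: "inj_on f D" "f ` D \<inter> B2 = {}" "independent (f ` D \<union> B2)" using insert by auto
    have "independent (insert (f d) (f ` D \<union> B2))"
      by (rule independent_insertI[OF fd ih(3)])
    moreover have "f d \<notin> f ` D \<union> B2" using fd span_base[of "f d" "f ` D \<union> B2"] by metis
    ultimately show ?case using ih by auto
  qed
  from this[of "E - B1"] finE have D: "inj_on f (E - B1)" "f ` (E - B1) \<inter> B2 = {}"
    "independent (f ` (E - B1) \<union> B2)" by auto
  let ?I = "f ` (E - B1) \<union> B2"
  have IZ: "?I \<subseteq> Z'" using E fZ B2 B' by blast
  obtain E' where E': "?I \<subseteq> E'" "E' \<subseteq> Z'" "independent E'" "Z' \<subseteq> span E'"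
    using maximal_independent_subset_extend[OF IZ D(3)] by metis
  have "finite E'" using independent_span_bound[OF fin'(1) E'(3)] E' fin' by blast
  moreover have "card E' = dim Z'" using E' basis_card_eq_dim by blast
  moreover have "card ?I = card (E - B1) + card B2"
    using D finE finB2 by (subst card_Un_disjoint) (auto simp: card_image)
  moreover have "card (E - B1) = dim Z - dim B"
    using E finE cE B1 by (simp add: card_Diff_subset finite_subset)
  ultimately show ?thesis using card_mono[of E' ?I] E' B2 by linarith
qed

lemma (in Vector_Spaces.vector_space) dim_eq_card_family:
  assumes fin: "finite P" and b: "\<And>p. p \<in> P \<Longrightarrow> b p \<in> Z"
    and spans: "\<And>v. v \<in> Z \<Longrightarrow> \<exists>c. v = (\<Sum>p\<in>P. scale (c p) (b p))"
    and indep: "\<And>c p. (\<Sum>p\<in>P. scale (c p) (b p)) = 0 \<Longrightarrow> p \<in> P \<Longrightarrow> c p = 0"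
  shows "dim Z = card P"
proof -
  have inj: "inj_on b P"
  proof (rule inj_onI, rule ccontr)
    fix p q assume pq: "p \<in> P" "q \<in> P" "b p = b q" "p \<noteq> q"
    let ?c = "\<lambda>x. if x = p then 1 :: 'a else if x = q then - 1 else 0"
    have "(\<Sum>x\<in>P. scale (?c x) (b x)) = (\<Sum>x\<in>{p, q}. scale (?c x) (b x))"
      by (rule sum.mono_neutral_right) (use pq fin in auto)
    also have "\<dots> = 0" using pq by simp
    finally have "?c p = 0" using indep[of ?c p] pq(1) by blast
    then show False by simp
  qed
  have "independent (b ` P)"
  proof (rule independent_if_scalars_zero)
    fix f x assume "(\<Sum>x\<in>b ` P. scale (f x) x) = 0" and x: "x \<in> b ` P"
    then have "(\<Sum>p\<in>P. scale (f (b p)) (b p)) = 0" by (simp add: sum.reindex[OF inj])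
    then show "f x = 0" using indep[of "\<lambda>p. f (b p)"] x by auto
  qed (simp add: fin)
  moreover have "Z \<subseteq> span (b ` P)"
  proof
    fix v assume "v \<in> Z"
    then obtain c where v: "v = (\<Sum>p\<in>P. scale (c p) (b p))" using spans by blast
    show "v \<in> span (b ` P)"
      unfolding v by (rule span_sum, rule span_scale, rule span_base, rule imageI)
  qed
  ultimately have "card (b ` P) = dim Z" using b by (intro basis_card_eq_dim) auto
  then show ?thesis by (simp add: card_image[OF inj])
qed

interpretation KV: Vector_Spaces.vector_space "kscale :: 'k::field \<Rightarrow> _"
  by (rule vector_space_kscale)

lemma finite_monomials: "finite {t. vars t \<subseteq> {1..m} \<times> {1..n} \<and> int (mon_degree t) = d}"
proof -
  define V where "V = {1..m} \<times> {1..n}"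
  define T where "T = {t. vars t \<subseteq> V \<and> int (mon_degree t) = d}"
  define R where "R = {f. \<forall>x. (x \<in> V \<longrightarrow> f x \<in> {0..nat d}) \<and> (x \<notin> V \<longrightarrow> f x = (0::nat))}"
  have V: "finite V" by (simp add: V_def)
  have "expo t \<in> R" if t: "t \<in> T" for t
  proof -
    have tV: "vars t \<subseteq> V" and td: "int (mon_degree t) = d" using t by (auto simp: T_def)
    have "expo t u \<le> nat d" if u: "u \<in> V" for u
    proof -
      have "expo t u \<le> (\<Sum>v\<in>V. expo t v)" by (rule member_le_sum[OF u _ V]) simp
      also have "\<dots> = mon_degree t" by (rule mon_degree_superset[OF V tV, symmetric])
      finally show ?thesis using td by linarith
    qed
    moreover have "expo t u = 0" if "u \<notin> V" for u
      using tV that by (meson in_keys_iff subsetD)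
    ultimately show ?thesis by (simp add: R_def)
  qed
  moreover have "finite R" unfolding R_def by (rule finite_set_of_finite_funs[OF V]) simp
  ultimately have "finite (expo ` T)" by (meson finite_subset image_subsetI)
  moreover have "inj_on expo T" by (meson inj_onI poly_mapping_eq_iff)
  ultimately have "finite T" by (rule finite_imageD)
  then show ?thesis by (simp add: T_def V_def)
qed

lemma poly_mapping_sum_monomials: "p = (\<Sum>t\<in>Poly_Mapping.keys p. Poly_Mapping.single t (Poly_Mapping.lookup p t))"
proof (rule poly_mapping_eqI)
  fix k
  have "Poly_Mapping.lookup (\<Sum>t\<in>Poly_Mapping.keys p. Poly_Mapping.single t (Poly_Mapping.lookup p t)) k =
      (\<Sum>t\<in>Poly_Mapping.keys p. if t = k then Poly_Mapping.lookup p t else 0)"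
    unfolding lookup_sum by (rule sum.cong) (auto simp: lookup_single when_def)
  also have "\<dots> = (if k \<in> Poly_Mapping.keys p then Poly_Mapping.lookup p k else 0)"
    by (rule sum.delta) simp
  also have "\<dots> = Poly_Mapping.lookup p k" by (simp add: in_keys_iff)
  finally show "Poly_Mapping.lookup p k =
      Poly_Mapping.lookup (\<Sum>t\<in>Poly_Mapping.keys p. Poly_Mapping.single t (Poly_Mapping.lookup p t)) k" ..
qed

lemma sum_fun_apply: "(sum f A) x = (\<Sum>a\<in>A. f a x)" for f :: "'a \<Rightarrow> 'b \<Rightarrow> 'c::comm_monoid_add"
  by (induction A rule: infinite_finite_induct) auto

text \<open>
Finite dimension matters for the truth of the statements below, because \<open>dim\<close> is \<open>0\<close> on spaces of infinite
dimension.
\<close>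

lemma tensor_part_finite_dim:
  assumes M: "M \<subseteq> polyring m n"
  obtains S where "finite S" "tensor_part F i M j \<subseteq> KV.span S"
proof -
  define T where "T r = {t. vars t \<subseteq> {1..m} \<times> {1..n} \<and> int (mon_degree t) = j - cdeg F i r}" for r
  define e where "e r t = (\<lambda>k. if k = r then Poly_Mapping.single t 1 else 0 :: 'a xpoly)" for r :: nat and t
  define S where "S = (\<Union>r<crank F i. e r ` T r)"
  have "finite (T r)" for r unfolding T_def by (rule finite_monomials)
  then have "finite S" by (simp add: S_def)
  moreover have "v \<in> KV.span S" if v: "v \<in> tensor_part F i M j" for v
  proof -
    have vr: "v r \<in> polyring m n" "homogeneous (j - cdeg F i r) (v r)" if "r < crank F i" for r
      using v that M by (auto simp: tensor_part_def tensor_def)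
    have v0: "v r = 0" if "\<not> r < crank F i" for r
      using v that by (auto simp: tensor_part_def tensor_def)
    have row: "(\<Sum>t\<in>Poly_Mapping.keys (v r). kscale (coef (v r) t) (e r t) k) = (if k = r then v k else 0)" for r k
    proof (cases "k = r")
      case True
      have "(\<Sum>t\<in>Poly_Mapping.keys (v r). kscale (coef (v r) t) (e r t) k) =
          (\<Sum>t\<in>Poly_Mapping.keys (v r). Poly_Mapping.single t (coef (v r) t))"
        by (rule sum.cong) (simp_all add: kscale_def xconst_def mult_single True e_def)
      also have "\<dots> = v r" by (rule poly_mapping_sum_monomials[symmetric])
      finally show ?thesis using True by simp
    next
      case False
      then show ?thesis by (simp add: kscale_def e_def)
    qed
    have "v = (\<Sum>r<crank F i. \<Sum>t\<in>Poly_Mapping.keys (v r). kscale (coef (v r) t) (e r t))"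
      unfolding fun_eq_iff sum_fun_apply row using v0 by simp
    also have "\<dots> \<in> KV.span S"
    proof (rule KV.span_sum, rule KV.span_sum, rule KV.span_scale, rule KV.span_base)
      fix r t assume r: "r \<in> {..<crank F i}" and t: "t \<in> Poly_Mapping.keys (v r)"
      then have "t \<in> T r" using vr[of r] unfolding T_def polyring_def homogeneous_def by blast
      then show "e r t \<in> S" using r unfolding S_def by blast
    qed
    finally show ?thesis .
  qed
  ultimately show ?thesis using that by blast
qed

lemma tensor_part_subspace:
  assumes M: "is_ideal m n M"
  shows "KV.subspace (tensor_part F i M j)"
proof (rule KV.subspaceI)
  show "0 \<in> tensor_part F i M j"
    using M by (auto intro!: tensor_partI simp: is_ideal_def)
next
  fix v w assume "v \<in> tensor_part F i M j" "w \<in> tensor_part F i M j"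
  then show "v + w \<in> tensor_part F i M j"
    using M by (auto simp: tensor_part_def tensor_def is_ideal_def homogeneous_add)
next
  fix c v assume v: "v \<in> tensor_part F i M j"
  show "kscale c v \<in> tensor_part F i M j"
  proof (rule tensor_partI)
    fix k assume "k < crank F i"
    then show "kscale c v k \<in> M \<and> homogeneous (j - cdeg F i k) (kscale c v k)"
      using v M homogeneous_mult[OF homogeneous_xconst, of "j - cdeg F i k" "v k" c]
      by (auto simp: kscale_def tensor_part_def tensor_def is_ideal_def polyring_xconst)
  qed (use v in \<open>auto simp: kscale_def tensor_part_def tensor_def\<close>)
qed

lemma linear_cdiff: "Vector_Spaces.linear kscale kscale (cdiff F i)"
  by (intro Vector_Spaces.linear.intro module_hom.intro module_hom_axioms.intro vector_space_kscale
      KV.module_axioms) (auto simp: cdiff_eq_lin lin_add lin_kscale)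

lemma tor_cycles_subspace:
  assumes M: "is_ideal m n M"
  shows "KV.subspace (tor_cycles F M i j)"
proof -
  have c0: "kscale c 0 = 0" for c :: 'a by (simp add: kscale_def fun_eq_iff)
  note sub = tensor_part_subspace[OF M, of F i j]
  show ?thesis
  proof (rule KV.subspaceI)
    show "0 \<in> tor_cycles F M i j"
      unfolding tor_cycles_iff using KV.subspace_0[OF sub] by simp
  next
    fix v w assume "v \<in> tor_cycles F M i j" "w \<in> tor_cycles F M i j"
    then show "v + w \<in> tor_cycles F M i j"
      unfolding tor_cycles_iff using KV.subspace_add[OF sub] by (simp add: cdiff_eq_lin lin_add)
  next
    fix c v assume "v \<in> tor_cycles F M i j"
    then show "kscale c v \<in> tor_cycles F M i j"
      unfolding tor_cycles_iff using KV.subspace_scale[OF sub] by (simp add: cdiff_eq_lin lin_kscale c0)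
  qed
qed

lemma tor_boundaries_subspace:
  assumes M: "is_ideal m n M"
  shows "KV.subspace (tor_boundaries F M i j)"
proof -
  interpret d: Vector_Spaces.linear kscale kscale "cdiff F i" by (rule linear_cdiff)
  show ?thesis unfolding tor_boundaries_def by (rule d.subspace_image[OF tensor_part_subspace[OF M]])
qed

lemma tor_boundaries_subset_cycles:
  assumes F: "resolution_of_field m n F" and M: "is_ideal m n M"
  shows "tor_boundaries F M i j \<subseteq> tor_cycles F M i j"
proof
  fix v assume "v \<in> tor_boundaries F M i j"
  then obtain w where w: "w \<in> tensor_part F (Suc i) M j" "v = cdiff F i w"
    by (auto simp: tor_boundaries_def)
  have "w \<in> tensor_part F (Suc i) (polyring m n) j"
    using w M tensor_part_mono[of M "polyring m n"] by (auto simp: is_ideal_def)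
  from aug_cycle_cdiff[OF F this] cdiff_tensor_part[OF F M w(1)] show "v \<in> tor_cycles F M i j"
    by (auto simp: w(2) tor_cycles_iff aug_cycle_def)
qed

lemma tor_dim_le:
  assumes F: "resolution_of_field m n F" and G: "resolution_of_field m n G" and M: "is_ideal m n M"
  shows "kdim (tor_cycles F M i j) - kdim (tor_boundaries F M i j) \<le>
         kdim (tor_cycles G M i j) - kdim (tor_boundaries G M i j)"
proof -
  obtain b where b: "graded_map m n F i G i b"
    "\<And>z. z \<in> tor_cycles F M i j \<Longrightarrow> lin (crank F i) b z \<in> tor_cycles G M i j"
    "\<And>z. z \<in> tor_cycles F M i j \<Longrightarrow> lin (crank F i) b z \<in> tor_boundaries G M i j
           \<Longrightarrow> z \<in> tor_boundaries F M i j"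
    using tor_comparison[OF F G M] by metis
  have MP: "M \<subseteq> polyring m n" using M by (simp add: is_ideal_def)
  obtain S where S: "finite S" "tensor_part F i M j \<subseteq> KV.span S"
    using tensor_part_finite_dim[OF MP] by metis
  obtain S' where S': "finite S'" "tensor_part G i M j \<subseteq> KV.span S'"
    using tensor_part_finite_dim[OF MP] by metis
  show ?thesis
  proof (rule KV.quotient_dim_le[of "lin (crank F i) b" _ _ S _ _ S'])
    show "tor_cycles F M i j \<subseteq> KV.span S" using S by (auto simp: tor_cycles_iff)
    show "tor_cycles G M i j \<subseteq> KV.span S'" using S' by (auto simp: tor_cycles_iff)
  qed (use b S S' tor_boundaries_subset_cycles[OF _ M] F G in
     \<open>auto simp: lin_add lin_kscale tor_boundaries_subspace[OF M] tor_cycles_subspace[OF M]\<close>)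
qed

theorem betti_eq:
  assumes F: "resolution_of_field m n F" and M: "is_ideal m n M"
  shows "betti m n M i j = kdim (tor_cycles F M i j) - kdim (tor_boundaries F M i j)"
proof -
  define G where "G = (SOME F :: 'a free_complex. resolution_of_field m n F)"
  have G: "resolution_of_field m n G" unfolding G_def using F by (rule someI)
  show ?thesis
    unfolding betti_def Let_def G_def[symmetric]
    using tor_dim_le[OF F G M, of i j] tor_dim_le[OF G F M, of i j] by simp
qed

section \<open>The Koszul complex\<close>

definition grid :: "nat \<Rightarrow> nat \<Rightarrow> (nat \<times> nat) set" where
  "grid m n = {1..m} \<times> {1..n}"

text \<open>
The order on the variables is column-major. With this order the Koszul signs of a set of variables in distinct columns
depend on the columns only.
\<close>

definition vkey :: "nat \<Rightarrow> nat \<times> nat \<Rightarrow> nat" where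
  "vkey m u = snd u * Suc m + fst u"

definition ksign :: "nat \<Rightarrow> nat \<times> nat \<Rightarrow> (nat \<times> nat) set \<Rightarrow> 'a::comm_ring_1" where
  "ksign m u B = (- 1) ^ card {v \<in> B. vkey m v < vkey m u}"

definition ksets :: "nat \<Rightarrow> nat \<Rightarrow> nat \<Rightarrow> (nat \<times> nat) set set" where
  "ksets m n i = {A. A \<subseteq> grid m n \<and> card A = i}"

text \<open>
The Koszul complex, with \<open>w A\<close> the coefficient of the wedge product of the variables in \<open>A\<close>. The
coefficient of the differential at \<open>B\<close> collects the sets that contain \<open>B\<close> and one more variable.
\<close>

definition kdiff :: "nat \<Rightarrow> nat \<Rightarrow> ((nat \<times> nat) set \<Rightarrow> 'k::field xpoly) \<Rightarrow> (nat \<times> nat) set \<Rightarrow> 'k xpoly" where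
  "kdiff m n w B = (\<Sum>u\<in>grid m n - B. xconst (ksign m u B) * (vpoly u * w (insert u B)))"

lemma finite_grid: "finite (grid m n)"
  by (simp add: grid_def)

lemma finite_ksets: "finite (ksets m n i)"
  unfolding ksets_def by (rule finite_subset[of _ "Pow (grid m n)"]) (auto simp: finite_grid)

lemma ksets_finite: "A \<in> ksets m n i \<Longrightarrow> finite A"
  unfolding ksets_def using finite_grid finite_subset by blast

lemma vkey_less_iff:
  assumes "fst u \<le> m" "fst v \<le> m"
  shows "vkey m u < vkey m v \<longleftrightarrow> snd u < snd v \<or> (snd u = snd v \<and> fst u < fst v)"
proof -
  have col: "vkey m a < vkey m b" if "snd a < snd b" "fst a \<le> m" for a b
  proof -
    have "Suc (snd a) * Suc m \<le> snd b * Suc m" using that by (intro mult_right_mono) auto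
    then show ?thesis using that by (simp add: vkey_def)
  qed
  show ?thesis
  proof (cases "snd u" "snd v" rule: linorder_cases)
    case less
    then show ?thesis using col[of u v] assms by simp
  next
    case equal
    then show ?thesis by (simp add: vkey_def)
  next
    case greater
    then show ?thesis using col[of v u] assms by (simp add: less_asym)
  qed
qed

lemma inj_on_vkey: "inj_on (vkey m) (grid m n)"
proof (rule inj_onI)
  fix u v assume u: "u \<in> grid m n" "v \<in> grid m n" "vkey m u = vkey m v"
  then have "fst u \<le> m" "fst v \<le> m" by (auto simp: grid_def)
  with u(3) vkey_less_iff[of u m v] vkey_less_iff[of v m u] show "u = v"
    by (metis less_irrefl linorder_neqE_nat prod.expand)
qed

lemma ksign_insert_less:
  assumes "finite B" "u \<notin> B" "vkey m u < vkey m v"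
  shows "ksign m v (insert u B) = - ksign m v B"
proof -
  have "{x \<in> insert u B. vkey m x < vkey m v} = insert u {x \<in> B. vkey m x < vkey m v}"
    using assms by auto
  then show ?thesis using assms by (simp add: ksign_def)
qed

lemma ksign_insert_ge:
  assumes "vkey m v \<le> vkey m u"
  shows "ksign m v (insert u B) = ksign m v B"
proof -
  have "{x \<in> insert u B. vkey m x < vkey m v} = {x \<in> B. vkey m x < vkey m v}"
    using assms by auto
  then show ?thesis by (simp add: ksign_def)
qed

lemma ksign_min: "(\<And>x. x \<in> B \<Longrightarrow> vkey m v \<le> vkey m x) \<Longrightarrow> ksign m v B = 1"
proof -
  assume "\<And>x. x \<in> B \<Longrightarrow> vkey m v \<le> vkey m x"
  then have "{x \<in> B. vkey m x < vkey m v} = {}" by fastforce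
  then show ?thesis unfolding ksign_def by (simp only: card.empty power_0)
qed

lemma xconst_mult: "xconst a * xconst b = xconst (a * b)"
  by (simp add: xconst_def mult_single)

lemma xconst_uminus: "xconst (- a) = - xconst a"
  by (simp add: xconst_def single_uminus)

text \<open>
The terms are cancelled in pairs \<open>(u, v)\<close>, \<open>(v, u)\<close>, which is also valid in characteristic \<open>2\<close>.
\<close>

lemma sum_antisymmetric:
  fixes f :: "'a \<Rightarrow> 'a \<Rightarrow> 'b::ab_group_add" and key :: "'a \<Rightarrow> nat"
  assumes "finite D" and inj: "inj_on key D"
    and f: "\<And>u v. u \<in> D \<Longrightarrow> v \<in> D \<Longrightarrow> key u < key v \<Longrightarrow> f u v = - f v u"
  shows "(\<Sum>u\<in>D. \<Sum>v\<in>D - {u}. f u v) = 0"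
proof -
  have "(\<Sum>v\<in>D - {u}. f u v) = (\<Sum>v\<in>{v\<in>D. key u < key v}. f u v) + (\<Sum>v\<in>{v\<in>D. key v < key u}. f u v)"
    if "u \<in> D" for u
  proof -
    have "D - {u} = {v\<in>D. key u < key v} \<union> {v\<in>D. key v < key u}"
      using inj that by (auto simp: inj_on_def) (metis linorder_neqE_nat)
    then show ?thesis using assms(1) by (simp add: sum.union_disjoint[symmetric] disjoint_iff)
  qed
  then have "(\<Sum>u\<in>D. \<Sum>v\<in>D - {u}. f u v) =
      (\<Sum>u\<in>D. \<Sum>v\<in>{v\<in>D. key u < key v}. f u v) + (\<Sum>u\<in>D. \<Sum>v\<in>{v\<in>D. key v < key u}. f u v)"
    by (simp add: sum.distrib)
  also have "(\<Sum>u\<in>D. \<Sum>v\<in>{v\<in>D. key v < key u}. f u v) = (\<Sum>v\<in>D. \<Sum>u\<in>{u\<in>D. key v < key u}. f u v)"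
    by (rule sum.swap_restrict[OF assms(1,1)])
  also have "\<dots> = (\<Sum>v\<in>D. \<Sum>u\<in>{u\<in>D. key v < key u}. - f v u)"
    by (intro sum.cong refl) (use f in \<open>metis (mono_tags, lifting) f add.inverse_inverse mem_Collect_eq\<close>)
  also have "\<dots> = - (\<Sum>v\<in>D. \<Sum>u\<in>{u\<in>D. key v < key u}. f v u)"
    by (simp add: sum_negf)
  finally show ?thesis by simp
qed

lemma kdiff_kdiff:
  assumes B: "B \<subseteq> grid m n"
  shows "kdiff m n (kdiff m n w) B = 0"
proof -
  let ?D = "grid m n - B"
  have fB: "finite B" using B finite_grid finite_subset by blast
  define f where "f u v = xconst (ksign m u B * ksign m v (insert u B)) * (vpoly u * (vpoly v * w (insert v (insert u B))))"
    for u v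
  have D: "grid m n - insert u B = ?D - {u}" for u by auto
  have "kdiff m n (kdiff m n w) B = (\<Sum>u\<in>?D. \<Sum>v\<in>?D - {u}. f u v)"
    by (simp add: kdiff_def D f_def sum_distrib_left xconst_mult[symmetric] mult_ac)
  also have "\<dots> = 0"
  proof (rule sum_antisymmetric[where key = "vkey m"])
    fix u v assume u: "u \<in> ?D" and v: "v \<in> ?D" and less: "vkey m u < vkey m v"
    have "ksign m u B * ksign m v (insert u B) = - (ksign m v B * ksign m u (insert v B) :: 'a)"
      using less u by (simp add: ksign_insert_less[OF fB _ less] ksign_insert_ge)
    then show "f u v = - f v u"
      by (simp add: f_def xconst_uminus insert_commute mult_ac)
  next
    show "inj_on (vkey m) (grid m n - B)" by (rule inj_on_subset[OF inj_on_vkey Diff_subset])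
  qed (simp add: finite_grid)
  finally show ?thesis .
qed

lemma coef_kdiff:
  "coef (kdiff m n w B) t =
    (\<Sum>u\<in>(grid m n - B) \<inter> vars t. ksign m u B * coef (w (insert u B)) (t - var1 u))"
proof -
  have "coef (kdiff m n w B) t =
    (\<Sum>u\<in>grid m n - B. if u \<in> vars t then ksign m u B * coef (w (insert u B)) (t - var1 u) else 0)"
    unfolding kdiff_def lookup_sum coef_xconst_mult coef_vpoly_mult by (rule sum.cong) auto
  then show ?thesis by (simp add: sum.inter_restrict finite_grid)
qed

section \<open>The contracting homotopy\<close>

text \<open>
Division by the variable \<open>v\<close> of those terms in which \<open>v\<close> is the least variable; the other terms are dropped.
\<close>

definition mshift :: "nat \<Rightarrow> nat \<times> nat \<Rightarrow> 'k::field xpoly \<Rightarrow> 'k xpoly" where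
  "mshift m v p = Abs_poly_mapping (\<lambda>s. if \<forall>u\<in>vars s. vkey m v \<le> vkey m u then coef p (s + var1 v) else 0)"

definition kmin :: "nat \<Rightarrow> (nat \<times> nat) set \<Rightarrow> nat \<times> nat" where
  "kmin m B = arg_min_on (vkey m) B"

text \<open>
The homotopy sends \<open>x\<^sup>t e\<^sub>A\<close> to \<open>(x\<^sup>t / x\<^sub>v) e\<^sub>v \<and> e\<^sub>A\<close>, where \<open>v\<close> is the least variable that occurs in \<open>t\<close> or \<open>A\<close>, if
\<open>v\<close> is not in \<open>A\<close>, and to \<open>0\<close> otherwise. The definition gives the coefficient at \<open>B = A \<union> {v}\<close>.
\<close>

definition khom :: "nat \<Rightarrow> ((nat \<times> nat) set \<Rightarrow> 'k::field xpoly) \<Rightarrow> (nat \<times> nat) set \<Rightarrow> 'k xpoly" where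
  "khom m w B = (if B = {} then 0 else mshift m (kmin m B) (w (B - {kmin m B})))"

lemma coef_mshift:
  "coef (mshift m v p) s = (if \<forall>u\<in>vars s. vkey m v \<le> vkey m u then coef p (s + var1 v) else 0)"
proof -
  have "finite ((\<lambda>s. s + var1 v) -` Poly_Mapping.keys p)"
    by (rule finite_vimageI) (auto simp: inj_def)
  then have "finite {s. (if \<forall>u\<in>vars s. vkey m v \<le> vkey m u then coef p (s + var1 v) else 0) \<noteq> 0}"
    by (rule rev_finite_subset) (auto simp: in_keys_iff)
  then show ?thesis by (simp add: mshift_def)
qed

lemma kmin_in: "finite B \<Longrightarrow> B \<noteq> {} \<Longrightarrow> kmin m B \<in> B"
  unfolding kmin_def by (rule arg_min_if_finite(1))

lemma kmin_le: "finite B \<Longrightarrow> u \<in> B \<Longrightarrow> vkey m (kmin m B) \<le> vkey m u"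
  unfolding kmin_def by (rule arg_min_least) auto

lemma kmin_eqI:
  assumes "B \<subseteq> grid m n" "v \<in> B" "\<And>u. u \<in> B \<Longrightarrow> vkey m v \<le> vkey m u"
  shows "kmin m B = v"
proof -
  have fin: "finite B" using assms finite_grid finite_subset by blast
  have k: "kmin m B \<in> B" using fin assms kmin_in by blast
  have "vkey m (kmin m B) = vkey m v"
    using kmin_le[OF fin assms(2)] assms(3)[OF k] by (rule antisym)
  then show ?thesis using inj_on_vkey[of m n] k assms by (auto simp: inj_on_def)
qed

lemma polyring_grid: "p \<in> polyring m n \<longleftrightarrow> (\<forall>t. coef p t \<noteq> 0 \<longrightarrow> vars t \<subseteq> grid m n)"
  unfolding polyring_iff grid_def ..

lemma mshift_polyring: "p \<in> polyring m n \<Longrightarrow> mshift m v p \<in> polyring m n"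
  unfolding polyring_grid coef_mshift
proof (intro allI impI)
  fix s assume p: "\<forall>t. coef p t \<noteq> 0 \<longrightarrow> vars t \<subseteq> grid m n"
    and "(if \<forall>u\<in>vars s. vkey m v \<le> vkey m u then coef p (s + var1 v) else 0) \<noteq> 0"
  then have "vars (s + var1 v) \<subseteq> grid m n" by presburger
  then show "vars s \<subseteq> grid m n" by (simp add: vars_add)
qed

lemma ksets_insert:
  assumes "A \<in> ksets m n i" "u \<in> grid m n - A"
  shows "insert u A \<in> ksets m n (Suc i)"
  using assms ksets_finite[OF assms(1)] by (auto simp: ksets_def)

lemma ksets_remove:
  assumes "A \<in> ksets m n (Suc i)" "u \<in> A"
  shows "A - {u} \<in> ksets m n i"
  using assms ksets_finite[OF assms(1)] by (auto simp: ksets_def)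

lemma khom_polyring:
  assumes w: "\<And>A. A \<in> ksets m n i \<Longrightarrow> w A \<in> polyring m n" and B: "B \<in> ksets m n (Suc i)"
  shows "khom m w B \<in> polyring m n"
proof -
  have "B \<noteq> {}" using B by (auto simp: ksets_def)
  then have "B - {kmin m B} \<in> ksets m n i"
    using ksets_remove[OF B] kmin_in ksets_finite[OF B] by blast
  then show ?thesis using w by (simp add: khom_def mshift_polyring)
qed

lemma kdiff_polyring:
  assumes w: "\<And>A. A \<in> ksets m n (Suc i) \<Longrightarrow> w A \<in> polyring m n" and B: "B \<in> ksets m n i"
  shows "kdiff m n w B \<in> polyring m n"
  unfolding kdiff_def
proof (rule is_ideal_sum[OF is_ideal_polyring])
  fix u assume u: "u \<in> grid m n - B"
  then show "xconst (ksign m u B) * (vpoly u * w (insert u B)) \<in> polyring m n"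
    using ksets_insert[OF B u] w
    by (intro polyring_mult polyring_xconst polyring_vpoly) (auto simp: grid_def)
qed

lemma var_add_diff_swap: "u \<in> vars t \<Longrightarrow> t - var1 u + var1 v = t + var1 v - var1 u"
  by (rule poly_mapping_eqI) (auto simp: lookup_add lookup_minus lookup_single in_keys_iff when_def)

text \<open>
Let \<open>v\<close> be the least variable in \<open>t\<close> or \<open>A\<close>. If \<open>v \<notin> A\<close>, only the summand for \<open>v\<close> survives in the coefficient
of the differential of the homotopy. If \<open>v \<in> A\<close>, the sum is the coefficient of the vanishing differential of \<open>w\<close> at
\<open>A - {v}\<close> and \<open>t + v\<close>, up to sign and without its summand for \<open>v\<close>, which is the coefficient sought.
\<close>

lemma koszul_homotopy:
  fixes w :: "(nat \<times> nat) set \<Rightarrow> 'k::field xpoly"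
  assumes w: "\<And>A. A \<in> ksets m n i \<Longrightarrow> w A \<in> polyring m n"
    and aug: "i = 0 \<Longrightarrow> coef (w {}) 0 = 0"
    and cyc: "\<And>i' C. i = Suc i' \<Longrightarrow> C \<in> ksets m n i' \<Longrightarrow> kdiff m n w C = 0"
    and A: "A \<in> ksets m n i"
  shows "kdiff m n (khom m w) A = w A"
proof (rule poly_mapping_eqI)
  fix t
  have Ag: "A \<subseteq> grid m n" using A by (simp add: ksets_def)
  have fA: "finite A" by (rule ksets_finite[OF A])
  show "coef (kdiff m n (khom m w) A) t = coef (w A) t"
  proof (cases "vars t \<subseteq> grid m n")
    case False
    have "kdiff m n (khom m w) A \<in> polyring m n"
      using kdiff_polyring[OF khom_polyring[OF w] A] .
    with w[OF A] False show ?thesis unfolding polyring_grid by metis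
  next
    case tg: True
    let ?U = "A \<union> vars t"
    have fU: "finite ?U" and Ug: "?U \<subseteq> grid m n" using fA Ag tg by auto
    show ?thesis
    proof (cases "?U = {}")
      case True
      then have "i = 0" "A = {}" "t = 0" using A by (auto simp: ksets_def)
      then show ?thesis using aug by (simp add: coef_kdiff)
    next
      case ne: False
      define v where "v = kmin m ?U"
      have vU: "v \<in> ?U" and vmin: "\<And>u. u \<in> ?U \<Longrightarrow> vkey m v \<le> vkey m u"
        unfolding v_def using kmin_in[OF fU ne] kmin_le[OF fU] by auto
      have vg: "v \<in> grid m n" using vU Ug by auto
      have kA: "ksign m v (A - {v}) = (1 :: 'k)" by (rule ksign_min) (use vmin in auto)
      show ?thesis
      proof (cases "v \<in> A")
        case False
        then have vt: "v \<in> vars t" using vU by auto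
        have z: "coef (khom m w (insert u A)) (t - var1 u) = 0"
          if u: "u \<in> (grid m n - A) \<inter> vars t" "u \<noteq> v" for u
        proof -
          let ?v = "kmin m (insert u A)"
          have "?v \<in> insert u A" using fA by (intro kmin_in) auto
          then have v': "?v \<in> grid m n" "?v \<noteq> v" "?v \<in> ?U" using u False Ag by auto
          then have "vkey m ?v \<noteq> vkey m v" using inj_on_vkey vg by (metis inj_on_def)
          then have "vkey m v < vkey m ?v" using vmin[OF v'(3)] by simp
          moreover have "v \<in> vars (t - var1 u)"
            using vt u by (auto simp: in_keys_iff lookup_minus lookup_single)
          ultimately have "\<not> (\<forall>x\<in>vars (t - var1 u). vkey m ?v \<le> vkey m x)" by force
          then show ?thesis by (simp only: khom_def coef_mshift if_False insert_not_empty)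
        qed
        have "coef (kdiff m n (khom m w) A) t =
            (\<Sum>u\<in>{v}. ksign m u A * coef (khom m w (insert u A)) (t - var1 u))"
          unfolding coef_kdiff
          by (rule sum.mono_neutral_right) (use z vt vg False finite_grid in auto)
        also have "\<dots> = coef (khom m w (insert v A)) (t - var1 v)"
          using kA False by simp
        also have "kmin m (insert v A) = v"
          by (rule kmin_eqI[of _ m n]) (use Ag vg vmin in auto)
        then have "coef (khom m w (insert v A)) (t - var1 v) = coef (w A) (t - var1 v + var1 v)"
        proof -
          have "vars (t - var1 v) \<subseteq> vars t" by (auto simp: in_keys_iff lookup_minus)
          then have "\<forall>x\<in>vars (t - var1 v). vkey m v \<le> vkey m x" using vmin by auto
          then show ?thesis using \<open>kmin m (insert v A) = v\<close> False by (simp add: khom_def coef_mshift)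
        qed
        also have "t - var1 v + var1 v = t"
          using var1_add_diff[OF vt] by (simp add: add.commute)
        finally show ?thesis .
      next
        case True
        let ?C = "A - {v}"
        obtain i' where i': "i = Suc i'" using A True fA by (cases i) (auto simp: ksets_def)
        have C: "?C \<in> ksets m n i'" using ksets_remove[OF A[unfolded i'] True] .
        have fC: "finite ?C" using fA by simp
        have vars_t: "vars (t + var1 v) = insert v (vars t)" by (auto simp: vars_add)
        let ?R = "(grid m n - A) \<inter> vars t"
        have R: "(grid m n - ?C) \<inter> vars (t + var1 v) = insert v ?R"
          using vg True by (auto simp: vars_t)
        have fR: "finite ?R" "v \<notin> ?R" using True finite_grid by auto
        have "0 = coef (kdiff m n w ?C) (t + var1 v)" using cyc[OF i' C] by simp
        also have "\<dots> = ksign m v ?C * coef (w (insert v ?C)) (t + var1 v - var1 v) +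
            (\<Sum>u\<in>?R. ksign m u ?C * coef (w (insert u ?C)) (t + var1 v - var1 u))"
          unfolding coef_kdiff R using fR by simp
        also have "ksign m v ?C * coef (w (insert v ?C)) (t + var1 v - var1 v) = coef (w A) t"
          using kA True by (simp add: insert_absorb)
        also have "(\<Sum>u\<in>?R. ksign m u ?C * coef (w (insert u ?C)) (t + var1 v - var1 u)) =
            (\<Sum>u\<in>?R. - (ksign m u A * coef (khom m w (insert u A)) (t - var1 u)))"
        proof (rule sum.cong[OF refl])
          fix u assume u: "u \<in> ?R"
          have "u \<noteq> v" using u True by auto
          then have "vkey m u \<noteq> vkey m v" using inj_on_vkey[of m n] vg u by (auto simp: inj_on_def)
          then have "vkey m v < vkey m u" using vmin[of u] u by auto
          then have "ksign m u (insert v ?C) = - (ksign m u ?C :: 'k)"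
            by (intro ksign_insert_less fC) auto
          then have s: "ksign m u A = - (ksign m u ?C :: 'k)"
            using True by (simp add: insert_absorb)
          have k: "kmin m (insert u A) = v"
            by (rule kmin_eqI[of _ m n]) (use Ag u True vmin in auto)
          have "vars (t - var1 u) \<subseteq> vars t" by (auto simp: in_keys_iff lookup_minus)
          then have "\<forall>x\<in>vars (t - var1 u). vkey m v \<le> vkey m x" using vmin by auto
          then have "coef (khom m w (insert u A)) (t - var1 u) =
              coef (w (insert u A - {v})) (t - var1 u + var1 v)"
            by (simp add: khom_def coef_mshift k)
          also have "insert u A - {v} = insert u ?C" using \<open>u \<noteq> v\<close> by auto
          also have "t - var1 u + var1 v = t + var1 v - var1 u" using u by (simp add: var_add_diff_swap)
          finally show "ksign m u ?C * coef (w (insert u ?C)) (t + var1 v - var1 u) =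
              - (ksign m u A * coef (khom m w (insert u A)) (t - var1 u))" by (simp add: s)
        qed
        also have "\<dots> = - coef (kdiff m n (khom m w) A) t" by (simp add: coef_kdiff sum_negf)
        finally show ?thesis by simp
      qed
    qed
  qed
qed

section \<open>The Koszul resolution\<close>

text \<open>
An enumeration of the sets of \<open>i\<close> variables, since bases of free modules are indexed by initial segments of the
naturals.
\<close>

definition ksub :: "nat \<Rightarrow> nat \<Rightarrow> nat \<Rightarrow> nat \<Rightarrow> (nat \<times> nat) set" where
  "ksub m n i = (SOME h. bij_betw h {..<card (ksets m n i)} (ksets m n i))"

text \<open>
The sum in \<open>cmat\<close> has at most one summand: it is empty unless the \<open>l\<close>-th set extends the \<open>k\<close>-th one by a
single variable.
\<close>

definition koszul :: "nat \<Rightarrow> nat \<Rightarrow> 'k::field free_complex" where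
  "koszul m n = \<lparr>crank = (\<lambda>i. card (ksets m n i)), cdeg = (\<lambda>i l. int i),
     cmat = (\<lambda>i k l. \<Sum>u | u \<notin> ksub m n i k \<and> ksub m n (Suc i) l = insert u (ksub m n i k).
        xconst (ksign m u (ksub m n i k)) * vpoly u),
     caug = (\<lambda>_. 1)\<rparr>"

definition kvec :: "nat \<Rightarrow> nat \<Rightarrow> nat \<Rightarrow> ((nat \<times> nat) set \<Rightarrow> 'k::field xpoly) \<Rightarrow> nat \<Rightarrow> 'k xpoly" where
  "kvec m n i w = (\<lambda>k. if k < card (ksets m n i) then w (ksub m n i k) else 0)"

lemma koszul_sel [simp]:
  "crank (koszul m n) i = card (ksets m n i)" "cdeg (koszul m n) i l = int i" "caug (koszul m n) k = 1"
  by (simp_all add: koszul_def)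

lemma bij_ksub: "bij_betw (ksub m n i) {..<card (ksets m n i)} (ksets m n i)"
proof -
  have "\<exists>h. bij_betw h {..<card (ksets m n i)} (ksets m n i)"
    using ex_bij_betw_nat_finite[OF finite_ksets] by (auto simp: atLeast0LessThan)
  then show ?thesis unfolding ksub_def by (rule someI_ex)
qed

lemma ksub_in: "k < card (ksets m n i) \<Longrightarrow> ksub m n i k \<in> ksets m n i"
  using bij_ksub[of m n i] by (auto simp: bij_betw_def)

lemma ksub_surj: "A \<in> ksets m n i \<Longrightarrow> \<exists>k<card (ksets m n i). ksub m n i k = A"
  using bij_ksub[of m n i] unfolding bij_betw_def by (metis imageE lessThan_iff)

lemma ball_ksets_iff: "(\<forall>A\<in>ksets m n i. P A) \<longleftrightarrow> (\<forall>k<card (ksets m n i). P (ksub m n i k))"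
  using ksub_in ksub_surj by metis

lemma kvec_surj:
  assumes "\<And>k. k \<ge> card (ksets m n i) \<Longrightarrow> v k = 0"
  obtains w where "v = kvec m n i w"
proof
  show "v = kvec m n i (\<lambda>A. v (inv_into {..<card (ksets m n i)} (ksub m n i) A))"
    using assms bij_betw_imp_inj_on[OF bij_ksub[of m n i]]
    by (auto simp: kvec_def fun_eq_iff not_less)
qed

lemma kvec_eq_iff: "kvec m n i w = kvec m n i w' \<longleftrightarrow> (\<forall>A\<in>ksets m n i. w A = w' A)"
  unfolding ball_ksets_iff by (auto simp: kvec_def fun_eq_iff)

lemma kvec_zero_iff: "kvec m n i w = 0 \<longleftrightarrow> (\<forall>A\<in>ksets m n i. w A = 0)"
  unfolding ball_ksets_iff by (auto simp: kvec_def fun_eq_iff)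

lemma kvec_tensor: "kvec m n i w \<in> tensor (koszul m n) i M \<longleftrightarrow> (\<forall>A\<in>ksets m n i. w A \<in> M)"
  unfolding ball_ksets_iff by (auto simp: kvec_def tensor_def)

lemma kvec_tensor_part:
  "kvec m n i w \<in> tensor_part (koszul m n) i M j \<longleftrightarrow>
    (\<forall>A\<in>ksets m n i. w A \<in> M \<and> homogeneous (j - int i) (w A))"
  unfolding tensor_part_def mem_Collect_eq kvec_tensor unfolding ball_ksets_iff
  by (auto simp: kvec_def)

lemma cdiff_kvec: "cdiff (koszul m n) i (kvec m n (Suc i) w) = kvec m n i (kdiff m n w)"
proof
  fix k
  show "cdiff (koszul m n) i (kvec m n (Suc i) w) k = kvec m n i (kdiff m n w) k"
  proof (cases "k < card (ksets m n i)")
    case False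
    then show ?thesis by (simp add: cdiff_def kvec_def)
  next
    case True
    define B where "B = ksub m n i k"
    have B: "B \<in> ksets m n i" unfolding B_def by (rule ksub_in[OF True])
    define g where "g A = (\<Sum>u | u \<notin> B \<and> A = insert u B. xconst (ksign m u B) * vpoly u) * w A" for A
    have "cdiff (koszul m n) i (kvec m n (Suc i) w) k =
        (\<Sum>l<card (ksets m n (Suc i)). g (ksub m n (Suc i) l))"
      using True by (simp add: cdiff_def kvec_def koszul_def g_def B_def)
    also have "\<dots> = (\<Sum>A\<in>ksets m n (Suc i). g A)"
      by (rule sum.reindex_bij_betw[OF bij_ksub])
    also have "\<dots> = (\<Sum>A\<in>(\<lambda>u. insert u B) ` (grid m n - B). g A)"
    proof (rule sum.mono_neutral_right[OF finite_ksets])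
      show "(\<lambda>u. insert u B) ` (grid m n - B) \<subseteq> ksets m n (Suc i)"
        using ksets_insert[OF B] by auto
      show "\<forall>A\<in>ksets m n (Suc i) - (\<lambda>u. insert u B) ` (grid m n - B). g A = 0"
      proof
        fix A assume A: "A \<in> ksets m n (Suc i) - (\<lambda>u. insert u B) ` (grid m n - B)"
        then have "{u. u \<notin> B \<and> A = insert u B} = {}" by (auto simp: ksets_def)
        then show "g A = 0" unfolding g_def by (simp only: sum.empty mult_zero_left)
      qed
    qed
    also have "\<dots> = (\<Sum>u\<in>grid m n - B. g (insert u B))"
      by (subst sum.reindex) (auto simp: inj_on_def)
    also have "\<dots> = kdiff m n w B"
      unfolding kdiff_def
    proof (rule sum.cong[OF refl])
      fix u assume "u \<in> grid m n - B"
      then have "{u'. u' \<notin> B \<and> insert u B = insert u' B} = {u}" by auto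
      then show "g (insert u B) = xconst (ksign m u B) * (vpoly u * w (insert u B))"
        by (simp add: g_def mult.assoc)
    qed
    finally show ?thesis using True by (simp add: kvec_def B_def)
  qed
qed

lemma ksets_0 [simp]: "ksets m n 0 = {{}}"
  unfolding ksets_def using finite_grid[of m n] by (auto dest: finite_subset)

lemma augmentation_kvec: "augmentation (koszul m n) (kvec m n 0 w) = coef (w {}) 0"
proof -
  have "ksub m n 0 0 = {}" using ksub_in[of 0 m n 0] by simp
  then show ?thesis by (simp add: augmentation_def kvec_def)
qed

lemma tensor_koszul_kvec:
  assumes "v \<in> tensor (koszul m n) i M"
  obtains w where "v = kvec m n i w" "\<And>A. A \<in> ksets m n i \<Longrightarrow> w A \<in> M"
proof -
  obtain w where w: "v = kvec m n i w"
    using kvec_surj[of m n i v] assms by (auto simp: tensor_def)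
  then show ?thesis using that assms kvec_tensor[of m n i w M] by blast
qed

theorem koszul_resolution: "resolution_of_field m n (koszul m n :: 'k::field free_complex)"
proof -
  let ?K = "koszul m n :: 'k free_complex" and ?S = "polyring m n :: 'k xpoly set"
  have mat: "cmat ?K i k l \<in> ?S \<and> homogeneous (cdeg ?K (Suc i) l - cdeg ?K i k) (cmat ?K i k l)"
    if k: "k < crank ?K i" and l: "l < crank ?K (Suc i)" for i k l
  proof -
    have A: "ksub m n (Suc i) l \<subseteq> grid m n" using ksub_in[of l m n "Suc i"] l by (simp add: ksets_def)
    have "xconst (ksign m u (ksub m n i k)) * vpoly u \<in> ?S \<and>
        homogeneous 1 (xconst (ksign m u (ksub m n i k)) * vpoly u :: 'k xpoly)"
      if "ksub m n (Suc i) l = insert u (ksub m n i k)" for u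
    proof
      have "u \<in> grid m n" using that A by auto
      then show "xconst (ksign m u (ksub m n i k)) * vpoly u \<in> ?S"
        by (intro polyring_mult polyring_xconst polyring_vpoly) (simp add: grid_def)
      show "homogeneous 1 (xconst (ksign m u (ksub m n i k)) * vpoly u :: 'k xpoly)"
        using homogeneous_mult[OF homogeneous_xconst homogeneous_vpoly] by simp
    qed
    then show ?thesis
      unfolding koszul_def by (auto intro!: is_ideal_sum[OF is_ideal_polyring] homogeneous_sum)
  qed
  have exact: "v \<in> cdiff ?K i ` tensor ?K (Suc i) ?S"
    if v: "v \<in> tensor ?K i ?S" and z: "aug_cycle ?K i v" for i v
  proof -
    obtain w where w: "v = kvec m n i w" "\<And>A. A \<in> ksets m n i \<Longrightarrow> w A \<in> ?S"
      using tensor_koszul_kvec[OF v] by blast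
    have "kdiff m n (khom m w) A = w A" if "A \<in> ksets m n i" for A
    proof (rule koszul_homotopy[OF w(2) _ _ that])
      assume "i = 0"
      then show "coef (w {}) 0 = 0" using z by (simp add: aug_cycle_def w(1) augmentation_kvec)
    next
      fix i' C assume "i = Suc i'" "C \<in> ksets m n i'"
      then show "kdiff m n w C = 0"
        using z by (simp add: aug_cycle_def w(1) cdiff_kvec kvec_zero_iff)
    qed
    then have "cdiff ?K i (kvec m n (Suc i) (khom m w)) = v"
      by (simp add: cdiff_kvec w(1) kvec_eq_iff)
    moreover have "kvec m n (Suc i) (khom m w) \<in> tensor ?K (Suc i) ?S"
      unfolding kvec_tensor by (intro ballI khom_polyring[of m n i w] w(2))
    ultimately show ?thesis by blast
  qed
  have complex: "cdiff ?K i v \<in> tensor ?K i ?S \<and> aug_cycle ?K i (cdiff ?K i v)"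
    if v: "v \<in> tensor ?K (Suc i) ?S" for i v
  proof -
    obtain w where w: "v = kvec m n (Suc i) w" "\<And>A. A \<in> ksets m n (Suc i) \<Longrightarrow> w A \<in> ?S"
      using tensor_koszul_kvec[OF v] by blast
    have "coef (kdiff m n w {}) 0 = 0" by (simp add: coef_kdiff)
    moreover have "kdiff m n (kdiff m n w) A = 0" if "A \<in> ksets m n i'" for A i'
      using that by (intro kdiff_kdiff) (simp add: ksets_def)
    ultimately show ?thesis
      using kdiff_polyring[OF w(2)]
      by (cases i) (auto simp: w(1) cdiff_kvec kvec_tensor aug_cycle_def augmentation_kvec kvec_zero_iff)
  qed
  have onto: "augmentation ?K ` tensor ?K 0 ?S = UNIV"
  proof -
    have "c \<in> augmentation ?K ` tensor ?K 0 ?S" for c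
    proof
      show "c = augmentation ?K (kvec m n 0 (\<lambda>_. xconst c))"
        by (simp add: augmentation_kvec xconst_def)
      show "kvec m n 0 (\<lambda>_. xconst c) \<in> tensor ?K 0 ?S"
        by (simp add: kvec_tensor polyring_xconst)
    qed
    then show ?thesis by blast
  qed
  have "cdiff ?K i ` tensor ?K (Suc i) ?S = {v \<in> tensor ?K i ?S. aug_cycle ?K i v}" for i
    using exact complex by blast
  from this[of 0] this[of "Suc _"] show ?thesis
    unfolding resolution_of_field_def using mat onto by (simp add: aug_cycle_def)
qed

section \<open>Maximal minors and their monomials\<close>

definition colsets :: "nat \<Rightarrow> nat \<Rightarrow> nat set set" where
  "colsets m n = {\<tau>. \<tau> \<subseteq> {1..n} \<and> card \<tau> = m}"

text \<open>
The monomials of the minor on the columns \<open>\<tau>\<close> are those in which the row \<open>g b\<close> is chosen in column \<open>b\<close>, for a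
bijection \<open>g\<close> from \<open>\<tau>\<close> to the rows.
\<close>

definition matching :: "(nat \<Rightarrow> nat) \<Rightarrow> nat set \<Rightarrow> ((nat \<times> nat) \<Rightarrow>\<^sub>0 nat)" where
  "matching g \<tau> = (\<Sum>b\<in>\<tau>. var1 (g b, b))"

lemma expo_matching:
  assumes "finite \<tau>"
  shows "expo (matching g \<tau>) (a, b) = (if b \<in> \<tau> \<and> g b = a then 1 else 0)"
proof -
  have "expo (matching g \<tau>) (a, b) = (\<Sum>c\<in>\<tau>. if c = b then (if g b = a then 1 else 0) else 0)"
    unfolding matching_def lookup_sum by (rule sum.cong) (auto simp: lookup_single when_def)
  then show ?thesis using assms by (simp add: sum.delta)
qed

lemma prod_single_one:
  "finite A \<Longrightarrow> (\<Prod>i\<in>A. Poly_Mapping.single (s i) (1::'k::field)) = (Poly_Mapping.single (\<Sum>i\<in>A. s i) 1 :: 'k xpoly)"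
  by (induction A rule: finite_induct) (auto simp: mult_single)

lemma coef_minor:
  "coef (minor m \<tau> :: 'k::field xpoly) t =
    (\<Sum>p | p permutes {0..<m}. if t = (\<Sum>i\<in>{0..<m}. var1 (i + 1, sorted_list_of_set \<tau> ! p i)) then signof p else 0)"
proof -
  let ?c = "\<lambda>b. sorted_list_of_set \<tau> ! b"
  let ?A = "mat m m (\<lambda>(a, b). xvar (a + 1) (?c b)) :: 'k xpoly mat"
  have "minor m \<tau> = (\<Sum>p | p permutes {0..<m}. signof p * (\<Prod>i = 0..<m. ?A $$ (i, p i)))"
    unfolding minor_def by (rule det_def') simp
  also have "\<dots> = (\<Sum>p | p permutes {0..<m}. Poly_Mapping.single (\<Sum>i\<in>{0..<m}. var1 (i + 1, ?c (p i))) (signof p))"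
  proof (rule sum.cong[OF refl])
    fix p assume p: "p \<in> {p. p permutes {0..<m}}"
    have "(\<Prod>i = 0..<m. ?A $$ (i, p i)) = (\<Prod>i = 0..<m. vpoly (i + 1, ?c (p i)))"
      using p by (intro prod.cong) (auto simp: xvar_eq_vpoly permutes_in_image)
    also have "\<dots> = Poly_Mapping.single (\<Sum>i\<in>{0..<m}. var1 (i + 1, ?c (p i))) 1"
      unfolding vpoly_def by (rule prod_single_one) simp
    finally show "signof p * (\<Prod>i = 0..<m. ?A $$ (i, p i)) =
        Poly_Mapping.single (\<Sum>i\<in>{0..<m}. var1 (i + 1, ?c (p i))) (signof p)"
      by (simp add: sign_def single_uminus)
  qed
  finally have "minor m \<tau> = (\<Sum>p | p permutes {0..<m}. Poly_Mapping.single (\<Sum>i\<in>{0..<m}. var1 (i + 1, ?c (p i))) (signof p :: 'k))" .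
  then show ?thesis
    by (simp only: lookup_sum) (rule sum.cong, auto simp: lookup_single when_def)
qed

lemma columns_bij:
  assumes "finite \<tau>" "card \<tau> = m"
  shows "bij_betw ((!) (sorted_list_of_set \<tau>)) {0..<m} \<tau>"
  using assms by (intro bij_betw_nth) (auto simp: atLeast0LessThan)

lemma minor_support:
  assumes \<tau>: "finite \<tau>" "card \<tau> = m" and t: "coef (minor m \<tau> :: 'k::field xpoly) t \<noteq> 0"
  obtains g where "bij_betw g \<tau> {1..m}" "t = matching g \<tau>"
proof -
  let ?c = "(!) (sorted_list_of_set \<tau>)"
  have "\<exists>p. p permutes {0..<m} \<and> t = (\<Sum>i\<in>{0..<m}. var1 (i + 1, ?c (p i)))"
  proof (rule ccontr)
    assume neg: "\<not> ?thesis"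
    then have "coef (minor m \<tau> :: 'k xpoly) t = 0"
      unfolding coef_minor by (intro sum.neutral ballI if_not_P) blast
    with t show False by contradiction
  qed
  then obtain p where p: "p permutes {0..<m}" "t = (\<Sum>i\<in>{0..<m}. var1 (i + 1, ?c (p i)))" by blast
  define h where "h = ?c \<circ> p"
  have h: "bij_betw h {0..<m} \<tau>"
    unfolding h_def by (rule bij_betw_trans[OF permutes_imp_bij[OF p(1)] columns_bij[OF \<tau>]])
  define g where "g = Suc \<circ> inv_into {0..<m} h"
  have "bij_betw Suc {0..<m} {1..m}"
    by (simp add: bij_betw_def atLeastLessThanSuc_atLeastAtMost image_Suc_atLeastLessThan)
  then have g: "bij_betw g \<tau> {1..m}"
    unfolding g_def by (rule bij_betw_trans[OF bij_betw_inv_into[OF h]])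
  have "matching g \<tau> = (\<Sum>i\<in>{0..<m}. var1 (g (h i), h i))"
    unfolding matching_def by (rule sum.reindex_bij_betw[OF h, symmetric])
  also have "\<dots> = t"
  proof -
    have "g (h i) = i + 1" if "i \<in> {0..<m}" for i
      using inv_into_f_f[OF bij_betw_imp_inj_on[OF h] that] by (simp add: g_def)
    then show ?thesis unfolding p(2) by (intro sum.cong refl) (simp add: h_def)
  qed
  finally show ?thesis using that g by simp
qed

text \<open>
Distinct permutations contribute distinct monomials to the determinant, so that no cancellation occurs and the
coefficient is a sign.
\<close>

lemma minor_coef_matching:
  assumes \<tau>: "finite \<tau>" "card \<tau> = m" and g: "bij_betw g \<tau> {1..m}"
  shows "coef (minor m \<tau> :: 'k::field xpoly) (matching g \<tau>) \<noteq> 0"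
proof -
  let ?c = "(!) (sorted_list_of_set \<tau>)"
  note c = columns_bij[OF \<tau>]
  define q where "q = inv_into {0..<m} ?c \<circ> (inv_into \<tau> g \<circ> Suc)"
  have "bij_betw Suc {0..<m} {1..m}"
    by (simp add: bij_betw_def atLeastLessThanSuc_atLeastAtMost image_Suc_atLeastLessThan)
  then have h: "bij_betw (inv_into \<tau> g \<circ> Suc) {0..<m} \<tau>"
    by (rule bij_betw_trans[OF _ bij_betw_inv_into[OF g]])
  then have q: "bij_betw q {0..<m} {0..<m}"
    unfolding q_def by (rule bij_betw_trans[OF _ bij_betw_inv_into[OF c]])
  define p where "p i = (if i \<in> {0..<m} then q i else i)" for i
  have p: "p permutes {0..<m}"
  proof (rule bij_imp_permutes)
    have "bij_betw p {0..<m} {0..<m} \<longleftrightarrow> bij_betw q {0..<m} {0..<m}"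
      by (rule bij_betw_cong) (simp add: p_def)
    with q show "bij_betw p {0..<m} {0..<m}" by simp
  qed (auto simp: p_def)
  have cp: "?c (p i) = inv_into \<tau> g (Suc i)" if "i < m" for i
  proof -
    have "(inv_into \<tau> g \<circ> Suc) i \<in> \<tau>" using h that by (auto simp: bij_betw_def)
    then show ?thesis using that bij_betw_inv_into_right[OF c] by (simp add: p_def q_def)
  qed
  have "matching g \<tau> = (\<Sum>i\<in>{0..<m}. var1 (g ((inv_into \<tau> g \<circ> Suc) i), (inv_into \<tau> g \<circ> Suc) i))"
    unfolding matching_def by (rule sum.reindex_bij_betw[OF h, symmetric])
  also have "\<dots> = (\<Sum>i\<in>{0..<m}. var1 (i + 1, ?c (p i)))"
    using bij_betw_inv_into_right[OF g] by (intro sum.cong) (auto simp: cp)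
  finally have t: "matching g \<tau> = (\<Sum>i\<in>{0..<m}. var1 (i + 1, ?c (p i)))" .
  have uniq: "p' = p" if p': "p' permutes {0..<m}" and eq: "matching g \<tau> = (\<Sum>i\<in>{0..<m}. var1 (i + 1, ?c (p' i)))" for p'
  proof
    fix i
    show "p' i = p i"
    proof (cases "i < m")
      case True
      have in_t: "?c (p' i) \<in> \<tau>" "?c (p i) \<in> \<tau>"
        using True c p p' permutes_in_image[of _ "{0..<m}" i] by (auto simp: bij_betw_def)
      have "0 < expo (var1 (i + 1, ?c (p' i))) (i + 1, ?c (p' i))" by simp
      also have "\<dots> \<le> (\<Sum>k\<in>{0..<m}. expo (var1 (k + 1, ?c (p' k))) (i + 1, ?c (p' i)))"
        using True by (intro member_le_sum[of i "{0..<m}" "\<lambda>k. expo (var1 (k + 1, ?c (p' k))) (i + 1, ?c (p' i))"]) auto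
      also have "\<dots> = expo (matching g \<tau>) (i + 1, ?c (p' i))" by (simp add: eq lookup_sum)
      finally have "g (?c (p' i)) = i + 1"
        unfolding expo_matching[OF \<tau>(1)] by (auto split: if_splits)
      moreover have "g (?c (p i)) = i + 1"
        using True bij_betw_inv_into_right[OF g] by (simp add: cp)
      ultimately have "?c (p' i) = ?c (p i)"
        using in_t g by (auto simp: bij_betw_def inj_on_def)
      then show ?thesis
        using c True p p' permutes_in_image[of _ "{0..<m}" i] by (auto simp: bij_betw_def inj_on_def)
    next
      case False
      then show ?thesis using p p' by (simp add: permutes_def)
    qed
  qed
  have fin: "finite {p. p permutes {0..<m}}" by (rule finite_permutations) simp
  have "coef (minor m \<tau> :: 'k xpoly) (matching g \<tau>) =
      (\<Sum>p' | p' permutes {0..<m}. if p' = p then signof p' else 0)"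
    unfolding coef_minor by (intro sum.cong refl if_cong) (use uniq t in auto)
  also have "\<dots> = signof p" using fin p by (simp add: sum.delta)
  finally show ?thesis by (simp add: sign_def)
qed

lemma colsets_finite: "\<tau> \<in> colsets m n \<Longrightarrow> finite \<tau>"
  unfolding colsets_def using finite_subset by blast

lemma colsetsD: "\<tau> \<in> colsets m n \<Longrightarrow> finite \<tau> \<and> card \<tau> = m \<and> \<tau> \<subseteq> {1..n}"
  using colsets_finite[of \<tau> m n] by (simp add: colsets_def)

lemma finite_colsets: "finite (colsets m n)"
  unfolding colsets_def by (rule finite_subset[of _ "Pow {1..n}"]) auto

lemma colset_bij_exists:
  assumes "\<tau> \<in> colsets m n"
  obtains g where "bij_betw g \<tau> {1..m}"
  using finite_same_card_bij[OF colsets_finite[OF assms], of "{1..m}"] assms by (auto simp: colsets_def)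

lemma vars_matching: "finite \<tau> \<Longrightarrow> vars (matching g \<tau>) = (\<lambda>b. (g b, b)) ` \<tau>"
  by (auto simp: in_keys_iff expo_matching split: if_splits)

lemma minor_polyring:
  assumes "\<tau> \<in> colsets m n"
  shows "minor m \<tau> \<in> polyring m n"
  unfolding polyring_iff
proof (intro allI impI)
  fix t assume "coef (minor m \<tau> :: 'a xpoly) t \<noteq> 0"
  moreover have f: "finite \<tau>" "card \<tau> = m" using colsetsD[OF assms] by blast+
  ultimately obtain g where "bij_betw g \<tau> {1..m}" "t = matching g \<tau>" using minor_support by metis
  moreover have "\<tau> \<subseteq> {1..n}" using assms by (simp add: colsets_def)
  ultimately show "vars t \<subseteq> {1..m} \<times> {1..n}"
    using f by (auto simp: vars_matching bij_betw_def)
qed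

lemma mon_degree_matching: "finite \<tau> \<Longrightarrow> mon_degree (matching g \<tau>) = card \<tau>"
  unfolding matching_def by (induction \<tau> rule: finite_induct) (auto simp: mon_degree_add)

lemma minor_homogeneous:
  assumes "\<tau> \<in> colsets m n"
  shows "homogeneous (int m) (minor m \<tau>)"
  unfolding homogeneous_iff
proof (intro allI impI)
  fix t assume "coef (minor m \<tau> :: 'a xpoly) t \<noteq> 0"
  moreover have f: "finite \<tau>" "card \<tau> = m" using colsetsD[OF assms] by blast+
  ultimately obtain g where "t = matching g \<tau>" using minor_support by metis
  then show "int (mon_degree t) = int m" using f by (simp add: mon_degree_matching)
qed

section \<open>Multidegrees\<close>

text \<open>
The polynomial ring is graded by columns and by rows. A maximal minor has degree \<open>1\<close> in each row and in each of
its columns, so the two degrees separate the terms of a relation among minors.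
\<close>

definition coldeg :: "nat \<Rightarrow> ((nat \<times> nat) \<Rightarrow>\<^sub>0 nat) \<Rightarrow> nat \<Rightarrow> nat" where
  "coldeg m t b = (\<Sum>a\<in>{1..m}. expo t (a, b))"

definition rowdeg :: "nat \<Rightarrow> ((nat \<times> nat) \<Rightarrow>\<^sub>0 nat) \<Rightarrow> nat \<Rightarrow> nat" where
  "rowdeg n t a = (\<Sum>b\<in>{1..n}. expo t (a, b))"

lemma coldeg_add: "coldeg m (s + t) b = coldeg m s b + coldeg m t b"
  by (simp add: coldeg_def lookup_add sum.distrib)

lemma rowdeg_add: "rowdeg n (s + t) b = rowdeg n s b + rowdeg n t b"
  by (simp add: rowdeg_def lookup_add sum.distrib)

lemma coldeg_var1: "r \<in> {1..m} \<Longrightarrow> coldeg m (var1 (r, j)) b = (if b = j then 1 else 0)"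
proof -
  assume r: "r \<in> {1..m}"
  have "coldeg m (var1 (r, j)) b = (\<Sum>a\<in>{1..m}. if a = r then (if b = j then 1 else 0) else 0)"
    unfolding coldeg_def by (rule sum.cong) (auto simp: lookup_single when_def)
  then show ?thesis using r by (simp add: sum.delta)
qed

lemma rowdeg_var1: "j \<in> {1..n} \<Longrightarrow> rowdeg n (var1 (r, j)) a = (if a = r then 1 else 0)"
proof -
  assume j: "j \<in> {1..n}"
  have "rowdeg n (var1 (r, j)) a = (\<Sum>b\<in>{1..n}. if b = j then (if a = r then 1 else 0) else 0)"
    unfolding rowdeg_def by (rule sum.cong) (auto simp: lookup_single when_def)
  then show ?thesis using j by (simp add: sum.delta)
qed

lemma coldeg_matching:
  assumes "\<tau> \<in> colsets m n" and g: "bij_betw g \<tau> {1..m}"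
  shows "coldeg m (matching g \<tau>) b = (if b \<in> \<tau> then 1 else 0)"
proof -
  have "coldeg m (matching g \<tau>) b = (\<Sum>a\<in>{1..m}. if a = g b then (if b \<in> \<tau> then 1 else 0) else 0)"
    unfolding coldeg_def using colsets_finite[OF assms(1)]
    by (intro sum.cong) (auto simp: expo_matching)
  also have "\<dots> = (if b \<in> \<tau> then 1 else 0)"
    using g by (auto simp: sum.delta bij_betw_def)
  finally show ?thesis .
qed

lemma rowdeg_matching:
  assumes \<tau>: "\<tau> \<in> colsets m n" and g: "bij_betw g \<tau> {1..m}" and a: "a \<in> {1..m}"
  shows "rowdeg n (matching g \<tau>) a = 1"
proof -
  let ?b = "inv_into \<tau> g a"
  have b: "?b \<in> \<tau>" "g ?b = a" using bij_betwE[OF bij_betw_inv_into[OF g]] bij_betw_inv_into_right[OF g] a by auto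
  have "rowdeg n (matching g \<tau>) a = (\<Sum>b\<in>{1..n}. if b = ?b then 1 else 0)"
    unfolding rowdeg_def expo_matching[OF colsets_finite[OF \<tau>]]
    using b g by (intro sum.cong) (auto simp: bij_betw_def inj_on_def)
  also have "\<dots> = 1" using b \<tau> by (auto simp: colsets_def)
  finally show ?thesis .
qed

section \<open>The determinantal linear syzygies\<close>

text \<open>
The sign of the column \<open>j\<close> in a Laplace expansion along a top row over the columns \<open>\<sigma>\<close>.
\<close>

definition colsign :: "nat \<Rightarrow> nat set \<Rightarrow> 'a::comm_ring_1" where
  "colsign j \<sigma> = (- 1) ^ card {x \<in> \<sigma>. x < j}"

lemma remove1_nth:
  assumes "distinct xs" "b < length xs"
  shows "remove1 (xs ! b) xs = take b xs @ drop (Suc b) xs"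
proof -
  have xs: "xs = take b xs @ xs ! b # drop (Suc b) xs" by (rule id_take_nth_drop[OF assms(2)])
  then have "xs ! b \<notin> set (take b xs)" using assms(1)
    by (metis distinct_append disjoint_iff list.set_intros(1))
  then show ?thesis using xs by (metis remove1.simps(2) remove1_append)
qed

lemma sorted_list_remove_nth:
  assumes "finite \<sigma>" "b < card \<sigma>" "c < card \<sigma> - 1"
  shows "sorted_list_of_set (\<sigma> - {sorted_list_of_set \<sigma> ! b}) ! c =
    sorted_list_of_set \<sigma> ! (if c < b then c else Suc c)"
proof -
  let ?xs = "sorted_list_of_set \<sigma>"
  have len: "length ?xs = card \<sigma>" using assms by simp
  have "sorted_list_of_set (\<sigma> - {?xs ! b}) = take b ?xs @ drop (Suc b) ?xs"
    using assms len by (subst sorted_list_of_set_remove) (auto intro!: remove1_nth)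
  then show ?thesis using assms len by (auto simp: nth_append)
qed

lemma card_less_sorted_nth:
  assumes "finite \<sigma>" "b < card \<sigma>"
  shows "card {x \<in> \<sigma>. x < sorted_list_of_set \<sigma> ! b} = b"
proof -
  let ?xs = "sorted_list_of_set \<sigma>"
  have len: "length ?xs = card \<sigma>" and set: "set ?xs = \<sigma>" using assms by simp_all
  have lt: "?xs ! i < ?xs ! k \<longleftrightarrow> i < k" if "i < card \<sigma>" "k < card \<sigma>" for i k
    using sorted_wrt_nth_less[OF strict_sorted_list_of_set[of \<sigma>]] that len
    by (metis linorder_neqE_nat not_less_iff_gr_or_eq)
  have "{x \<in> \<sigma>. x < ?xs ! b} = (!) ?xs ` {..<b}"
  proof (intro equalityI subsetI)
    fix x assume x: "x \<in> {x \<in> \<sigma>. x < ?xs ! b}"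
    then obtain i where "i < card \<sigma>" "x = ?xs ! i" using set len by (metis (no_types, lifting) in_set_conv_nth mem_Collect_eq)
    then show "x \<in> (!) ?xs ` {..<b}" using x lt assms by auto
  next
    fix x assume "x \<in> (!) ?xs ` {..<b}"
    then show "x \<in> {x \<in> \<sigma>. x < ?xs ! b}" using lt assms set len nth_mem[of _ ?xs] by fastforce
  qed
  moreover have "inj_on ((!) ?xs) {..<b}"
    using assms len by (auto simp: inj_on_def nth_eq_iff_index_eq)
  ultimately show ?thesis by (simp add: card_image)
qed

text \<open>
Expansion, along the first row, of the minor on \<open>m + 1\<close> columns whose first row repeats the row \<open>r\<close>.
\<close>

lemma laplace_relation:
  assumes \<sigma>: "finite \<sigma>" "card \<sigma> = Suc m" and r: "r \<in> {1..m}"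
  shows "(\<Sum>j\<in>\<sigma>. xconst (colsign j \<sigma>) * (vpoly (r, j) * minor m (\<sigma> - {j}))) = (0 :: 'k::field xpoly)"
proof -
  let ?c = "(!) (sorted_list_of_set \<sigma>)"
  define M :: "'k xpoly mat" where
    "M = mat (Suc m) (Suc m) (\<lambda>(a, b). xvar (if a = 0 then r else a) (?c b))"
  have M: "M \<in> carrier_mat (Suc m) (Suc m)" by (simp add: M_def)
  have "row M 0 = row M r" using r by (intro eq_vecI) (auto simp: M_def)
  then have "det M = 0" using r by (intro det_identical_rows[OF M, of 0 r]) auto
  moreover have "det M = (\<Sum>b<Suc m. M $$ (0, b) * cofactor M 0 b)"
    by (rule laplace_expansion_row[OF M]) simp
  moreover have "M $$ (0, b) * cofactor M 0 b =
      xconst (colsign (?c b) \<sigma>) * (vpoly (r, ?c b) * minor m (\<sigma> - {?c b}))" if b: "b < Suc m" for b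
  proof -
    have "mat_delete M 0 b = mat m m (\<lambda>(a, c). xvar (a + 1) (sorted_list_of_set (\<sigma> - {?c b}) ! c))"
      using b \<sigma> by (intro eq_matI) (auto simp: mat_delete_def M_def sorted_list_remove_nth)
    then have "cofactor M 0 b = (- 1) ^ b * minor m (\<sigma> - {?c b})"
      by (simp add: cofactor_def minor_def)
    moreover have "(- 1) ^ b = (xconst (colsign (?c b) \<sigma>) :: 'k xpoly)"
      using b \<sigma> by (simp add: colsign_def card_less_sorted_nth xconst_def)
        (metis (no_types, lifting) neg_one_even_power neg_one_odd_power single_one single_uminus)
    moreover have "M $$ (0, b) = vpoly (r, ?c b)" using b by (simp add: M_def xvar_eq_vpoly)
    ultimately show ?thesis by (simp add: mult_ac)
  qed
  ultimately have "(\<Sum>b<Suc m. xconst (colsign (?c b) \<sigma>) * (vpoly (r, ?c b) * minor m (\<sigma> - {?c b}))) = (0 :: 'k xpoly)"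
    by simp
  moreover have "bij_betw ?c {..<Suc m} \<sigma>"
    using columns_bij[OF \<sigma>] by (simp add: atLeast0LessThan)
  ultimately show ?thesis
    by (simp only: sum.reindex_bij_betw[where g = "\<lambda>j. xconst (colsign j \<sigma>) * (vpoly (r, j) * minor m (\<sigma> - {j}))"])
qed

section \<open>All linear syzygies\<close>

definition linear_syzygy :: "nat \<Rightarrow> nat \<Rightarrow> (nat \<times> nat \<Rightarrow> nat set \<Rightarrow> 'k::field) \<Rightarrow> bool" where
  "linear_syzygy m n f \<longleftrightarrow> (\<Sum>(u, \<tau>)\<in>grid m n \<times> colsets m n. xconst (f u \<tau>) * (vpoly u * minor m \<tau>)) = 0"

lemma linear_syzygy_laplace:
  assumes \<sigma>: "\<sigma> \<in> colsets (Suc m) n" and r: "r \<in> {1..m}"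
  shows "linear_syzygy m n (\<lambda>(a, k) \<tau>. if a = r \<and> k \<in> \<sigma> \<and> \<tau> = \<sigma> - {k} then colsign k \<sigma> else (0 :: 'k::field))"
proof -
  have fin: "finite \<sigma>" and card: "card \<sigma> = Suc m" and sub: "\<sigma> \<subseteq> {1..n}"
    using colsetsD[OF \<sigma>] by blast+
  define f where "f = (\<lambda>(a, k) \<tau>. if a = r \<and> k \<in> \<sigma> \<and> \<tau> = \<sigma> - {k} then colsign k \<sigma> else (0 :: 'k))"
  let ?h = "\<lambda>k. ((r, k), \<sigma> - {k})"
  have "(\<Sum>(u, \<tau>)\<in>grid m n \<times> colsets m n. xconst (f u \<tau>) * (vpoly u * minor m \<tau>)) =
      (\<Sum>(u, \<tau>)\<in>?h ` \<sigma>. xconst (f u \<tau>) * (vpoly u * minor m \<tau>))"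
  proof (rule sum.mono_neutral_right)
    show "?h ` \<sigma> \<subseteq> grid m n \<times> colsets m n"
      using fin card sub r by (auto simp: grid_def colsets_def)
    show "\<forall>x\<in>grid m n \<times> colsets m n - ?h ` \<sigma>. (case x of (u, \<tau>) \<Rightarrow> xconst (f u \<tau>) * (vpoly u * minor m \<tau>)) = 0"
      by (auto simp: f_def xconst_def)
  qed (simp add: finite_grid finite_colsets)
  also have "\<dots> = (\<Sum>k\<in>\<sigma>. xconst (colsign k \<sigma>) * (vpoly (r, k) * minor m (\<sigma> - {k})))"
    by (subst sum.reindex) (auto simp: inj_on_def f_def intro!: sum.cong)
  finally show ?thesis
    unfolding linear_syzygy_def f_def[symmetric] using laplace_relation[OF fin card r] by simp
qed

text \<open>
The coefficient of a monomial \<open>t\<close> in a linear relation. It suffices to know a set \<open>P\<close> that contains all pairs of a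
variable and a minor whose product contains \<open>t\<close>.
\<close>

lemma linear_syzygy_coef:
  assumes f: "linear_syzygy m n f" and P: "P \<subseteq> grid m n \<times> colsets m n"
    and only: "\<And>u \<tau> g. u \<in> grid m n \<Longrightarrow> \<tau> \<in> colsets m n \<Longrightarrow> bij_betw g \<tau> {1..m} \<Longrightarrow>
       t = matching g \<tau> + var1 u \<Longrightarrow> (u, \<tau>) \<in> P"
    and div: "\<And>u \<tau>. (u, \<tau>) \<in> P \<Longrightarrow> u \<in> vars t"
  shows "(\<Sum>(u, \<tau>)\<in>P. f u \<tau> * coef (minor m \<tau>) (t - var1 u)) = 0"
proof -
  define F where "F = (\<lambda>(u, \<tau>). if u \<in> vars t then f u \<tau> * coef (minor m \<tau>) (t - var1 u) else 0)"
  have "0 = coef (\<Sum>(u, \<tau>)\<in>grid m n \<times> colsets m n. xconst (f u \<tau>) * (vpoly u * minor m \<tau>)) t"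
    using f by (simp add: linear_syzygy_def)
  also have "\<dots> = (\<Sum>x\<in>grid m n \<times> colsets m n. F x)"
    unfolding lookup_sum by (rule sum.cong) (auto simp: coef_xconst_mult coef_vpoly_mult F_def)
  also have "\<dots> = (\<Sum>x\<in>P. F x)"
  proof (rule sum.mono_neutral_right[OF _ P])
    show "\<forall>x\<in>grid m n \<times> colsets m n - P. F x = 0"
    proof (intro ballI)
      fix x assume x: "x \<in> grid m n \<times> colsets m n - P"
      obtain u \<tau> where [simp]: "x = (u, \<tau>)" by (cases x)
      have u: "u \<in> grid m n" and \<tau>: "\<tau> \<in> colsets m n" and nP: "(u, \<tau>) \<notin> P" using x by auto
      show "F x = 0"
      proof (rule ccontr)
        assume "F x \<noteq> 0"
        then have ut: "u \<in> vars t" and c: "coef (minor m \<tau> :: 'a xpoly) (t - var1 u) \<noteq> 0"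
          by (auto simp: F_def split: if_splits)
        have "card \<tau> = m" using \<tau> by (simp add: colsets_def)
        then obtain g where g: "bij_betw g \<tau> {1..m}" "t - var1 u = matching g \<tau>"
          using minor_support[OF colsets_finite[OF \<tau>] _ c] by metis
        have "t = matching g \<tau> + var1 u"
          using var1_add_diff[OF ut] by (simp add: g(2) add.commute)
        then show False using only[OF u \<tau> g(1)] nP by blast
      qed
    qed
  qed (simp add: finite_grid finite_colsets)
  also have "\<dots> = (\<Sum>(u, \<tau>)\<in>P. f u \<tau> * coef (minor m \<tau>) (t - var1 u))"
    by (rule sum.cong) (use div in \<open>auto simp: F_def\<close>)
  finally show ?thesis by simp
qed

text \<open>
In \<open>x\<^sub>r\<^sub>j m\<^sub>\<tau>\<close> with \<open>j \<in> \<tau>\<close> the column \<open>j\<close> has degree \<open>2\<close>. This determines \<open>j\<close> and \<open>\<tau>\<close>, and the row degree determines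
\<open>r\<close>; so no other summand has a monomial in common with this one.
\<close>

lemma linear_syzygy_column_disjoint:
  assumes f: "linear_syzygy m n f" and r: "r \<in> {1..m}" and \<tau>: "\<tau> \<in> colsets m n" and j: "j \<in> \<tau>"
  shows "f (r, j) \<tau> = 0"
proof -
  obtain g where g: "bij_betw g \<tau> {1..m}" by (rule colset_bij_exists[OF \<tau>])
  define t where "t = matching g \<tau> + var1 (r, j)"
  have jn: "j \<in> {1..n}" using \<tau> j by (auto simp: colsets_def)
  have "(\<Sum>(u, \<tau>)\<in>{((r, j), \<tau>)}. f u \<tau> * coef (minor m \<tau>) (t - var1 u)) = 0"
  proof (rule linear_syzygy_coef[OF f])
    show "{((r, j), \<tau>)} \<subseteq> grid m n \<times> colsets m n" using r jn \<tau> by (simp add: grid_def)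
  next
    fix u \<tau>' g' assume u: "u \<in> grid m n" and \<tau>': "\<tau>' \<in> colsets m n"
      and g': "bij_betw g' \<tau>' {1..m}" and t': "t = matching g' \<tau>' + var1 u"
    obtain r' j' where u': "u = (r', j')" by (cases u)
    have r': "r' \<in> {1..m}" and j': "j' \<in> {1..n}" using u by (auto simp: u' grid_def)
    have cd: "(if b \<in> \<tau> then 1 else 0) + (if b = j then 1 else 0) =
        (if b \<in> \<tau>' then 1 else 0) + (if b = j' then 1 else 0 :: nat)" for b
      using arg_cong[OF t', of "\<lambda>t. coldeg m t b"]
      by (simp add: t_def u' coldeg_add coldeg_var1[OF r] coldeg_var1[OF r'] coldeg_matching[OF \<tau> g] coldeg_matching[OF \<tau>' g'])
    have "j' = j" using cd[of j] j by (auto split: if_splits)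
    then have "b \<in> \<tau> \<longleftrightarrow> b \<in> \<tau>'" for b using cd[of b] by (auto split: if_splits)
    then have "\<tau>' = \<tau>" by blast
    moreover have "rowdeg n t r = rowdeg n (matching g' \<tau>' + var1 u) r" by (simp add: t')
    then have "r = r'"
      by (simp add: t_def u' rowdeg_add rowdeg_var1[OF jn] rowdeg_var1[OF j'] rowdeg_matching[OF \<tau> g r] rowdeg_matching[OF \<tau>' g' r] split: if_splits)
    ultimately show "(u, \<tau>') \<in> {((r, j), \<tau>)}" using \<open>j' = j\<close> by (simp add: u')
  next
    fix u \<tau>' assume "(u, \<tau>') \<in> {((r, j), \<tau>)}"
    then show "u \<in> vars t" by (auto simp: t_def vars_add)
  qed
  then have "f (r, j) \<tau> * coef (minor m \<tau>) (matching g \<tau>) = 0" by (simp add: t_def)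
  moreover have "card \<tau> = m" using \<tau> by (simp add: colsets_def)
  ultimately show ?thesis
    using minor_coef_matching[OF colsets_finite[OF \<tau>] _ g, where 'k='a] by simp
qed

lemma colsign_square: "colsign j \<sigma> * colsign j \<sigma> = (1 :: 'a::comm_ring_1)"
  unfolding colsign_def by (metis (no_types) left_minus_one_mult_self mult.right_neutral)

text \<open>
A monomial in which the row \<open>r\<close> occurs exactly in the columns \<open>j\<close> and \<open>j'\<close> of \<open>\<sigma>\<close> is contained in
two products only, \<open>x\<^sub>r\<^sub>j m\<^bsub>\<sigma>-j\<^esub>\<close> and \<open>x\<^sub>r\<^sub>j\<^sub>' m\<^bsub>\<sigma>-j'\<^esub>\<close>. Hence its coefficient fixes the ratio of the two scalars in every
linear relation. The Laplace relation is one of them and shows what the ratio is, without a computation of signs of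
permutations.
\<close>

lemma linear_syzygy_exchange:
  fixes f :: "nat \<times> nat \<Rightarrow> nat set \<Rightarrow> 'k::field"
  assumes f: "linear_syzygy m n f" and r: "r \<in> {1..m}" and \<sigma>: "\<sigma> \<in> colsets (Suc m) n"
    and j: "j \<in> \<sigma>" and j': "j' \<in> \<sigma>"
  shows "colsign j \<sigma> * f (r, j) (\<sigma> - {j}) = colsign j' \<sigma> * f (r, j') (\<sigma> - {j'})"
proof (cases "j = j'")
  case False
  have fin: "finite \<sigma>" and card: "card \<sigma> = Suc m" and sub: "\<sigma> \<subseteq> {1..n}"
    using colsetsD[OF \<sigma>] by blast+
  have sj: "\<sigma> - {k} \<in> colsets m n" if "k \<in> \<sigma>" for k
    using that fin card sub by (auto simp: colsets_def)
  have jn: "j \<in> {1..n}" using j sub by auto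
  \<comment> \<open>a bijection \<open>g\<close> from \<open>\<sigma> - {j}\<close> to the rows with \<open>g j' = r\<close>; the monomial \<open>t\<close> then contains both
    \<open>x\<^sub>r\<^sub>j\<close> and \<open>x\<^sub>r\<^sub>j\<^sub>'\<close>\<close>
  obtain g0 where g0: "bij_betw g0 (\<sigma> - {j, j'}) ({1..m} - {r})"
  proof -
    have "card (\<sigma> - {j, j'}) = card ({1..m} - {r})"
      using j j' False r card by (subst card_Diff_subset) (auto simp: card_Diff_subset)
    then show ?thesis using finite_same_card_bij[of "\<sigma> - {j, j'}" "{1..m} - {r}"] fin that by auto
  qed
  define g where "g = g0(j' := r)"
  have "bij_betw g0 (\<sigma> - {j, j'}) ({1..m} - {r}) \<longleftrightarrow> bij_betw g (\<sigma> - {j, j'}) ({1..m} - {r})"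
    by (rule bij_betw_cong) (auto simp: g_def)
  with g0 have "bij_betw g (\<sigma> - {j, j'}) ({1..m} - {r})" by simp
  then have "bij_betw g ((\<sigma> - {j, j'}) \<union> {j'}) (({1..m} - {r}) \<union> {r})"
    by (rule bij_betw_combine) (auto simp: g_def)
  moreover have "(\<sigma> - {j, j'}) \<union> {j'} = \<sigma> - {j}" "({1..m} - {r}) \<union> {r} = {1..m}" using False j' r by auto
  ultimately have g: "bij_betw g (\<sigma> - {j}) {1..m}" by simp
  have gj': "g j' = r" by (simp add: g_def)
  define t where "t = matching g (\<sigma> - {j}) + var1 (r, j)"
  define \<kappa> where "\<kappa> k = coef (minor m (\<sigma> - {k}) :: 'k xpoly) (t - var1 (r, k))" for k
  have main: "h (r, j) (\<sigma> - {j}) * \<kappa> j + h (r, j') (\<sigma> - {j'}) * \<kappa> j' = 0"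
    if h: "linear_syzygy m n h" for h :: "nat \<times> nat \<Rightarrow> nat set \<Rightarrow> 'k"
  proof -
    let ?P = "{((r, j), \<sigma> - {j}), ((r, j'), \<sigma> - {j'})}"
    have "(\<Sum>(u, \<tau>)\<in>?P. h u \<tau> * coef (minor m \<tau>) (t - var1 u)) = 0"
    proof (rule linear_syzygy_coef[OF h])
      show "?P \<subseteq> grid m n \<times> colsets m n" using sj j j' r sub by (auto simp: grid_def)
    next
      fix u \<tau>' g' assume u: "u \<in> grid m n" and \<tau>': "\<tau>' \<in> colsets m n"
        and g': "bij_betw g' \<tau>' {1..m}" and t': "t = matching g' \<tau>' + var1 u"
      obtain r' k where u': "u = (r', k)" by (cases u)
      have r': "r' \<in> {1..m}" and k: "k \<in> {1..n}" using u by (auto simp: u' grid_def)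
      have cd: "(if b \<in> \<sigma> - {j} then 1 else 0) + (if b = j then 1 else 0) =
          (if b \<in> \<tau>' then 1 else 0) + (if b = k then 1 else 0 :: nat)" for b
        using arg_cong[OF t', of "\<lambda>t. coldeg m t b"]
        by (simp add: t_def u' coldeg_add coldeg_var1[OF r] coldeg_var1[OF r'] coldeg_matching[OF sj[OF j] g] coldeg_matching[OF \<tau>' g'])
      have b: "b \<in> \<sigma> \<longleftrightarrow> b \<in> \<tau>' \<or> b = k" "\<not> (b \<in> \<tau>' \<and> b = k)" for b
        using cd[of b] j by (auto split: if_splits)
      then have \<tau>'': "\<tau>' = \<sigma> - {k}" by blast
      have "rowdeg n t r = rowdeg n (matching g' \<tau>' + var1 u) r" by (simp add: t')
      then have rr: "r = r'"
        by (simp add: t_def u' rowdeg_add rowdeg_var1[OF jn] rowdeg_var1[OF k] rowdeg_matching[OF sj[OF j] g r] rowdeg_matching[OF \<tau>' g' r] split: if_splits)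
      have "expo t (r, k) > 0" by (simp add: t' u' rr lookup_add)
      then have "k = j \<or> (k \<in> \<sigma> - {j} \<and> g k = r)"
        using fin by (auto simp: t_def lookup_add expo_matching lookup_single when_def split: if_splits)
      moreover have "k = j'" if "k \<in> \<sigma> - {j}" "g k = r"
        using g that gj' j' False by (auto simp: bij_betw_def inj_on_def)
      ultimately show "(u, \<tau>') \<in> ?P" using u' \<tau>'' rr by auto
    next
      fix u \<tau>' assume "(u, \<tau>') \<in> ?P"
      moreover have "(r, j') \<in> vars (matching g (\<sigma> - {j}))"
        using fin gj' j' False by (auto simp: vars_matching)
      ultimately show "u \<in> vars t" by (auto simp: t_def vars_add)
    qed
    then show ?thesis using False by (simp add: \<kappa>_def)
  qed
  have "card (\<sigma> - {j}) = m" using sj[OF j] by (simp add: colsets_def)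
  then have "\<kappa> j \<noteq> 0"
    using minor_coef_matching[OF _ _ g, where 'k='k] fin by (simp add: \<kappa>_def t_def)
  moreover have e: "colsign j \<sigma> * \<kappa> j + colsign j' \<sigma> * \<kappa> j' = 0"
    using main[OF linear_syzygy_laplace[OF \<sigma> r]] j j' by simp
  moreover have h: "f (r, j) (\<sigma> - {j}) * \<kappa> j + f (r, j') (\<sigma> - {j'}) * \<kappa> j' = 0" by (rule main[OF f])
  moreover have s: "colsign j' \<sigma> * colsign j' \<sigma> = (1 :: 'k)" "colsign j \<sigma> * colsign j \<sigma> = (1 :: 'k)"
    by (rule colsign_square)+
  ultimately show ?thesis
  proof -
    have "\<kappa> j' = - (colsign j' \<sigma> * (colsign j \<sigma> * \<kappa> j))"
    proof -
      have "colsign j' \<sigma> * (colsign j \<sigma> * \<kappa> j) + (colsign j' \<sigma> * colsign j' \<sigma>) * \<kappa> j' = 0"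
        using arg_cong[OF e, of "\<lambda>x. colsign j' \<sigma> * x"] by (simp add: distrib_left mult.assoc)
      then show ?thesis by (simp add: s(1) eq_neg_iff_add_eq_0 add.commute)
    qed
    then have "\<kappa> j * (f (r, j) (\<sigma> - {j}) - colsign j \<sigma> * colsign j' \<sigma> * f (r, j') (\<sigma> - {j'})) = 0"
      using h by (simp add: algebra_simps)
    then have "f (r, j) (\<sigma> - {j}) = colsign j \<sigma> * colsign j' \<sigma> * f (r, j') (\<sigma> - {j'})"
      using \<open>\<kappa> j \<noteq> 0\<close> by simp
    then have "colsign j \<sigma> * f (r, j) (\<sigma> - {j}) = (colsign j \<sigma> * colsign j \<sigma>) * (colsign j' \<sigma> * f (r, j') (\<sigma> - {j'}))"
      by (simp add: mult_ac)
    then show ?thesis by (simp add: s(2))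
  qed
qed simp

section \<open>Low degrees of the ideal\<close>

lemma hcomp_neg: "d < 0 \<Longrightarrow> hcomp d q = 0"
  by (rule poly_mapping_eqI) (simp add: coef_hcomp)

lemma mon_degree_eq_0_iff: "mon_degree t = 0 \<longleftrightarrow> t = 0"
  by (auto simp: mon_degree_def in_keys_iff intro!: poly_mapping_eqI)

lemma hcomp_zero_degree: "hcomp 0 q = xconst (coef q 0)"
  by (rule poly_mapping_eqI) (auto simp: coef_hcomp xconst_def lookup_single when_def mon_degree_eq_0_iff)

lemma ideal_gen_hcomp:
  assumes G: "\<And>g. g \<in> G \<Longrightarrow> homogeneous (int m) g" and p: "p \<in> ideal_gen m' n G" "homogeneous (int m + e) p"
  obtains A q where "finite A" "A \<subseteq> G" "p = (\<Sum>g\<in>A. g * hcomp e (q g))"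
proof -
  obtain A q where A: "finite A" "A \<subseteq> G" "p = (\<Sum>g\<in>A. q g * g)"
    using p(1) unfolding ideal_gen_def by auto
  have "p = hcomp (int m + e) p" using p(2) hcomp_eq_iff[of "int m + e" p] by simp
  also have "\<dots> = (\<Sum>g\<in>A. hcomp (int m + e) (g * q g))" by (simp add: A(3) hcomp_sum mult.commute)
  also have "\<dots> = (\<Sum>g\<in>A. g * hcomp e (q g))"
    by (rule sum.cong) (use A G in \<open>auto simp: hcomp_mult\<close>)
  finally show ?thesis using that A by blast
qed

text \<open>
The ideal is generated in degree \<open>m\<close>, so it has no nonzero elements of degree \<open>m - 1\<close>.
\<close>

lemma facet_ideal_low_degree:
  assumes C: "C \<subseteq> colsets m n" and p: "p \<in> det_facet_ideal m n C" "homogeneous (int m - 1) p"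
  shows "p = 0"
proof -
  have G: "homogeneous (int m) g" if "g \<in> minor m ` C" for g :: "'a xpoly"
    using that C minor_homogeneous by blast
  obtain A q where "p = (\<Sum>g\<in>A. g * hcomp (- 1) (q g))"
    by (rule ideal_gen_hcomp[OF G p(1)[unfolded det_facet_ideal_def], of "- 1"])
      (use p(2) in simp_all)
  then show ?thesis by (simp add: hcomp_neg)
qed

definition minor_comb :: "nat \<Rightarrow> nat \<Rightarrow> (nat set \<Rightarrow> 'k::field) \<Rightarrow> 'k xpoly" where
  "minor_comb m n c = (\<Sum>\<tau>\<in>colsets m n. xconst (c \<tau>) * minor m \<tau>)"

lemma facet_ideal_generating_degree:
  assumes C: "C \<subseteq> colsets m n" and p: "p \<in> det_facet_ideal m n C" "homogeneous (int m) p"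
  shows "\<exists>c. p = minor_comb m n c \<and> (\<forall>\<tau>. \<tau> \<notin> C \<longrightarrow> c \<tau> = 0)"
proof -
  have G: "homogeneous (int m) g" if "g \<in> minor m ` C" for g :: "'a xpoly"
    using that C minor_homogeneous by blast
  obtain A q where A: "finite A" "A \<subseteq> minor m ` C" "p = (\<Sum>g\<in>A. g * hcomp 0 (q g))"
    by (rule ideal_gen_hcomp[OF G p(1)[unfolded det_facet_ideal_def], of 0])
      (use p(2) in simp_all)
  define s where "s = inv_into C (minor m :: _ \<Rightarrow> 'a xpoly)"
  have s: "s g \<in> C" "minor m (s g) = g" if "g \<in> A" for g
    using A(2) that unfolding s_def by (auto intro: inv_into_into f_inv_into_f)
  have inj: "inj_on s A" by (rule inj_on_inverseI[of _ "minor m"]) (rule s(2))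
  define c where "c \<tau> = (if \<tau> \<in> s ` A then coef (q (minor m \<tau>)) 0 else 0)" for \<tau>
  have "p = (\<Sum>g\<in>A. xconst (c (s g)) * minor m (s g))"
    unfolding A(3) by (rule sum.cong) (auto simp: c_def s hcomp_zero_degree mult.commute)
  also have "\<dots> = (\<Sum>\<tau>\<in>s ` A. xconst (c \<tau>) * minor m \<tau>)"
    by (simp add: sum.reindex[OF inj])
  also have "\<dots> = minor_comb m n c"
    unfolding minor_comb_def
    by (rule sum.mono_neutral_left) (use C s finite_colsets in \<open>auto simp: c_def xconst_def\<close>)
  finally show ?thesis using s by (intro exI[of _ c]) (auto simp: c_def)
qed

lemma minor_in_facet_ideal: "\<tau> \<in> C \<Longrightarrow> minor m \<tau> \<in> det_facet_ideal m n C"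
  unfolding det_facet_ideal_def ideal_gen_def mem_Collect_eq
  by (intro exI[of _ "{minor m \<tau>}"] exI[of _ "\<lambda>_. 1"]) (auto simp: polyring_1)

lemma is_ideal_facet_ideal:
  assumes "C \<subseteq> colsets m n"
  shows "is_ideal m n (det_facet_ideal m n C)"
  unfolding det_facet_ideal_def by (rule is_ideal_ideal_gen) (use assms minor_polyring in blast)

text \<open>
A monomial of a minor determines its set of columns, so different minors have no monomial in common.
\<close>

lemma minors_independent:
  assumes z: "minor_comb m n c = (0 :: 'k::field xpoly)" and \<tau>: "\<tau> \<in> colsets m n"
  shows "c \<tau> = 0"
proof -
  obtain g where g: "bij_betw g \<tau> {1..m}" by (rule colset_bij_exists[OF \<tau>])
  have t: "finite \<tau>" "card \<tau> = m" using colsetsD[OF \<tau>] by blast+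
  have "coef (minor m \<tau>' :: 'k xpoly) (matching g \<tau>) = 0" if \<tau>': "\<tau>' \<in> colsets m n" "\<tau>' \<noteq> \<tau>" for \<tau>'
  proof (rule ccontr)
    have t': "finite \<tau>'" "card \<tau>' = m" using colsetsD[OF \<tau>'(1)] by blast+
    assume "coef (minor m \<tau>' :: 'k xpoly) (matching g \<tau>) \<noteq> 0"
    then obtain g' where "matching g \<tau> = matching g' \<tau>'" using minor_support[OF t'] by metis
    then have "snd ` vars (matching g \<tau>) = snd ` vars (matching g' \<tau>')" by simp
    then have "\<tau> = \<tau>'" by (simp add: vars_matching t t' image_image)
    with \<tau>' show False by simp
  qed
  then have "coef (minor_comb m n c) (matching g \<tau>) =
      (\<Sum>\<tau>'\<in>{\<tau>}. c \<tau>' * coef (minor m \<tau>') (matching g \<tau>))"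
    unfolding minor_comb_def lookup_sum coef_xconst_mult
    by (intro sum.mono_neutral_right) (use \<tau> finite_colsets in auto)
  then show ?thesis using z minor_coef_matching[OF t g, where 'k='k] by simp
qed

lemma minor_comb_sum:
  fixes c :: "'a \<Rightarrow> 'b::field"
  shows "(\<Sum>p\<in>P. xconst (c p) * minor_comb m n (d p)) = minor_comb m n (\<lambda>\<tau>. \<Sum>p\<in>P. c p * d p \<tau>)"
proof -
  have xs: "xconst (sum f S) = (\<Sum>s\<in>S. xconst (f s))" for f :: "'a \<Rightarrow> 'b" and S :: "'a set"
    by (induction S rule: infinite_finite_induct) (auto simp: xconst_def single_add)
  have "(\<Sum>p\<in>P. xconst (c p) * minor_comb m n (d p)) =
      (\<Sum>p\<in>P. \<Sum>\<tau>\<in>colsets m n. xconst (c p * d p \<tau>) * minor m \<tau>)"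
    by (simp add: minor_comb_def sum_distrib_left mult.assoc xconst_mult[symmetric])
  also have "\<dots> = (\<Sum>\<tau>\<in>colsets m n. \<Sum>p\<in>P. xconst (c p * d p \<tau>) * minor m \<tau>)" by (rule sum.swap)
  finally show ?thesis by (simp add: minor_comb_def xs sum_distrib_right)
qed

lemma minor_comb_cong: "(\<And>\<tau>. \<tau> \<in> colsets m n \<Longrightarrow> c \<tau> = d \<tau>) \<Longrightarrow> minor_comb m n c = minor_comb m n d"
  by (simp add: minor_comb_def)

section \<open>Cycles in terms of coefficients\<close>

text \<open>
The scalars of \<open>a\<close> at the sets \<open>B \<union> {u}\<close>, with the Koszul signs, as coefficients of \<open>x\<^sub>u m\<^sub>\<tau>\<close> in the
differential at \<open>B\<close>.
\<close>

definition slice :: "nat \<Rightarrow> ((nat \<times> nat) set \<Rightarrow> nat set \<Rightarrow> 'k::field) \<Rightarrow> (nat \<times> nat) set \<Rightarrow> nat \<times> nat \<Rightarrow> nat set \<Rightarrow> 'k" where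
  "slice m a B u \<tau> = (if u \<in> B then 0 else ksign m u B * a (insert u B) \<tau>)"

lemma kdiff_minor_comb:
  assumes B: "B \<in> ksets m n i" and w: "\<And>A. A \<in> ksets m n (Suc i) \<Longrightarrow> w A = minor_comb m n (a A)"
  shows "kdiff m n w B = 0 \<longleftrightarrow> linear_syzygy m n (slice m a B)"
proof -
  have "kdiff m n w B = (\<Sum>u\<in>grid m n - B. \<Sum>\<tau>\<in>colsets m n. xconst (slice m a B u \<tau>) * (vpoly u * minor m \<tau>))"
    unfolding kdiff_def
  proof (rule sum.cong[OF refl])
    fix u assume u: "u \<in> grid m n - B"
    have "w (insert u B) = minor_comb m n (a (insert u B))" by (rule w[OF ksets_insert[OF B u]])
    then show "xconst (ksign m u B) * (vpoly u * w (insert u B)) =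
        (\<Sum>\<tau>\<in>colsets m n. xconst (slice m a B u \<tau>) * (vpoly u * minor m \<tau>))"
      using u by (simp add: minor_comb_def sum_distrib_left slice_def xconst_mult[symmetric] mult_ac)
  qed
  also have "\<dots> = (\<Sum>u\<in>grid m n. \<Sum>\<tau>\<in>colsets m n. xconst (slice m a B u \<tau>) * (vpoly u * minor m \<tau>))"
    by (rule sum.mono_neutral_left) (auto simp: finite_grid slice_def xconst_def)
  finally show ?thesis
    by (simp add: linear_syzygy_def sum.cartesian_product)
qed

lemma ksign_square: "ksign m u B * ksign m u B = (1 :: 'a::comm_ring_1)"
  unfolding ksign_def by (metis (no_types) left_minus_one_mult_self mult.right_neutral)

lemma ksign_nonzero: "ksign m u B \<noteq> (0 :: 'a::field)"
  by (simp add: ksign_def)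

text \<open>
The scalars of a Koszul cycle of homological degree \<open>i\<close>; for \<open>i = 0\<close> there is no condition.
\<close>

definition coef_cycle :: "nat \<Rightarrow> nat \<Rightarrow> nat \<Rightarrow> ((nat \<times> nat) set \<Rightarrow> nat set \<Rightarrow> 'k::field) \<Rightarrow> bool" where
  "coef_cycle m n i a \<longleftrightarrow> (\<forall>i' B. i = Suc i' \<longrightarrow> B \<in> ksets m n i' \<longrightarrow> linear_syzygy m n (slice m a B))"

lemma coef_cycle_remove:
  assumes a: "coef_cycle m n i a" and A: "A \<in> ksets m n i" and u: "u \<in> A"
  obtains i' where "i = Suc i'" "A - {u} \<in> ksets m n i'" "linear_syzygy m n (slice m a (A - {u}))"
proof -
  obtain i' where i: "i = Suc i'"
    using A u ksets_finite[OF A] by (cases i) (auto simp: ksets_def)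
  have "A - {u} \<in> ksets m n i'" using ksets_remove[OF A[unfolded i] u] .
  then show ?thesis using that i a unfolding coef_cycle_def by blast
qed

lemma slice_remove: "u \<in> A \<Longrightarrow> slice m a (A - {u}) u \<tau> = ksign m u (A - {u}) * a A \<tau>"
  by (simp add: slice_def insert_absorb)

lemma coef_cycle_column_disjoint:
  assumes a: "coef_cycle m n i a" and A: "A \<in> ksets m n i" and \<tau>: "\<tau> \<in> colsets m n"
    and u: "u \<in> A" "snd u \<in> \<tau>"
  shows "a A \<tau> = 0"
proof -
  obtain r j where rj: "u = (r, j)" by (cases u)
  have "linear_syzygy m n (slice m a (A - {u}))" using coef_cycle_remove[OF a A u(1)] by metis
  moreover have "r \<in> {1..m}" using A u by (auto simp: ksets_def grid_def rj)
  ultimately have "slice m a (A - {u}) (r, j) \<tau> = 0"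
    using linear_syzygy_column_disjoint \<tau> u(2) rj by simp
  then show ?thesis using u(1) by (simp add: slice_remove rj[symmetric] ksign_nonzero)
qed

text \<open>
Suppose that two variables \<open>u\<close> and \<open>v\<close> of \<open>A\<close> lie in the column \<open>j\<close>. Exchanging \<open>u\<close> for a variable in a column \<open>j'\<close>
of \<open>\<tau>\<close> puts \<open>j\<close> into the column set of the minor, where the scalar vanishes because \<open>v\<close> still lies in that
column. Since \<open>m \<ge> 1\<close>, a column \<open>j'\<close> exists.
\<close>

lemma coef_cycle_columns_distinct:
  assumes m: "m \<ge> 1" and a: "coef_cycle m n i a" and A: "A \<in> ksets m n i" and \<tau>: "\<tau> \<in> colsets m n"
    and n: "\<not> inj_on snd A"
  shows "a A \<tau> = 0"
proof (rule ccontr)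
  assume nz: "a A \<tau> \<noteq> 0"
  obtain u v where uv: "u \<in> A" "v \<in> A" "u \<noteq> v" "snd u = snd v" using n by (auto simp: inj_on_def)
  obtain r j where rj: "u = (r, j)" by (cases u)
  have u: "r \<in> {1..m}" "j \<in> {1..n}" using A uv by (auto simp: ksets_def grid_def rj)
  have j\<tau>: "j \<notin> \<tau>" using coef_cycle_column_disjoint[OF a A \<tau> uv(1)] nz rj by auto
  have t: "finite \<tau>" "card \<tau> = m" "\<tau> \<subseteq> {1..n}" using colsetsD[OF \<tau>] by blast+
  obtain j' where j': "j' \<in> \<tau>" using t m by (metis card.empty equals0I not_one_le_zero)
  obtain i' where i': "i = Suc i'" and B: "A - {u} \<in> ksets m n i'" and syz: "linear_syzygy m n (slice m a (A - {u}))"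
    using coef_cycle_remove[OF a A uv(1)] by metis
  let ?\<sigma> = "insert j \<tau>"
  have \<sigma>: "?\<sigma> \<in> colsets (Suc m) n" using t u j\<tau> by (simp add: colsets_def)
  have "slice m a (A - {u}) (r, j') (?\<sigma> - {j'}) = 0"
  proof (cases "(r, j') \<in> A - {u}")
    case False
    have jn: "j' \<in> {1..n}" using j' t by auto
    have "insert (r, j') (A - {u}) \<in> ksets m n i"
      unfolding i' by (rule ksets_insert[OF B]) (use False u jn in \<open>auto simp: grid_def\<close>)
    moreover have "?\<sigma> - {j'} \<in> colsets m n" using \<sigma> j' by (auto simp: colsets_def card_Diff_singleton_if)
    moreover have "v \<in> insert (r, j') (A - {u})" "snd v \<in> ?\<sigma> - {j'}"
      using uv rj j\<tau> j' by auto
    ultimately have "a (insert (r, j') (A - {u})) (?\<sigma> - {j'}) = 0"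
      using coef_cycle_column_disjoint[OF a] by blast
    then show ?thesis by (simp add: slice_def)
  qed (simp add: slice_def)
  then have "colsign j ?\<sigma> * slice m a (A - {u}) (r, j) (?\<sigma> - {j}) = 0"
    using linear_syzygy_exchange[OF syz u(1) \<sigma>, of j j'] j' by simp
  moreover have "?\<sigma> - {j} = \<tau>" using j\<tau> by auto
  ultimately have "slice m a (A - {u}) u \<tau> = 0" by (simp add: colsign_def rj)
  then show False using nz uv(1) by (simp add: slice_remove ksign_nonzero)
qed

section \<open>Placements of entries in distinct columns\<close>

text \<open>
The sign of the permutation that sorts the elements of \<open>T\<close> followed by those of \<open>\<tau>\<close>, for disjoint sets.
\<close>

definition shuffle_sign :: "nat set \<Rightarrow> nat set \<Rightarrow> 'a::comm_ring_1" where
  "shuffle_sign T \<tau> = (\<Prod>x\<in>T. colsign x \<tau>)"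

lemma shuffle_sign_square: "shuffle_sign T \<tau> * shuffle_sign T \<tau> = (1 :: 'a::comm_ring_1)"
  by (simp add: shuffle_sign_def prod.distrib[symmetric] colsign_square)

lemma shuffle_sign_nonzero: "shuffle_sign T \<tau> \<noteq> (0 :: 'a::field)"
  using shuffle_sign_square[of T \<tau>, where 'a='a] by auto

lemma colsign_remove:
  assumes "finite \<sigma>" "j \<in> \<sigma>"
  shows "colsign x (\<sigma> - {j}) = (if j < x then - 1 else 1) * (colsign x \<sigma> :: 'a::comm_ring_1)"
proof (cases "j < x")
  case True
  have "{y \<in> \<sigma>. y < x} = insert j {y \<in> \<sigma> - {j}. y < x}" using assms True by auto
  then have "card {y \<in> \<sigma>. y < x} = Suc (card {y \<in> \<sigma> - {j}. y < x})" using assms by simp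
  then show ?thesis using True by (simp add: colsign_def)
next
  case False
  then have "{y \<in> \<sigma> - {j}. y < x} = {y \<in> \<sigma>. y < x}" by auto
  then show ?thesis using False by (simp add: colsign_def)
qed

lemma prod_if_minus_one:
  "finite T \<Longrightarrow> (\<Prod>x\<in>T. if P x then - 1 else 1) = ((- 1) ^ card {x \<in> T. P x} :: 'a::comm_ring_1)"
  by (simp add: prod.If_cases Int_def)

lemma ksign_columns:
  assumes B: "B \<subseteq> grid m n" "inj_on snd B" and r: "r \<in> {1..m}" and j: "j \<notin> snd ` B"
  shows "ksign m (r, j) B = ((- 1) ^ card {x \<in> snd ` B. x < j} :: 'a::comm_ring_1)"
proof -
  have "{v \<in> B. vkey m v < vkey m (r, j)} = {v \<in> B. snd v < j}"
  proof (rule Collect_cong, rule conj_cong[OF refl])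
    fix v assume v: "v \<in> B"
    then have "fst v \<le> m" "snd v \<noteq> j" using B j by (auto simp: grid_def)
    then show "vkey m v < vkey m (r, j) \<longleftrightarrow> snd v < j" using r by (subst vkey_less_iff) auto
  qed
  moreover have "card (snd ` {v \<in> B. snd v < j}) = card {v \<in> B. snd v < j}"
    by (rule card_image) (use B in \<open>auto intro: inj_on_subset\<close>)
  moreover have "snd ` {v \<in> B. snd v < j} = {x \<in> snd ` B. x < j}" by auto
  ultimately show ?thesis by (simp add: ksign_def)
qed

text \<open>
When \<open>j\<close> moves from \<open>\<sigma>\<close> to the columns of \<open>B\<close>, the sign changes by \<open>colsign j \<sigma>\<close> and by one factor \<open>-1\<close> for each column
of \<open>B\<close> to the right of \<open>j\<close>. The Koszul sign contributes the columns of \<open>B\<close> to the left of \<open>j\<close>. So the total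
depends on \<open>j\<close> only through \<open>colsign j \<sigma>\<close>, which is the sign in the exchange relation.
\<close>

lemma shuffle_sign_insert:
  assumes B: "B \<subseteq> grid m n" "inj_on snd B" and r: "r \<in> {1..m}" and \<sigma>: "finite \<sigma>" "j \<in> \<sigma>" "snd ` B \<inter> \<sigma> = {}"
  shows "shuffle_sign (insert j (snd ` B)) (\<sigma> - {j}) * ksign m (r, j) B =
    shuffle_sign (snd ` B) \<sigma> * (- 1) ^ card B * (colsign j \<sigma> :: 'a::comm_ring_1)"
proof -
  let ?T = "snd ` B"
  have fB: "finite B" using B finite_grid finite_subset by blast
  then have fT: "finite ?T" by simp
  have jT: "j \<notin> ?T" using \<sigma> by auto
  have cT: "card ?T = card B" using B by (simp add: card_image)
  have k: "ksign m (r, j) B = (\<Prod>x\<in>?T. if x < j then - 1 else 1 :: 'a)"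
    using ksign_columns[OF B r jT, where 'a='a] prod_if_minus_one[OF fT, where 'a='a] by simp
  have "shuffle_sign (insert j ?T) (\<sigma> - {j}) * ksign m (r, j) B =
      colsign j \<sigma> * ((\<Prod>x\<in>?T. (if j < x then - 1 else 1) * colsign x \<sigma>) * (\<Prod>x\<in>?T. if x < j then - 1 else 1 :: 'a))"
    using fT jT by (simp add: shuffle_sign_def colsign_remove[OF \<sigma>(1,2)] k mult.assoc)
  also have "(\<Prod>x\<in>?T. (if j < x then - 1 else 1) * colsign x \<sigma>) * (\<Prod>x\<in>?T. if x < j then - 1 else 1 :: 'a) =
      (\<Prod>x\<in>?T. - 1 * colsign x \<sigma>)"
    unfolding prod.distrib[symmetric]
  proof (rule prod.cong[OF refl])
    fix x assume "x \<in> ?T"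
    then have "x \<noteq> j" using jT by auto
    then show "(if j < x then - 1 else 1) * colsign x \<sigma> * (if x < j then - 1 else 1) = - 1 * (colsign x \<sigma> :: 'a)"
      by (cases x j rule: linorder_cases) auto
  qed
  also have "\<dots> = (- 1) ^ card B * shuffle_sign ?T \<sigma>"
    unfolding prod.distrib shuffle_sign_def by (simp add: cT)
  finally show ?thesis by (simp add: mult_ac)
qed

definition placement :: "nat \<Rightarrow> nat set \<Rightarrow> nat \<Rightarrow> (nat \<times> nat) set \<Rightarrow> bool" where
  "placement m \<sigma> i A \<longleftrightarrow> A \<subseteq> {1..m} \<times> \<sigma> \<and> inj_on snd A \<and> card A = i"

lemma placement_finite: "finite \<sigma> \<Longrightarrow> placement m \<sigma> i A \<Longrightarrow> finite A"
  unfolding placement_def by (meson finite_SigmaI finite_atLeastAtMost finite_subset)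

lemma placement_ksets: "\<sigma> \<subseteq> {1..n} \<Longrightarrow> placement m \<sigma> i A \<Longrightarrow> A \<in> ksets m n i"
  unfolding placement_def ksets_def grid_def by blast

lemma placement_columns:
  assumes "finite \<sigma>" "placement m \<sigma> i A"
  shows "snd ` A \<subseteq> \<sigma>" "card (snd ` A) = i"
  using assms by (auto simp: placement_def card_image)

lemma placement_insert:
  assumes fin: "finite \<sigma>" and B: "placement m \<sigma> i B" and r: "r \<in> {1..m}" and j: "j \<in> \<sigma> - snd ` B"
  shows "placement m \<sigma> (Suc i) (insert (r, j) B)" "(r, j) \<notin> B"
proof -
  show n: "(r, j) \<notin> B" using j by force
  show "placement m \<sigma> (Suc i) (insert (r, j) B)"
    using placement_finite[OF fin B] B r j n unfolding placement_def by (auto simp: inj_on_insert)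
qed

lemma placement_remove:
  assumes fin: "finite \<sigma>" and A: "placement m \<sigma> (Suc i) A" and x: "x \<in> A"
  shows "placement m \<sigma> i (A - {x})" "snd x \<in> \<sigma> - snd ` (A - {x})" "fst x \<in> {1..m}"
proof -
  show "placement m \<sigma> i (A - {x})"
    using placement_finite[OF fin A] A x unfolding placement_def by (auto intro: inj_on_subset)
  show "snd x \<in> \<sigma> - snd ` (A - {x})" "fst x \<in> {1..m}"
    using A x unfolding placement_def by (auto dest: inj_onD)
qed

definition rowcount :: "(nat \<times> nat) set \<Rightarrow> nat \<Rightarrow> nat" where
  "rowcount A r = card {x \<in> A. fst x = r}"

definition rowcounts :: "nat \<Rightarrow> (nat \<times> nat) set \<Rightarrow> nat list" where
  "rowcounts m A = map (rowcount A) [1..<Suc m]"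

lemma rowcount_insert:
  assumes "finite B" "u \<notin> B"
  shows "rowcount (insert u B) r = (if r = fst u then Suc (rowcount B r) else rowcount B r)"
proof -
  have "{x \<in> insert u B. fst x = r} = (if r = fst u then insert u {x \<in> B. fst x = r} else {x \<in> B. fst x = r})"
    by auto
  then show ?thesis using assms by (simp add: rowcount_def)
qed

lemma rowcounts_eq_iff: "rowcounts m A = rowcounts m A' \<longleftrightarrow> (\<forall>r\<in>{1..m}. rowcount A r = rowcount A' r)"
  by (auto simp: rowcounts_def)

lemma length_rowcounts [simp]: "length (rowcounts m A) = m"
  by (simp add: rowcounts_def)

lemma sum_list_rowcounts:
  assumes "finite A" "fst ` A \<subseteq> {1..m}"
  shows "sum_list (rowcounts m A) = card A"
proof -
  have "sum_list (rowcounts m A) = (\<Sum>r\<in>{1..m}. card {x \<in> A. fst x = r})"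
    by (simp add: rowcounts_def rowcount_def sum_list_distinct_conv_sum_set atLeastLessThanSuc_atLeastAtMost del: upt_Suc)
  also have "\<dots> = card (\<Union>r\<in>{1..m}. {x \<in> A. fst x = r})"
    by (rule card_UN_disjoint[symmetric]) (use assms in auto)
  also have "(\<Union>r\<in>{1..m}. {x \<in> A. fst x = r}) = A" using assms by auto
  finally show ?thesis .
qed

text \<open>
Consecutive blocks of columns are assigned to the rows.
\<close>

lemma placement_exists:
  "finite T \<Longrightarrow> card T = sum_list \<rho> \<Longrightarrow>
    \<exists>A. placement (length \<rho>) T (sum_list \<rho>) A \<and> snd ` A = T \<and> rowcounts (length \<rho>) A = \<rho>"
proof (induction \<rho> arbitrary: T rule: rev_induct)
  case Nil
  then show ?case by (intro exI[of _ "{}"]) (auto simp: placement_def rowcounts_def)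
next
  case (snoc k \<rho>)
  let ?l = "length \<rho>"
  obtain T1 where T1: "T1 \<subseteq> T" "card T1 = sum_list \<rho>"
    using obtain_subset_with_card_n[of "sum_list \<rho>" T] snoc.prems by auto
  have fT1: "finite T1" using T1 snoc.prems finite_subset by blast
  obtain A where A: "placement ?l T1 (sum_list \<rho>) A" "snd ` A = T1" "rowcounts ?l A = \<rho>"
    using snoc.IH[OF fT1 T1(2)] by blast
  let ?N = "{Suc ?l} \<times> (T - T1)"
  let ?A = "A \<union> ?N"
  have fA: "finite A" by (rule placement_finite[OF fT1 A(1)])
  have Asub: "A \<subseteq> {1..?l} \<times> T1" and Ainj: "inj_on snd A" and Ac: "card A = sum_list \<rho>"
    using A(1) by (auto simp: placement_def)
  have cN: "card ?N = k"
    using snoc.prems T1 fT1 by (simp add: card_cartesian_product card_Diff_subset)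
  have disj: "A \<inter> ?N = {}" using Asub by auto
  have fN: "finite ?N" using snoc.prems by simp
  have "card ?A = sum_list (\<rho> @ [k])"
    using fA fN disj Ac cN by (simp add: card_Un_disjoint)
  moreover have "inj_on snd ?A"
  proof (rule inj_onI)
    fix x y assume x: "x \<in> ?A" and y: "y \<in> ?A" and xy: "snd x = snd y"
    show "x = y"
    proof (cases "snd x \<in> T1")
      case True
      then have "x \<in> A" "y \<in> A" using x y xy by auto
      then show ?thesis using Ainj xy by (simp add: inj_on_def)
    next
      case False
      then have "x \<in> ?N" "y \<in> ?N" using x y xy A(2) by auto
      then show ?thesis using xy by (auto intro: prod_eqI)
    qed
  qed
  moreover have "?A \<subseteq> {1..Suc ?l} \<times> T" using Asub T1 by auto
  ultimately have "placement (Suc ?l) T (sum_list (\<rho> @ [k])) ?A" by (simp add: placement_def)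
  moreover have "snd ` ?A = T"
  proof -
    have "snd ` ?N = T - T1" by auto
    then show ?thesis using A(2) T1 by (auto simp: image_Un)
  qed
  moreover have "rowcounts (Suc ?l) ?A = \<rho> @ [k]"
  proof -
    have "rowcount ?A r = rowcount A r" if "r \<in> {1..?l}" for r
    proof -
      have "{x \<in> ?A. fst x = r} = {x \<in> A. fst x = r}" using that by auto
      then show ?thesis by (simp add: rowcount_def)
    qed
    then have "map (rowcount ?A) [1..<Suc ?l] = map (rowcount A) [1..<Suc ?l]" by (intro map_cong) auto
    moreover have "{x \<in> ?A. fst x = Suc ?l} = ?N" using Asub by auto
    then have "rowcount ?A (Suc ?l) = k" using cN by (simp add: rowcount_def)
    moreover have "[1..<Suc (Suc ?l)] = [1..<Suc ?l] @ [Suc ?l]" by simp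
    ultimately show ?thesis using A(3) unfolding rowcounts_def by (simp only: map_append list.map)
  qed
  ultimately show ?case by (intro exI[of _ ?A]) simp
qed

text \<open>
If \<open>A\<close> and \<open>A'\<close> have different column sets, some \<open>y \<in> A'\<close> lies in a column that is free for \<open>A\<close>; as the row counts
agree, some variable of \<open>A - A'\<close> in the row of \<open>y\<close> can be moved to \<open>y\<close>, and \<open>A - A'\<close> becomes smaller. If the column
sets agree, a variable of \<open>A - A'\<close> is first moved to a free column. This does not enlarge \<open>A - A'\<close>
but makes the column sets differ, which explains the second summand of the measure.
\<close>

lemma placement_connected:
  fixes F :: "(nat \<times> nat) set \<Rightarrow> 'b"
  assumes fin: "finite \<sigma>" and room: "i < card \<sigma>"
    and exch: "\<And>B i' r j j'. i = Suc i' \<Longrightarrow> placement m \<sigma> i' B \<Longrightarrow> r \<in> {1..m} \<Longrightarrow>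
      j \<in> \<sigma> - snd ` B \<Longrightarrow> j' \<in> \<sigma> - snd ` B \<Longrightarrow> F (insert (r, j) B) = F (insert (r, j') B)"
    and A': "placement m \<sigma> i A'"
  shows "placement m \<sigma> i A \<Longrightarrow> rowcounts m A = rowcounts m A' \<Longrightarrow> F A = F A'"
proof (induction "2 * card (A - A') + (if snd ` A = snd ` A' then 1 else 0)" arbitrary: A rule: less_induct)
  case less
  note A = less.prems(1) and rc = less.prems(2)
  have fA: "finite A" and fA': "finite A'" using placement_finite[OF fin] A A' by auto
  show ?case
  proof (cases "A = A'")
    case False
    have cA: "card A = i" "card A' = i" using A A' by (auto simp: placement_def)
    have ne: "A - A' \<noteq> {}"
      using False cA fA' card_subset_eq[of A' A] by auto
    \<comment> \<open>Replacing one entry by another of the same row, in a free column, leaves \<open>F\<close> and the row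
      counts unchanged.\<close>
    have move: "F A = F (insert (fst x, j0) (A - {x})) \<and> placement m \<sigma> i (insert (fst x, j0) (A - {x}))
        \<and> rowcounts m (insert (fst x, j0) (A - {x})) = rowcounts m A \<and> (fst x, j0) \<notin> A"
      if x: "x \<in> A" and j0: "j0 \<in> \<sigma> - snd ` A" for x j0
    proof -
      obtain i' where i: "i = Suc i'" using x cA fA by (cases i) auto
      note B = placement_remove[OF fin A[unfolded i] x]
      have j0B: "j0 \<in> \<sigma> - snd ` (A - {x})" using j0 by auto
      have "F (insert (fst x, snd x) (A - {x})) = F (insert (fst x, j0) (A - {x}))"
        by (rule exch[OF i B(1,3,2) j0B])
      then have "F A = F (insert (fst x, j0) (A - {x}))" using x by (simp add: insert_absorb)
      moreover have "rowcount (insert (fst x, j0) (A - {x})) r = rowcount A r" for r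
        using rowcount_insert[of "A - {x}" "(fst x, j0)" r] rowcount_insert[of "A - {x}" x r]
          placement_insert(2)[OF fin B(1,3) j0B] fA x by (simp add: insert_absorb)
      moreover have "(fst x, j0) \<notin> A" using j0 by force
      ultimately show ?thesis
        using placement_insert(1)[OF fin B(1,3) j0B] i by (simp add: rowcounts_eq_iff)
    qed
    show ?thesis
    proof (cases "snd ` A = snd ` A'")
      case True
      obtain x where x: "x \<in> A" "x \<notin> A'" using ne by blast
      have "card (snd ` A) < card \<sigma>" using room placement_columns[OF fin A] by simp
      then obtain j0 where j0: "j0 \<in> \<sigma> - snd ` A"
        using card_mono[of "snd ` A" \<sigma>] fA by (metis DiffI finite_imageI leD subsetI)
      let ?A = "insert (fst x, j0) (A - {x})"
      note mv = move[OF x(1) j0]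
      have notin: "(fst x, j0) \<notin> A'" using j0 True by force
      have "?A - A' = insert (fst x, j0) ((A - A') - {x})" using notin by auto
      then have "card (?A - A') = card (A - A')"
        using fA x mv card_Suc_Diff1[of "A - A'" x] by simp
      moreover have "snd ` ?A \<noteq> snd ` A'" using j0 True by auto
      ultimately have "F ?A = F A'"
        using mv rc True by (intro less.hyps) auto
      then show ?thesis using mv by simp
    next
      case False
      have "card (snd ` A) = card (snd ` A')" using placement_columns(2)[OF fin] A A' by simp
      then obtain j0 where j0: "j0 \<in> snd ` A'" "j0 \<notin> snd ` A"
        using False card_subset_eq[of "snd ` A" "snd ` A'"] fA by auto
      then obtain y where y: "y \<in> A'" "snd y = j0" by auto
      have j0\<sigma>: "j0 \<in> \<sigma> - snd ` A" using j0 placement_columns(1)[OF fin A'] by auto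
      have yA: "y \<notin> A" using y j0 by auto
      have ry: "fst y \<in> {1..m}" using A' y by (auto simp: placement_def)
      have "\<exists>x\<in>A - A'. fst x = fst y"
      proof (rule ccontr)
        assume "\<not> ?thesis"
        then have sub: "{x \<in> A. fst x = fst y} \<subseteq> {x \<in> A'. fst x = fst y}" by auto
        have "rowcount A (fst y) = rowcount A' (fst y)" using rc ry by (simp add: rowcounts_eq_iff)
        then have "{x \<in> A. fst x = fst y} = {x \<in> A'. fst x = fst y}"
          using sub fA' by (intro card_subset_eq) (auto simp: rowcount_def)
        then show False using y yA by blast
      qed
      then obtain x where x: "x \<in> A" "x \<notin> A'" "fst x = fst y" by blast
      let ?A = "insert (fst x, j0) (A - {x})"
      note mv = move[OF x(1) j0\<sigma>]
      have "(fst x, j0) \<in> A'" using y x by (metis prod.collapse)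
      then have "?A - A' = (A - A') - {x}" by auto
      then have "Suc (card (?A - A')) = card (A - A')"
        using fA x card_Suc_Diff1[of "A - A'" x] by simp
      then have "F ?A = F A'" using mv rc False by (intro less.hyps) auto
      then show ?thesis using mv by simp
    qed
  qed simp
qed

section \<open>Normalised coefficients\<close>

text \<open>
With this sign the scalars of a cycle become invariant under exchange of columns.
\<close>

definition norm_coef :: "((nat \<times> nat) set \<Rightarrow> nat set \<Rightarrow> 'k::field) \<Rightarrow> nat set \<Rightarrow> (nat \<times> nat) set \<Rightarrow> 'k" where
  "norm_coef a \<sigma> A = shuffle_sign (snd ` A) (\<sigma> - snd ` A) * a A (\<sigma> - snd ` A)"

lemma norm_coef_exchange:
  assumes a: "coef_cycle m n (Suc i) a" and \<sigma>: "\<sigma> \<in> colsets (m + Suc i) n" and B: "placement m \<sigma> i B"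
    and r: "r \<in> {1..m}" and j: "j \<in> \<sigma> - snd ` B" and j': "j' \<in> \<sigma> - snd ` B"
  shows "norm_coef a \<sigma> (insert (r, j) B) = norm_coef a \<sigma> (insert (r, j') B)"
proof -
  have s: "finite \<sigma>" "card \<sigma> = m + Suc i" "\<sigma> \<subseteq> {1..n}" using colsetsD[OF \<sigma>] by blast+
  let ?\<sigma> = "\<sigma> - snd ` B"
  have BK: "B \<in> ksets m n i" by (rule placement_ksets[OF s(3) B])
  then have Bg: "B \<subseteq> grid m n" by (simp add: ksets_def)
  have Bi: "inj_on snd B" using B by (simp add: placement_def)
  have fB: "finite B" by (rule placement_finite[OF s(1) B])
  have \<sigma>': "?\<sigma> \<in> colsets (Suc m) n"
    using placement_columns[OF s(1) B] s fB by (auto simp: colsets_def card_Diff_subset)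
  have syz: "linear_syzygy m n (slice m a B)" using a BK by (simp add: coef_cycle_def)
  have eq: "norm_coef a \<sigma> (insert (r, k) B) =
      shuffle_sign (snd ` B) ?\<sigma> * (- 1) ^ card B * (colsign k ?\<sigma> * slice m a B (r, k) (?\<sigma> - {k}))"
    if k: "k \<in> ?\<sigma>" for k
  proof -
    have nB: "(r, k) \<notin> B" by (rule placement_insert(2)[OF s(1) B r k])
    have "snd ` insert (r, k) B = insert k (snd ` B)" "\<sigma> - insert k (snd ` B) = ?\<sigma> - {k}" by auto
    then have "norm_coef a \<sigma> (insert (r, k) B) =
        shuffle_sign (insert k (snd ` B)) (?\<sigma> - {k}) * a (insert (r, k) B) (?\<sigma> - {k})"
      by (simp add: norm_coef_def)
    also have "\<dots> = shuffle_sign (insert k (snd ` B)) (?\<sigma> - {k}) * (ksign m (r, k) B * ksign m (r, k) B)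
        * a (insert (r, k) B) (?\<sigma> - {k})"
      by (simp add: ksign_square)
    also have "\<dots> = (shuffle_sign (insert k (snd ` B)) (?\<sigma> - {k}) * ksign m (r, k) B) * slice m a B (r, k) (?\<sigma> - {k})"
      using nB by (simp add: slice_def mult_ac)
    also have "shuffle_sign (insert k (snd ` B)) (?\<sigma> - {k}) * ksign m (r, k) B =
        shuffle_sign (snd ` B) ?\<sigma> * (- 1) ^ card B * (colsign k ?\<sigma> :: 'a)"
      by (rule shuffle_sign_insert[OF Bg Bi r]) (use s k in auto)
    finally show ?thesis by (simp add: mult.assoc)
  qed
  show ?thesis
    unfolding eq[OF j] eq[OF j'] using linear_syzygy_exchange[OF syz r \<sigma>' j j'] by simp
qed

lemma norm_coef_constant:
  assumes m: "m \<ge> 1" and a: "coef_cycle m n i a" and \<sigma>: "\<sigma> \<in> colsets (m + i) n"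
    and A: "placement m \<sigma> i A" and A': "placement m \<sigma> i A'" and rc: "rowcounts m A = rowcounts m A'"
  shows "norm_coef a \<sigma> A = norm_coef a \<sigma> A'"
proof (rule placement_connected[where F = "norm_coef a \<sigma>", OF _ _ _ A' A rc])
  show "finite \<sigma>" "i < card \<sigma>" using colsetsD[OF \<sigma>] m by auto
next
  fix B i' r j j' assume i: "i = Suc i'" and B: "placement m \<sigma> i' B" and r: "r \<in> {1..m}"
    and j: "j \<in> \<sigma> - snd ` B" "j' \<in> \<sigma> - snd ` B"
  show "norm_coef a \<sigma> (insert (r, j) B) = norm_coef a \<sigma> (insert (r, j') B)"
    by (rule norm_coef_exchange[OF a[unfolded i] \<sigma>[unfolded i] B r j])
qed

section \<open>A basis of the linear strand\<close>

definition strand_index :: "nat \<Rightarrow> nat \<Rightarrow> nat \<Rightarrow> nat set set \<Rightarrow> (nat list \<times> nat set) set" where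
  "strand_index m n i C = {\<rho>. length \<rho> = m \<and> sum_list \<rho> = i} \<times> {\<sigma> \<in> clique_complex m n C. card \<sigma> = m + i}"

definition strand_coef ::
    "nat \<Rightarrow> nat \<Rightarrow> nat list \<times> nat set \<Rightarrow> (nat \<times> nat) set \<Rightarrow> nat set \<Rightarrow> 'k::field" where
  "strand_coef m i p A \<tau> = (case p of (\<rho>, \<sigma>) \<Rightarrow>
     if placement m \<sigma> i A \<and> rowcounts m A = \<rho> \<and> \<tau> = \<sigma> - snd ` A then shuffle_sign (snd ` A) \<tau> else 0)"

definition strand_cycle ::
    "nat \<Rightarrow> nat \<Rightarrow> nat \<Rightarrow> nat list \<times> nat set \<Rightarrow> (nat \<times> nat) set \<Rightarrow> 'k::field xpoly" where
  "strand_cycle m n i p A = minor_comb m n (strand_coef m i p A)"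

lemma clique_complexD:
  assumes "\<sigma> \<in> clique_complex m n C" "card \<sigma> = m + i"
  shows "\<sigma> \<in> colsets (m + i) n"
  using assms by (simp add: clique_complex_def colsets_def)

lemma finite_strand_index: "finite (strand_index m n i C)"
proof -
  have "{\<rho>. length \<rho> = m \<and> sum_list \<rho> = i} \<subseteq> {\<rho>. set \<rho> \<subseteq> {..i} \<and> length \<rho> = m}"
    by (auto dest: member_le_sum_list)
  then have "finite {\<rho> :: nat list. length \<rho> = m \<and> sum_list \<rho> = i}"
    by (rule finite_subset) (rule finite_lists_length_eq, simp)
  moreover have "finite {\<sigma> \<in> clique_complex m n C. card \<sigma> = m + i}"
    by (rule finite_subset[of _ "Pow {1..n}"]) (auto simp: clique_complex_def)
  ultimately show ?thesis by (simp add: strand_index_def)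
qed

lemma card_strand_index:
  assumes "m \<ge> 1"
  shows "card (strand_index m n i C) =
    ((m + i - 1) choose (m - 1)) * face_number (m + i - 1) (clique_complex m n C)"
proof -
  have "card {\<rho> :: nat list. length \<rho> = m \<and> sum_list \<rho> = i} = (i + m - 1) choose i"
    by (rule card_length_sum_list)
  also have "\<dots> = (m + i - 1) choose (m - 1)"
    using assms binomial_symmetric[of i "m + i - 1"] by (simp add: add.commute)
  finally show ?thesis
    using assms by (simp add: strand_index_def card_cartesian_product face_number_def)
qed

lemma rows_subset: "A \<subseteq> {1..m} \<times> \<sigma> \<Longrightarrow> fst ` A \<subseteq> {1..m}"
  using image_mono[of A "{1..m} \<times> \<sigma>" fst] by (simp split: if_splits)

lemma placement_complement:
  assumes \<sigma>: "\<sigma> \<in> colsets (m + i) n" and A: "placement m \<sigma> i A"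
  shows "\<sigma> - snd ` A \<in> colsets m n"
proof -
  have s: "finite \<sigma>" "card \<sigma> = m + i" "\<sigma> \<subseteq> {1..n}" using colsetsD[OF \<sigma>] by blast+
  have "finite (snd ` A)" using placement_finite[OF s(1) A] by simp
  then show ?thesis
    using placement_columns[OF s(1) A] s by (auto simp: colsets_def card_Diff_subset)
qed

lemma strand_cycle_value:
  assumes \<sigma>: "\<sigma> \<in> colsets (m + i) n"
  shows "strand_cycle m n i (\<rho>, \<sigma>) A =
    (if placement m \<sigma> i A \<and> rowcounts m A = \<rho>
     then xconst (shuffle_sign (snd ` A) (\<sigma> - snd ` A)) * minor m (\<sigma> - snd ` A) else (0 :: 'k::field xpoly))"
proof (cases "placement m \<sigma> i A \<and> rowcounts m A = \<rho>")
  case True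
  have "strand_cycle m n i (\<rho>, \<sigma>) A =
      (\<Sum>\<tau>\<in>{\<sigma> - snd ` A}. xconst (strand_coef m i (\<rho>, \<sigma>) A \<tau>) * (minor m \<tau> :: 'k xpoly))"
    unfolding strand_cycle_def minor_comb_def
    by (rule sum.mono_neutral_right)
      (use True placement_complement[OF \<sigma>] finite_colsets in \<open>auto simp: strand_coef_def xconst_def\<close>)
  then show ?thesis using True by (simp add: strand_coef_def)
next
  case False
  then have "strand_coef m i (\<rho>, \<sigma>) A \<tau> = (0 :: 'k)" for \<tau> by (auto simp: strand_coef_def)
  then have "strand_cycle m n i (\<rho>, \<sigma>) A = (0 :: 'k xpoly)"
    by (simp add: strand_cycle_def minor_comb_def xconst_def)
  then show ?thesis unfolding if_not_P[OF False] .
qed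

text \<open>
At a placement \<open>B\<close> the differential is a sum over the row \<open>r\<close> and the column \<open>j\<close> of the added variable. Whether the
row counts become \<open>\<rho>\<close> depends on \<open>r\<close> only, and the signs agree with those of the Laplace relation, so for each \<open>r\<close>
the sum over \<open>j\<close> vanishes.
\<close>

lemma strand_cycle_kdiff:
  assumes \<sigma>: "\<sigma> \<in> colsets (m + Suc i) n" and B: "B \<in> ksets m n i"
  shows "kdiff m n (strand_cycle m n (Suc i) (\<rho>, \<sigma>)) B = (0 :: 'k::field xpoly)"
proof -
  have s: "finite \<sigma>" "card \<sigma> = m + Suc i" "\<sigma> \<subseteq> {1..n}" using colsetsD[OF \<sigma>] by blast+
  define h where "h u = xconst (ksign m u B) * (vpoly u * strand_cycle m n (Suc i) (\<rho>, \<sigma>) (insert u B) :: 'k xpoly)" for u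
  have k: "kdiff m n (strand_cycle m n (Suc i) (\<rho>, \<sigma>)) B = (\<Sum>u\<in>grid m n - B. h u)"
    by (simp add: kdiff_def h_def)
  have need: "placement m \<sigma> i B \<and> fst u \<in> {1..m} \<and> snd u \<in> \<sigma> - snd ` B"
    if nz: "h u \<noteq> 0" and u: "u \<notin> B" for u
  proof -
    have p: "placement m \<sigma> (Suc i) (insert u B)"
    proof (rule ccontr)
      assume "\<not> placement m \<sigma> (Suc i) (insert u B)"
      then have "h u = 0" unfolding h_def strand_cycle_value[OF \<sigma>] by simp
      with nz show False by simp
    qed
    have "insert u B - {u} = B" using u by simp
    with placement_remove[OF s(1) p, of u] show ?thesis by simp
  qed
  show ?thesis
  proof (cases "placement m \<sigma> i B")
    case False
    then have "h u = 0" if "u \<notin> B" for u using need that by blast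
    then show ?thesis unfolding k by (intro sum.neutral) simp
  next
    case True
    let ?\<sigma> = "\<sigma> - snd ` B"
    have Bg: "B \<subseteq> grid m n" using B by (simp add: ksets_def)
    have Bi: "inj_on snd B" using True by (simp add: placement_def)
    have fB: "finite B" by (rule ksets_finite[OF B])
    have \<sigma>': "finite ?\<sigma>" "card ?\<sigma> = Suc m"
      using placement_columns[OF s(1) True] s fB by (auto simp: card_Diff_subset)
    have "(\<Sum>u\<in>grid m n - B. h u) = (\<Sum>u\<in>{1..m} \<times> ?\<sigma>. h u)"
    proof (rule sum.mono_neutral_right)
      show "{1..m} \<times> ?\<sigma> \<subseteq> grid m n - B"
      proof
        fix u assume u: "u \<in> {1..m} \<times> ?\<sigma>"
        then have "snd u \<notin> snd ` B" by (simp add: mem_Times_iff)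
        then have "u \<notin> B" by blast
        then show "u \<in> grid m n - B" using u s(3) by (auto simp: grid_def)
      qed
      show "\<forall>u\<in>grid m n - B - {1..m} \<times> ?\<sigma>. h u = 0"
      proof
        fix u assume u: "u \<in> grid m n - B - {1..m} \<times> ?\<sigma>"
        then have "u \<notin> B" "\<not> (fst u \<in> {1..m} \<and> snd u \<in> ?\<sigma>)" by (auto simp: mem_Times_iff)
        then show "h u = 0" using need by blast
      qed
    qed (simp add: finite_grid)
    also have "\<dots> = (\<Sum>r\<in>{1..m}. \<Sum>j\<in>?\<sigma>. h (r, j))"
      by (simp add: sum.cartesian_product)
    also have "\<dots> = 0"
    proof (rule sum.neutral, rule ballI)
      fix r assume r: "r \<in> {1..m}"
      \<comment> \<open>whether adding a variable in row \<open>r\<close> produces the row counts \<open>\<rho>\<close>\<close>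
      define Q where "Q \<longleftrightarrow> length \<rho> = m \<and>
        (\<forall>k<m. (if Suc k = r then Suc (rowcount B (Suc k)) else rowcount B (Suc k)) = \<rho> ! k)"
      have hj: "h (r, j) = (if Q then xconst (shuffle_sign (snd ` B) ?\<sigma> * (- 1) ^ card B) *
          (xconst (colsign j ?\<sigma>) * (vpoly (r, j) * minor m (?\<sigma> - {j}))) else 0)" if j: "j \<in> ?\<sigma>" for j
      proof -
        note ins = placement_insert[OF s(1) True r j]
        have "rowcounts m (insert (r, j) B) = \<rho> \<longleftrightarrow>
            length \<rho> = m \<and> (\<forall>k<m. rowcount (insert (r, j) B) (Suc k) = \<rho> ! k)"
          by (auto simp: rowcounts_def list_eq_iff_nth_eq simp del: upt_Suc)
        also have "\<dots> \<longleftrightarrow> Q"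
          unfolding Q_def rowcount_insert[OF fB ins(2)] fst_conv ..
        finally have Q: "rowcounts m (insert (r, j) B) = \<rho> \<longleftrightarrow> Q" .
        have im: "snd ` insert (r, j) B = insert j (snd ` B)" "\<sigma> - insert j (snd ` B) = ?\<sigma> - {j}" by auto
        have "shuffle_sign (insert j (snd ` B)) (?\<sigma> - {j}) * ksign m (r, j) B =
            shuffle_sign (snd ` B) ?\<sigma> * (- 1) ^ card B * (colsign j ?\<sigma> :: 'k)"
          by (rule shuffle_sign_insert[OF Bg Bi r]) (use \<sigma>' j in auto)
        then have sg: "xconst (ksign m (r, j) B) * xconst (shuffle_sign (insert j (snd ` B)) (?\<sigma> - {j})) =
            xconst (shuffle_sign (snd ` B) ?\<sigma> * (- 1) ^ card B) * (xconst (colsign j ?\<sigma>) :: 'k xpoly)"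
          by (simp add: xconst_mult mult.commute)
        show ?thesis
        proof (cases Q)
          case True
          have "h (r, j) = (xconst (ksign m (r, j) B) * xconst (shuffle_sign (insert j (snd ` B)) (?\<sigma> - {j}))) *
              (vpoly (r, j) * minor m (?\<sigma> - {j}))"
            unfolding h_def strand_cycle_value[OF \<sigma>] im using True Q ins by (simp add: mult_ac)
          then show ?thesis using True by (simp add: sg mult.assoc)
        next
          case False
          then show ?thesis unfolding h_def strand_cycle_value[OF \<sigma>] using Q by simp
        qed
      qed
      show "(\<Sum>j\<in>?\<sigma>. h (r, j)) = 0"
      proof (cases Q)
        case True
        have "(\<Sum>j\<in>?\<sigma>. h (r, j)) = xconst (shuffle_sign (snd ` B) ?\<sigma> * (- 1) ^ card B) *
            (\<Sum>j\<in>?\<sigma>. xconst (colsign j ?\<sigma>) * (vpoly (r, j) * minor m (?\<sigma> - {j})))"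
          unfolding sum_distrib_left by (rule sum.cong) (use True hj in auto)
        then show ?thesis by (simp add: laplace_relation[OF \<sigma>' r])
      next
        case False
        show ?thesis by (rule sum.neutral) (use False hj in auto)
      qed
    qed
    finally show ?thesis unfolding k .
  qed
qed

lemma strand_cycle_tor:
  assumes C: "C \<subseteq> colsets m n" and p: "p \<in> strand_index m n i C"
  shows "kvec m n i (strand_cycle m n i p) \<in>
    tor_cycles (koszul m n) (det_facet_ideal m n C :: 'k::field xpoly set) i (int (i + m))"
proof -
  obtain \<rho> \<sigma> where p': "p = (\<rho>, \<sigma>)" by (cases p)
  have cl: "\<sigma> \<in> clique_complex m n C" "card \<sigma> = m + i" using p by (auto simp: strand_index_def p')
  then have \<sigma>: "\<sigma> \<in> colsets (m + i) n" by (rule clique_complexD)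
  have "strand_cycle m n i p A \<in> (det_facet_ideal m n C :: 'k xpoly set) \<and> homogeneous (int m) (strand_cycle m n i p A :: 'k xpoly)" for A
  proof (cases "placement m \<sigma> i A \<and> rowcounts m A = \<rho>")
    case True
    let ?\<tau> = "\<sigma> - snd ` A"
    have t: "?\<tau> \<in> colsets m n" using placement_complement[OF \<sigma>] True by blast
    then have "card ?\<tau> = m" by (simp add: colsets_def)
    then have "?\<tau> \<in> C" using cl unfolding clique_complex_def by blast
    then have "minor m ?\<tau> \<in> det_facet_ideal m n C" by (rule minor_in_facet_ideal)
    then have "xconst c * minor m ?\<tau> \<in> det_facet_ideal m n C" for c :: 'k
      using is_ideal_facet_ideal[OF C] polyring_xconst unfolding is_ideal_def by blast
    moreover have "homogeneous (int m) (xconst c * minor m ?\<tau>)" for c :: 'k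
      using homogeneous_mult[OF homogeneous_xconst minor_homogeneous[OF t]] by simp
    ultimately show ?thesis unfolding p' strand_cycle_value[OF \<sigma>] using True by simp
  next
    case False
    then show ?thesis
      unfolding p' strand_cycle_value[OF \<sigma>]
      using is_ideal_facet_ideal[OF C, where 'a='k] by (auto simp: is_ideal_def)
  qed
  then have "kvec m n i (strand_cycle m n i p) \<in> tensor_part (koszul m n) i (det_facet_ideal m n C :: 'k xpoly set) (int (i + m))"
    by (simp add: kvec_tensor_part)
  moreover have "cdiff (koszul m n) i' (kvec m n i (strand_cycle m n i p)) = (0 :: nat \<Rightarrow> 'k xpoly)" if i: "i = Suc i'" for i'
    using strand_cycle_kdiff[of \<sigma> m i' n, where 'k='k] \<sigma> by (simp add: i cdiff_kvec kvec_zero_iff p')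
  ultimately show ?thesis by (simp add: tor_cycles_iff)
qed

text \<open>
The pair \<open>(A, \<tau>)\<close> determines the row counts and the column set \<open>\<sigma>\<close>, so exactly one basis element can
contribute to its scalar.
\<close>

lemma strand_coef_sum:
  assumes \<sigma>: "\<sigma> \<in> colsets (m + i) n" and A: "placement m \<sigma> i A"
  shows "(\<Sum>p\<in>strand_index m n i C. c p * strand_coef m i p A (\<sigma> - snd ` A)) =
    (if \<sigma> \<in> clique_complex m n C then c (rowcounts m A, \<sigma>) * shuffle_sign (snd ` A) (\<sigma> - snd ` A) else (0 :: 'k::field))"
proof -
  have s: "finite \<sigma>" "card \<sigma> = m + i" "\<sigma> \<subseteq> {1..n}" using colsetsD[OF \<sigma>] by blast+
  let ?p = "(rowcounts m A, \<sigma>)"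
  have fA: "finite A" by (rule placement_finite[OF s(1) A])
  have "sum_list (rowcounts m A) = i"
    using sum_list_rowcounts[OF fA rows_subset] A by (auto simp: placement_def)
  then have mem: "?p \<in> strand_index m n i C \<longleftrightarrow> \<sigma> \<in> clique_complex m n C"
    using s by (simp add: strand_index_def)
  have only: "p = ?p" if nz: "c p * strand_coef m i p A (\<sigma> - snd ` A) \<noteq> 0" and p: "p \<in> strand_index m n i C" for p
  proof -
    obtain \<rho> \<sigma>' where p': "p = (\<rho>, \<sigma>')" by (cases p)
    have "placement m \<sigma>' i A" "rowcounts m A = \<rho>" "\<sigma> - snd ` A = \<sigma>' - snd ` A"
      using nz by (auto simp: strand_coef_def p' split: if_splits)
    moreover from this(1) have "snd ` A \<subseteq> \<sigma>'" by (auto simp: placement_def)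
    moreover have "snd ` A \<subseteq> \<sigma>" using A by (auto simp: placement_def)
    ultimately show ?thesis by (auto simp: p')
  qed
  have "(\<Sum>p\<in>strand_index m n i C. c p * strand_coef m i p A (\<sigma> - snd ` A)) =
      (\<Sum>p\<in>{?p} \<inter> strand_index m n i C. c p * strand_coef m i p A (\<sigma> - snd ` A))"
    by (rule sum.mono_neutral_right) (use only finite_strand_index in auto)
  also have "{?p} \<inter> strand_index m n i C = (if \<sigma> \<in> clique_complex m n C then {?p} else {})"
    using mem by auto
  finally show ?thesis using A by (simp add: strand_coef_def)
qed

lemma strand_placement_exists:
  assumes \<sigma>: "finite \<sigma>" "T \<subseteq> \<sigma>" "card T = sum_list \<rho>"
  obtains A where "placement (length \<rho>) \<sigma> (sum_list \<rho>) A" "snd ` A = T" "rowcounts (length \<rho>) A = \<rho>"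
proof -
  have "finite T" using \<sigma> finite_subset by blast
  from placement_exists[OF this \<sigma>(3)] obtain A where
    A: "placement (length \<rho>) T (sum_list \<rho>) A" "snd ` A = T" "rowcounts (length \<rho>) A = \<rho>" by blast
  moreover have "placement (length \<rho>) \<sigma> (sum_list \<rho>) A"
    using A(1) \<sigma>(2) unfolding placement_def by blast
  ultimately show ?thesis using that by blast
qed

lemma strand_independent:
  assumes z: "(\<Sum>p\<in>strand_index m n i C. kscale (c p) (kvec m n i (strand_cycle m n i p))) = (0 :: nat \<Rightarrow> 'k::field xpoly)"
    and p: "p \<in> strand_index m n i C"
  shows "c p = 0"
proof -
  obtain \<rho> \<sigma> where p': "p = (\<rho>, \<sigma>)" by (cases p)
  have cl: "\<sigma> \<in> clique_complex m n C" "card \<sigma> = m + i" and \<rho>: "length \<rho> = m" "sum_list \<rho> = i"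
    using p by (auto simp: strand_index_def p')
  have \<sigma>: "\<sigma> \<in> colsets (m + i) n" by (rule clique_complexD[OF cl])
  have s: "finite \<sigma>" "card \<sigma> = m + i" "\<sigma> \<subseteq> {1..n}" using colsetsD[OF \<sigma>] by blast+
  have "sum_list \<rho> \<le> card \<sigma>" using s \<rho> by simp
  then obtain T where T: "T \<subseteq> \<sigma>" "card T = sum_list \<rho>" by (rule obtain_subset_with_card_n)
  obtain A where A: "placement m \<sigma> i A" "rowcounts m A = \<rho>"
    using strand_placement_exists[OF s(1) T] \<rho> by metis
  have AK: "A \<in> ksets m n i" by (rule placement_ksets[OF s(3) A(1)])
  have "kvec m n i (\<lambda>A. minor_comb m n (\<lambda>\<tau>. \<Sum>p\<in>strand_index m n i C. c p * strand_coef m i p A \<tau>)) =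
     (\<Sum>p\<in>strand_index m n i C. kscale (c p) (kvec m n i (strand_cycle m n i p)))"
    by (auto simp: fun_eq_iff sum_fun_apply kscale_def kvec_def strand_cycle_def minor_comb_sum)
  then have "minor_comb m n (\<lambda>\<tau>. \<Sum>p\<in>strand_index m n i C. c p * strand_coef m i p A \<tau>) = 0"
    using z AK kvec_zero_iff[of m n i "\<lambda>A. minor_comb m n (\<lambda>\<tau>. \<Sum>p\<in>strand_index m n i C. c p * strand_coef m i p A \<tau>)"]
    by simp
  from minors_independent[OF this placement_complement[OF \<sigma> A(1)]]
  have "c p * shuffle_sign (snd ` A) (\<sigma> - snd ` A) = 0"
    using strand_coef_sum[OF \<sigma> A(1), where C = C and c = c] cl A p' by simp
  then show ?thesis by (simp add: shuffle_sign_nonzero)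
qed

text \<open>
The scalar of \<open>(\<rho>, \<sigma>)\<close> is the common value of the normalised scalars on all placements in \<open>\<sigma>\<close> with row
counts \<open>\<rho>\<close>. If \<open>\<sigma>\<close> is not a clique, one of these placements leaves the columns of a set outside \<open>C\<close> free,
so the common value is \<open>0\<close>.
\<close>

lemma strand_spans:
  assumes m: "m \<ge> 1" and C: "C \<subseteq> colsets m n"
    and v: "v \<in> tor_cycles (koszul m n) (det_facet_ideal m n C) i (int (i + m))"
  shows "\<exists>c. v = (\<Sum>p\<in>strand_index m n i C. kscale (c p) (kvec m n i (strand_cycle m n i p) :: nat \<Rightarrow> 'k::field xpoly))"
proof -
  let ?J = "det_facet_ideal m n C :: 'k xpoly set"
  have vt: "v \<in> tensor_part (koszul m n) i ?J (int (i + m))" using v by (simp add: tor_cycles_iff)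
  then have "v \<in> tensor (koszul m n) i ?J" by (simp add: tensor_part_def)
  then obtain w where w: "v = kvec m n i w" by (rule tensor_koszul_kvec)
  have "\<exists>c. w A = minor_comb m n c \<and> (\<forall>\<tau>. \<tau> \<notin> C \<longrightarrow> c \<tau> = 0)" if "A \<in> ksets m n i" for A
    using vt that facet_ideal_generating_degree[OF C, of "w A"] by (simp add: w kvec_tensor_part)
  then obtain a where a: "\<And>A. A \<in> ksets m n i \<Longrightarrow> w A = minor_comb m n (a A)"
    and aC: "\<And>A \<tau>. A \<in> ksets m n i \<Longrightarrow> \<tau> \<notin> C \<Longrightarrow> a A \<tau> = 0" by metis
  have cyc: "coef_cycle m n i a"
    unfolding coef_cycle_def
  proof (intro allI impI)
    fix i' B assume i: "i = Suc i'" and B: "B \<in> ksets m n i'"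
    have "kdiff m n w B = 0" using v B by (simp add: tor_cycles_iff w i cdiff_kvec kvec_zero_iff)
    then show "linear_syzygy m n (slice m a B)" using kdiff_minor_comb[OF B] a i by metis
  qed
  define c where "c = (\<lambda>(\<rho>, \<sigma>). norm_coef a \<sigma> (SOME A. placement m \<sigma> i A \<and> rowcounts m A = \<rho>))"
  have c: "c (rowcounts m A, \<sigma>) = norm_coef a \<sigma> A" if \<sigma>: "\<sigma> \<in> colsets (m + i) n" and A: "placement m \<sigma> i A" for \<sigma> A
  proof -
    define A' where "A' = (SOME A'. placement m \<sigma> i A' \<and> rowcounts m A' = rowcounts m A)"
    have "placement m \<sigma> i A' \<and> rowcounts m A' = rowcounts m A"
      unfolding A'_def by (rule someI[of _ A]) (simp add: A)
    then show ?thesis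
      using norm_coef_constant[OF m cyc \<sigma> _ A] by (simp add: c_def A'_def[symmetric])
  qed
  have main: "a A \<tau> = (\<Sum>p\<in>strand_index m n i C. c p * strand_coef m i p A \<tau>)"
    if A: "A \<in> ksets m n i" and \<tau>: "\<tau> \<in> colsets m n" for A \<tau>
  proof (cases "inj_on snd A \<and> snd ` A \<inter> \<tau> = {}")
    case True
    have t: "finite \<tau>" "card \<tau> = m" "\<tau> \<subseteq> {1..n}" using colsetsD[OF \<tau>] by blast+
    have fA: "finite A" by (rule ksets_finite[OF A])
    have Ag: "A \<subseteq> grid m n" "card A = i" using A by (auto simp: ksets_def)
    define \<sigma> where "\<sigma> = snd ` A \<union> \<tau>"
    have "card \<sigma> = m + i"
      unfolding \<sigma>_def using True t fA Ag by (subst card_Un_disjoint) (auto simp: card_image)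
    moreover have "\<sigma> \<subseteq> {1..n}" using Ag t by (auto simp: \<sigma>_def grid_def)
    ultimately have \<sigma>: "\<sigma> \<in> colsets (m + i) n" by (simp add: colsets_def)
    have s: "finite \<sigma>" using fA t by (simp add: \<sigma>_def)
    have pl: "placement m \<sigma> i A" using Ag True unfolding placement_def \<sigma>_def grid_def by force
    have \<tau>': "\<sigma> - snd ` A = \<tau>" using True by (auto simp: \<sigma>_def)
    have "a A \<tau> = 0" if ncl: "\<sigma> \<notin> clique_complex m n C"
    proof -
      obtain \<tau>1 where \<tau>1: "\<tau>1 \<subseteq> \<sigma>" "card \<tau>1 = m" "\<tau>1 \<notin> C"
        using ncl \<open>\<sigma> \<subseteq> {1..n}\<close> by (auto simp: clique_complex_def)
      let ?\<rho> = "rowcounts m A"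
      have sl: "sum_list ?\<rho> = i" using sum_list_rowcounts[OF fA rows_subset] pl by (auto simp: placement_def)
      have "card (\<sigma> - \<tau>1) = sum_list ?\<rho>"
        using \<tau>1 s \<open>card \<sigma> = m + i\<close> sl by (simp add: card_Diff_subset finite_subset)
      then obtain A1 where A1: "placement m \<sigma> i A1" "snd ` A1 = \<sigma> - \<tau>1" "rowcounts m A1 = ?\<rho>"
        using strand_placement_exists[OF s Diff_subset, of \<tau>1 ?\<rho>] sl by (metis length_rowcounts)
      have "norm_coef a \<sigma> A = norm_coef a \<sigma> A1"
        by (rule norm_coef_constant[OF m cyc \<sigma> pl A1(1) A1(3)[symmetric]])
      also have "\<dots> = 0"
      proof -
        have "\<sigma> - snd ` A1 = \<tau>1" using A1(2) \<tau>1(1) by auto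
        moreover have "A1 \<in> ksets m n i" by (rule placement_ksets[OF \<open>\<sigma> \<subseteq> {1..n}\<close> A1(1)])
        ultimately show ?thesis using aC \<tau>1(3) by (simp add: norm_coef_def)
      qed
      finally show ?thesis by (simp add: norm_coef_def \<tau>' shuffle_sign_nonzero)
    qed
    moreover have "norm_coef a \<sigma> A * shuffle_sign (snd ` A) \<tau> =
        (shuffle_sign (snd ` A) \<tau> * shuffle_sign (snd ` A) \<tau>) * a A \<tau>"
      by (simp add: norm_coef_def \<tau>' mult_ac)
    ultimately show ?thesis
      using strand_coef_sum[OF \<sigma> pl, where C = C and c = c] by (simp add: \<tau>' c[OF \<sigma> pl] shuffle_sign_square split: if_splits)
  next
    case False
    have "a A \<tau> = 0"
    proof (cases "inj_on snd A")
      case True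
      then obtain u where "u \<in> A" "snd u \<in> \<tau>" using False by blast
      then show ?thesis by (rule coef_cycle_column_disjoint[OF cyc A \<tau>])
    next
      case False
      then show ?thesis by (rule coef_cycle_columns_distinct[OF m cyc A \<tau>])
    qed
    moreover have "strand_coef m i p A \<tau> = (0 :: 'k)" for p
      using False by (auto simp: strand_coef_def placement_def split: prod.split)
    ultimately show ?thesis by simp
  qed
  have "w A = (\<Sum>p\<in>strand_index m n i C. xconst (c p) * strand_cycle m n i p A)" if A: "A \<in> ksets m n i" for A
    unfolding strand_cycle_def minor_comb_sum a[OF A] by (rule minor_comb_cong) (rule main[OF A])
  then have "v = kvec m n i (\<lambda>A. \<Sum>p\<in>strand_index m n i C. xconst (c p) * strand_cycle m n i p A)"
    by (simp add: w kvec_eq_iff)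
  also have "\<dots> = (\<Sum>p\<in>strand_index m n i C. kscale (c p) (kvec m n i (strand_cycle m n i p)))"
    by (auto simp: fun_eq_iff sum_fun_apply kscale_def kvec_def)
  finally show ?thesis by blast
qed

section \<open>The Betti numbers of the linear strand\<close>

lemma tor_boundaries_linear_strand:
  assumes C: "C \<subseteq> colsets m n"
  shows "tor_boundaries (koszul m n) (det_facet_ideal m n C :: 'k::field xpoly set) i (int (i + m)) = {0}"
proof -
  let ?J = "det_facet_ideal m n C :: 'k xpoly set"
  have "v = 0" if v: "v \<in> tensor_part (koszul m n) (Suc i) ?J (int (i + m))" for v
  proof -
    have "v \<in> tensor (koszul m n) (Suc i) ?J" using v by (simp add: tensor_part_def)
    then obtain w where w: "v = kvec m n (Suc i) w" by (rule tensor_koszul_kvec)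
    have "w A = 0" if "A \<in> ksets m n (Suc i)" for A
    proof (rule facet_ideal_low_degree[OF C])
      show "w A \<in> ?J" using v that by (simp add: w kvec_tensor_part)
      have "homogeneous (int (i + m) - int (Suc i)) (w A)"
        using v that unfolding w kvec_tensor_part by blast
      then show "homogeneous (int m - 1) (w A)" by (simp add: algebra_simps)
    qed
    then show ?thesis by (simp add: w kvec_zero_iff)
  qed
  moreover have "0 \<in> tensor_part (koszul m n) (Suc i) ?J (int (i + m))"
    using KV.subspace_0[OF tensor_part_subspace[OF is_ideal_facet_ideal[OF C]]] .
  ultimately have "tensor_part (koszul m n) (Suc i) ?J (int (i + m)) = {0}" by blast
  then show ?thesis by (simp add: tor_boundaries_def)
qed

theorem corollary4p3:
  fixes m n i :: nat and C :: "nat set set"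
  assumes "m \<ge> 1" and "n \<ge> 1"
    and "clutter n C" and "uniform m C"
  shows "betti m n (det_facet_ideal m n C :: 'k::field xpoly set) i (int (i + m)) =
    ((m + i - 1) choose (m - 1)) * face_number (m + i - 1) (clique_complex m n C)"
proof -
  let ?J = "det_facet_ideal m n C :: 'k xpoly set"
  have C: "C \<subseteq> colsets m n" using assms by (auto simp: clutter_def uniform_def colsets_def)
  have "kdim (tor_cycles (koszul m n) ?J i (int (i + m))) = card (strand_index m n i C)"
  proof (rule KV.dim_eq_card_family[OF finite_strand_index strand_cycle_tor[OF C]])
    fix v assume "v \<in> tor_cycles (koszul m n) ?J i (int (i + m))"
    then show "\<exists>c. v = (\<Sum>p\<in>strand_index m n i C. kscale (c p) (kvec m n i (strand_cycle m n i p)))"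
      by (rule strand_spans[OF assms(1) C])
  next
    fix c p assume "(\<Sum>p\<in>strand_index m n i C. kscale (c p) (kvec m n i (strand_cycle m n i p))) = (0 :: nat \<Rightarrow> 'k xpoly)"
      and "p \<in> strand_index m n i C"
    then show "c p = 0" by (rule strand_independent)
  qed
  moreover have "kdim {0 :: nat \<Rightarrow> 'k xpoly} = 0"
    using KV.basis_card_eq_dim[of "{}" "{0 :: nat \<Rightarrow> 'k xpoly}"] by (simp add: KV.span_zero KV.independent_empty)
  ultimately show ?thesis
    unfolding betti_eq[OF koszul_resolution is_ideal_facet_ideal[OF C]]
      tor_boundaries_linear_strand[OF C]
    by (simp add: card_strand_index[OF assms(1)])
qed

end
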